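(* Let $p\geq 2$ and $s>s_p^\star$, where $s_p^\star=1/4$ if $p\leq 4$ and $s_p^\star=1/2-1/p$ if $p>4$. Let $R_s(x)=\sum_{n=1}^\infty n^{-2s}e^{2\pi i n^2 x}$ on $\mathbb T=\mathbb R/\mathbb Z$. Then, as $N\to\infty$, \[ F_{R_s,p}(N)\simeq \begin{cases} 1, & p<4,\\ \log N, & p=4,\\ N^{p/4-1}, & p>4,\end{cases} \] where the implicit constants do not depend on $N$.
   Context: $\mathbb T=\mathbb R/\mathbb Z$ and $\|\cdot\|_p$ denotes the $L^p(\mathbb T)$ norm. For $s\le 1/2$ the series defining $R_s$ is not absolutely convergent; $R_s$ is then understood as the limit in $L^p(\mathbb T)$ of its partial sums. For $f(x)=\sum_{n\in\mathbb Z}a_ne^{2\pi i n x}$, the high-pass filter is $f_{\geq N}(x)=\sum_{|n|\geq N}a_ne^{2\pi i n x}$; for $R_s$ this means $(R_s)_{\ge N}(x)=\sum_{n\ge1,\ n^2\ge N} n^{-2s}e^{2\pi i n^2x}$. The flatness in the sense of high-pass filters is $F_{f,p}(N)=\|f_{\geq N}\|_{p}^p/\|f_{\geq N}\|_{2}^p$. $A\simeq B$ means $c B\le A\le CB$ for constants $c,C>0$. *)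

theory Defs
  imports "HOL-Analysis.Analysis"
begin

text \<open>Functions on the torus R/Z are represented as functions real => complex,
  integrated over one period [0,1].\<close>

definition Lp_pow :: "real \<Rightarrow> (real \<Rightarrow> complex) \<Rightarrow> ennreal" where
  "Lp_pow p f = (\<integral>\<^sup>+ x \<in> {0..1}. ennreal (cmod (f x) powr p) \<partial>lborel)"

definition Lp_limit :: "real \<Rightarrow> (nat \<Rightarrow> real \<Rightarrow> complex) \<Rightarrow> (real \<Rightarrow> complex) \<Rightarrow> bool" where
  "Lp_limit p S g \<longleftrightarrow> g \<in> borel_measurable lborel \<and>
     (\<lambda>M. Lp_pow p (\<lambda>x. S M x - g x)) \<longlonglongrightarrow> 0"

definition Rs_high_partial :: "real \<Rightarrow> nat \<Rightarrow> nat \<Rightarrow> real \<Rightarrow> complex" where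
  "Rs_high_partial s N M x =
     sum (\<lambda>n. complex_of_real (real n powr (- 2 * s)) * cis (2 * pi * real (n ^ 2) * x))
       {n. 1 \<le> n \<and> N \<le> n ^ 2 \<and> n \<le> M}"

definition flatness :: "real \<Rightarrow> (real \<Rightarrow> complex) \<Rightarrow> real" where
  "flatness p g = enn2real (Lp_pow p g) / (enn2real (Lp_pow 2 g)) powr (p/2)"

definition s_star :: "real \<Rightarrow> real" where
  "s_star p = (if p \<le> 4 then 1/4 else 1/2 - 1/p)"

definition flat_rate :: "real \<Rightarrow> nat \<Rightarrow> real" where
  "flat_rate p N = (if p < 4 then 1 else if p = 4 then ln (real N) else real N powr (p/4 - 1))"

end

theory Submission
  imports Defs "HOL-Number_Theory.Totient"
begin

text \<open>
  Write \<open>L = \<lceil>sqrt N\<rceil>\<close>. Since the \<open>L\<^sup>2\<close> norm of the tail is of size \<open>L\<^bsup>1/2 - 2s\<^esup>\<close> by orthogonality, the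
  theorem amounts to a two-sided estimate of its \<open>L\<^sup>p\<close> norm.

  Upper bound. For a quadratic exponential sum with a tent-shaped weight of width \<open>w\<close>, Weyl
  differencing loses no logarithm: with \<open>x = a/q + \<beta>\<close> given by Dirichlet's theorem
  (\<open>q \<lesssim> w\<close>, \<open>\<bar>\<beta>\<bar> \<le> 1/(8 w q)\<close>) its square is at most a constant times
  \<open>w + (w\<^sup>2/q) (1 + w\<^sup>2 \<bar>\<beta>\<bar>)\<^bsup>-\<eta>\<^esup>\<close> for any \<open>\<eta> < 1\<close>. Taking \<open>\<eta> > 2/p\<close> and integrating over all arcs gives the
  \<open>L\<^sup>p\<close> norm for every \<open>p > 2\<close>, the three regimes coming from \<open>\<Sum>q \<lesssim> w. q\<^bsup>1 - p/2\<^esup>\<close>. A sharply cut interval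
  is a superposition of tents of geometrically decreasing widths, and partial summation together
  with a dyadic decomposition yields the weighted tails. The same bounds show that the partial sums
  are Cauchy, and Fatou's lemma provides the limit.

  Lower bound. For \<open>p < 4\<close> this is Jensen's inequality. For \<open>p = 4\<close> the coefficients are positive, so it suffices
  to count solutions of \<open>n\<^sub>1\<^sup>2 + n\<^sub>2\<^sup>2 = n\<^sub>3\<^sup>2 + n\<^sub>4\<^sup>2\<close> of size \<open>L\<close>; there are at least \<open>c L\<^sup>2 log L\<close> of them, by summing
  greatest common divisors. For \<open>p > 4\<close> one tests against a Fejer kernel.
\<close>

section \<open>Minkowski's inequality\<close>

text \<open>Differencing a sharply cut sum leaves geometric sums that decay only like the inverse
  distance to the integers; adding them over all shifts costs a logarithm, and at
  \<open>p = 4\<close> a logarithm is the answer itself. Hence the smooth weights. The exponent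
  \<eta> is squeezed from two sides: the sum over multiples of the denominator is carried out with
  \<eta> < 1, while an arc, raised to the power \<open>p/2\<close>, is integrable only if
  \<open>\<eta> * p/2 > 1\<close>. The window is nonempty exactly for \<open>p > 2\<close>, so
  \<open>p = 2\<close> is treated apart. All norms are estimated for finite sums, uniformly in the
  upper end, and only then carried to an arbitrary limit \<open>g\<close>; no property of the series
  other than convergence in norm is used. The weights enter both norms of the flatness through the
  same factor \<open>L powr (1/2 - 2*s)\<close>, which cancels: the rates do not see
  \<open>s\<close>, and \<open>s_star\<close> only decides whether dyadic blocks decay
  geometrically. The tangent inequality below is the one convexity fact of the development: it
  yields Minkowski, the comparison of exponents, and the test against the Fejer kernel.\<close>

lemma powr_ge_tangent:
  fixes z r :: real
  assumes "0 \<le> z" "1 \<le> r"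
  shows "1 + r * (z - 1) \<le> z powr r"
proof (cases "z = 0")
  case True
  then show ?thesis using assms by simp
next
  case False
  then have z: "z > 0" using assms by simp
  \<comment> \<open>Weighted arithmetic-geometric mean: \<open>z\<close> is the geometric mean of
    \<open>z powr r\<close> and \<open>1\<close> with weights \<open>1/r\<close> and
    \<open>1 - 1/r\<close>.\<close>
  have "(z powr r) powr (1/r) * 1 powr (1 - 1/r) \<le> 1/r * z powr r + (1 - 1/r) * 1"
    by (rule Youngs_inequality_0) (use assms z in auto)
  then have "z \<le> 1/r * z powr r + (1 - 1/r)"
    using assms z by (simp add: powr_powr)
  then have "r * z \<le> r * (1/r * z powr r + (1 - 1/r))"
    using assms by (intro mult_left_mono) auto
  also have "\<dots> = z powr r + r - 1"
    using assms by (simp add: field_simps)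
  finally show ?thesis by (simp add: algebra_simps)
qed

text \<open>Convexity of \<open>t powr p\<close> at the point \<open>(u + v) / (a + b)\<close>, the
  mean of \<open>u / a\<close> and \<open>v / b\<close> with weights \<open>a / (a + b)\<close> and
  \<open>b / (a + b)\<close>. When \<open>a\<close> and \<open>b\<close> are bounds for two norms,
  integration gives Minkowski's inequality with no dual exponent.\<close>

lemma powr_add_le_weighted:
  fixes a b u v p :: real
  assumes "a > 0" "b > 0" "u \<ge> 0" "v \<ge> 0" "p \<ge> 1"
  shows "(u + v) powr p \<le> (a + b) powr p * (a / (a + b) * (a powr - p * u powr p)
           + b / (a + b) * (b powr - p * v powr p))"
proof (cases "u + v = 0")
  case True
  then show ?thesis using assms by simp
next
  case False
  define z where "z = (u + v) / (a + b)"
  have z: "z > 0" using False assms by (simp add: z_def)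
  have *: "z powr p * (1 + p * (t / (c * z) - 1)) \<le> c powr - p * t powr p"
    if "c > 0" "t \<ge> 0" for c t
  proof -
    have "z powr p * (1 + p * (t / (c * z) - 1)) \<le> z powr p * (t / (c * z)) powr p"
      using that z assms by (intro mult_left_mono powr_ge_tangent) auto
    also have "\<dots> = c powr - p * t powr p"
      using that z by (simp add: powr_divide powr_mult powr_minus field_simps)
    finally show ?thesis .
  qed
  have "z powr p = a/(a+b) * (z powr p * (1 + p * (u / (a * z) - 1)))
      + b/(a+b) * (z powr p * (1 + p * (v / (b * z) - 1)))"
  proof -
    have "a/(a+b) * (z powr p * (1 + p * (u / (a * z) - 1)))
      + b/(a+b) * (z powr p * (1 + p * (v / (b * z) - 1)))
      = z powr p * ((a + b) / (a+b) + p * ((u + v) / (a + b) / z - (a+b)/(a+b)))"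
    proof -
      have 1: "c/(a+b) * (z powr p * (1 + p * (t / (c * z) - 1)))
          = z powr p / (a+b) * (c + p * (t / z - c))" if "c > 0" for c t
        using that z assms by (simp add: divide_simps)
      show ?thesis unfolding 1[OF assms(1)] 1[OF assms(2)]
        using assms z by (simp add: divide_simps) (simp add: algebra_simps)
    qed
    also have "\<dots> = z powr p" using assms z by (simp add: z_def[symmetric])
    finally show ?thesis by simp
  qed
  also have "\<dots> \<le> a / (a + b) * (a powr - p * u powr p) + b / (a + b) * (b powr - p * v powr p)"
    by (intro add_mono mult_left_mono *) (use assms in auto)
  finally have "(a + b) powr p * z powr p \<le> (a + b) powr p * (a / (a + b) * (a powr - p * u powr p)
           + b / (a + b) * (b powr - p * v powr p))"
    by (intro mult_left_mono) auto
  moreover have "(a + b) powr p * z powr p = (u + v) powr p"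
    using assms by (simp add: z_def powr_divide)
  ultimately show ?thesis by simp
qed

text \<open>The inequality \<open>\<parallel>f\<parallel>\<^sub>p \<le> a\<close>, in a form that needs no separate finiteness hypothesis.\<close>

definition Lp_bound :: "real \<Rightarrow> (real \<Rightarrow> complex) \<Rightarrow> real \<Rightarrow> bool" where
  "Lp_bound p f a \<longleftrightarrow> f \<in> borel_measurable borel \<and> 0 \<le> a \<and> Lp_pow p f \<le> ennreal (a powr p)"

lemma Lp_bound_mono: "Lp_bound p f a \<Longrightarrow> a \<le> b \<Longrightarrow> 0 \<le> p \<Longrightarrow> Lp_bound p f b"
  unfolding Lp_bound_def
  by (meson dual_order.trans ennreal_leI powr_mono2)

lemma Lp_pow_add_le:
  assumes "f \<in> borel_measurable borel" "g \<in> borel_measurable borel"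
    and "Lp_pow p f \<le> ennreal (a powr p)" "Lp_pow p g \<le> ennreal (b powr p)"
    and "a > 0" "b > 0" "p \<ge> 1"
  shows "Lp_pow p (\<lambda>x. f x + g x) \<le> ennreal ((a + b) powr p)"
proof -
  define A where "A = (a + b) powr p * (a / (a + b) * a powr - p)"
  define B where "B = (a + b) powr p * (b / (a + b) * b powr - p)"
  have AB: "A \<ge> 0" "B \<ge> 0" using assms by (auto simp: A_def B_def)
  have pt: "cmod (f x + g x) powr p \<le> A * cmod (f x) powr p + B * cmod (g x) powr p" for x
  proof -
    have "cmod (f x + g x) powr p \<le> (cmod (f x) + cmod (g x)) powr p"
      using assms by (intro powr_mono2 norm_triangle_ineq) auto
    also have "\<dots> \<le> A * cmod (f x) powr p + B * cmod (g x) powr p"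
      using powr_add_le_weighted[of a b "cmod (f x)" "cmod (g x)" p] assms
      by (simp add: A_def B_def algebra_simps)
    finally show ?thesis .
  qed
  have "Lp_pow p (\<lambda>x. f x + g x)
      \<le> (\<integral>\<^sup>+ x. ennreal A * (ennreal (cmod (f x) powr p) * indicator {0..1} x)
             + ennreal B * (ennreal (cmod (g x) powr p) * indicator {0..1} x) \<partial>lborel)"
    unfolding Lp_pow_def
    by (rule nn_integral_mono)
      (use pt AB in \<open>auto simp: indicator_def ennreal_mult[symmetric] simp flip: ennreal_plus intro!: ennreal_leI\<close>)
  also have "\<dots> = ennreal A * Lp_pow p f + ennreal B * Lp_pow p g"
    unfolding Lp_pow_def using assms(1,2)
    by (subst nn_integral_add) (auto simp: nn_integral_cmult)
  also have "\<dots> \<le> ennreal A * ennreal (a powr p) + ennreal B * ennreal (b powr p)"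
    using assms by (intro add_mono mult_left_mono) auto
  also have "\<dots> = ennreal (A * a powr p + B * b powr p)"
    using AB by (simp add: ennreal_mult ennreal_plus)
  also have "A * a powr p + B * b powr p = (a + b) powr p"
  proof -
    have 1: "a powr - p * a powr p = 1" "b powr - p * b powr p = 1"
      using assms by (simp_all flip: powr_add)
    have "A * a powr p + B * b powr p = (a + b) powr p *
        (a / (a + b) * (a powr - p * a powr p) + b / (a + b) * (b powr - p * b powr p))"
      by (simp add: A_def B_def algebra_simps)
    also have "\<dots> = (a + b) powr p * (a / (a + b) + b / (a + b))"
      unfolding 1 by simp
    also have "a / (a + b) + b / (a + b) = 1"
      using assms by (simp flip: add_divide_distrib)
    finally show ?thesis by simp
  qed
  finally show ?thesis .
qed

lemma Lp_bound_add:
  assumes "Lp_bound p f a" "Lp_bound p g b" "p \<ge> 1"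
  shows "Lp_bound p (\<lambda>x. f x + g x) (a + b)"
proof -
  \<comment> \<open>The convexity weights divide by \<open>a\<close> and \<open>b\<close>. Bounds
    equal to 0 are reached by enlarging both by \<open>inverse (real (Suc n))\<close> and letting
    \<open>n\<close> grow.\<close>
  have "Lp_pow p (\<lambda>x. f x + g x) \<le> ennreal ((a + inverse (real (Suc n)) + (b + inverse (real (Suc n)))) powr p)" for n
  proof (rule Lp_pow_add_le)
    have "Lp_bound p f (a + inverse (real (Suc n)))" "Lp_bound p g (b + inverse (real (Suc n)))"
      using assms by (auto elim!: Lp_bound_mono)
    then show "Lp_pow p f \<le> ennreal ((a + inverse (real (Suc n))) powr p)"
      "Lp_pow p g \<le> ennreal ((b + inverse (real (Suc n))) powr p)"
      by (auto simp: Lp_bound_def)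
  qed (use assms in \<open>auto simp: Lp_bound_def intro!: add_nonneg_pos\<close>)
  moreover have "(\<lambda>n. ennreal ((a + inverse (real (Suc n)) + (b + inverse (real (Suc n)))) powr p))
      \<longlonglongrightarrow> ennreal ((a + 0 + (b + 0)) powr p)"
    using assms by (intro tendsto_ennrealI tendsto_powr' tendsto_intros LIMSEQ_inverse_real_of_nat)
       (auto simp: Lp_bound_def intro!: always_eventually)
  ultimately have "Lp_pow p (\<lambda>x. f x + g x) \<le> ennreal ((a + 0 + (b + 0)) powr p)"
    using LIMSEQ_le_const by blast
  then show ?thesis using assms by (auto simp: Lp_bound_def)
qed

lemma Lp_bound_zero: "Lp_bound p (\<lambda>x. 0) 0"
  by (simp add: Lp_bound_def Lp_pow_def)

lemma Lp_bound_sum: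
  assumes "finite I" "\<And>i. i \<in> I \<Longrightarrow> Lp_bound p (f i) (a i)" "p \<ge> 1"
  shows "Lp_bound p (\<lambda>x. \<Sum>i\<in>I. f i x) (\<Sum>i\<in>I. a i)"
  using assms
proof (induction I rule: finite_induct)
  case empty
  then show ?case by (simp add: Lp_bound_zero)
next
  case (insert i I)
  then show ?case using Lp_bound_add[of p "f i" "a i" "\<lambda>x. \<Sum>i\<in>I. f i x" "\<Sum>i\<in>I. a i"] by simp
qed

lemma Lp_bound_scale:
  assumes "Lp_bound p f a" "p \<ge> 0"
  shows "Lp_bound p (\<lambda>x. c * f x) (cmod c * a)"
proof -
  have "Lp_pow p (\<lambda>x. c * f x) = ennreal (cmod c powr p) * Lp_pow p f"
    unfolding Lp_pow_def using assms
    by (subst nn_integral_cmult[symmetric])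
       (auto simp: Lp_bound_def norm_mult powr_mult ennreal_mult mult.assoc)
  also have "\<dots> \<le> ennreal (cmod c powr p) * ennreal (a powr p)"
    using assms by (intro mult_left_mono) (auto simp: Lp_bound_def)
  also have "\<dots> = ennreal ((cmod c * a) powr p)"
    using assms by (simp add: powr_mult ennreal_mult Lp_bound_def)
  finally show ?thesis using assms by (auto simp: Lp_bound_def)
qed

text \<open>Jensen on an interval of length 1, done pointwise: the tangent of
  \<open>t powr (p/2)\<close> at \<open>t = 1\<close>, taken at the square of
  \<open>cmod (f x) / a\<close>, bounds \<open>cmod (f x) powr 2\<close> by
  \<open>A * cmod (f x) powr p + B\<close>, and \<open>A * a powr p + B = a powr 2\<close>.\<close>

lemma Lp_bound_lower_exponent:
  assumes "Lp_bound p f a" "2 \<le> p" "a > 0"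
  shows "Lp_bound 2 f a"
proof -
  define A where "A = 2 / p * a powr (2 - p)"
  define B where "B = (1 - 2 / p) * a powr 2"
  have AB: "A \<ge> 0" "B \<ge> 0" using assms by (auto simp: A_def B_def)
  have pt: "cmod (f x) powr 2 \<le> A * cmod (f x) powr p + B" for x
  proof -
    have "1 + p/2 * ((cmod (f x) / a) powr 2 - 1) \<le> ((cmod (f x) / a) powr 2) powr (p/2)"
      using assms by (intro powr_ge_tangent) auto
    also have "\<dots> = cmod (f x) powr p / a powr p"
      using assms by (simp add: powr_powr powr_divide del: powr_numeral)
    finally have "p/2 * (cmod (f x) powr 2 / a powr 2) \<le> cmod (f x) powr p / a powr p + (p/2 - 1)"
      using assms by (simp add: powr_divide algebra_simps del: powr_numeral)
    then have "2 / p * a powr 2 * (p/2 * (cmod (f x) powr 2 / a powr 2))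
        \<le> 2 / p * a powr 2 * (cmod (f x) powr p / a powr p + (p/2 - 1))"
      using assms by (intro mult_left_mono) auto
    also have "2 / p * a powr 2 * (p/2 * (cmod (f x) powr 2 / a powr 2)) = cmod (f x) powr 2"
      using assms by simp
    also have "2 / p * a powr 2 * (cmod (f x) powr p / a powr p + (p/2 - 1)) = A * cmod (f x) powr p + B"
      using assms by (simp add: A_def B_def powr_diff field_simps del: powr_numeral)
    finally show ?thesis .
  qed
  have m: "f \<in> borel_measurable borel" using assms by (simp add: Lp_bound_def)
  have "Lp_pow 2 f \<le> (\<integral>\<^sup>+ x. ennreal A * (ennreal (cmod (f x) powr p) * indicator {0..1} x)
             + ennreal B * indicator {0..1} x \<partial>lborel)"
    unfolding Lp_pow_def
    by (rule nn_integral_mono)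
      (use pt AB in \<open>auto simp: indicator_def ennreal_mult[symmetric] simp flip: ennreal_plus intro!: ennreal_leI simp del: powr_numeral\<close>)
  also have "\<dots> = ennreal A * Lp_pow p f + ennreal B"
    unfolding Lp_pow_def using m
    by (subst nn_integral_add) (auto simp: nn_integral_cmult)
  also have "\<dots> \<le> ennreal A * ennreal (a powr p) + ennreal B"
    using assms by (intro add_mono mult_left_mono) (auto simp: Lp_bound_def)
  also have "\<dots> = ennreal (A * a powr p + B)"
    using AB by (simp add: ennreal_mult)
  also have "A * a powr p + B = a powr 2"
    using assms by (simp add: A_def B_def powr_diff field_simps del: powr_numeral)
  finally show ?thesis using assms m by (auto simp: Lp_bound_def)
qed

section \<open>Trigonometric polynomials\<close>

definition unit_exp :: "real \<Rightarrow> complex" where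
  "unit_exp x = cis (2 * pi * x)"

lemma unit_exp_add: "unit_exp (x + y) = unit_exp x * unit_exp y"
  by (simp add: unit_exp_def cis_mult algebra_simps)

lemma cnj_unit_exp: "cnj (unit_exp x) = unit_exp (- x)"
  by (simp add: unit_exp_def cis_cnj)

lemma norm_unit_exp [simp]: "cmod (unit_exp x) = 1"
  by (simp add: unit_exp_def)

lemma unit_exp_int [simp]: "unit_exp (of_int k) = 1"
  by (auto simp: unit_exp_def complex_eq_iff intro: cos_int_2pin sin_int_2pin)

lemma unit_exp_0 [simp]: "unit_exp 0 = 1"
  by (simp add: unit_exp_def)

lemma unit_exp_power: "unit_exp x ^ n = unit_exp (real n * x)"
  by (simp add: unit_exp_def Complex.DeMoivre mult_ac)

lemma continuous_on_unit_exp [continuous_intros]: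
  "continuous_on S f \<Longrightarrow> continuous_on S (\<lambda>x. unit_exp (f x))"
  unfolding unit_exp_def by (intro continuous_intros)

lemma has_integral_unit_exp:
  fixes k :: int
  shows "((\<lambda>x. unit_exp (of_int k * x)) has_integral (if k = 0 then 1 else 0)) {0..1}"
proof (cases "k = 0")
  case True
  then show ?thesis using has_integral_const_real[of "1::complex" 0 1] by simp
next
  case False
  define c where "c = 2 * pi * of_int k"
  have c: "c \<noteq> 0" using False by (simp add: c_def)
  have d: "((\<lambda>x. cis (c * x) / (\<i> * complex_of_real c)) has_vector_derivative unit_exp (of_int k * x)) (at x within {0..1})" for x
  proof -
    have "((\<lambda>x. cis (c * x) / (\<i> * complex_of_real c)) has_vector_derivative
        (complex_of_real c * \<i> * cis (c * x)) / (\<i> * complex_of_real c)) (at x within {0..1})"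
      unfolding has_vector_derivative_def
      by (rule has_derivative_eq_rhs, (rule derivative_intros)+)
         (use c in \<open>auto simp: fun_eq_iff scaleR_conv_of_real field_simps\<close>)
    then show ?thesis using c by (simp add: unit_exp_def c_def mult.assoc)
  qed
  have "((\<lambda>x. unit_exp (of_int k * x)) has_integral
      (cis (c * 1) / (\<i> * complex_of_real c) - cis (c * 0) / (\<i> * complex_of_real c))) {0..1}"
    by (rule fundamental_theorem_of_calculus) (use d in auto)
  moreover have "cis (c * 1) = 1" using unit_exp_int[of k] by (simp add: unit_exp_def c_def)
  ultimately show ?thesis using False by simp
qed

text \<open>The frequencies may coincide. For injective \<open>k\<close> this is orthogonality; for
  the square of a trigonometric polynomial the coincidences count solutions of a Diophantine
  equation.\<close>

lemma has_integral_norm_sq_trig: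
  fixes k :: "'i \<Rightarrow> int" and c :: "'i \<Rightarrow> real"
  assumes "finite I"
  shows "((\<lambda>x. (cmod (\<Sum>i\<in>I. of_real (c i) * unit_exp (of_int (k i) * x)))\<^sup>2) has_integral
     (\<Sum>i\<in>I. \<Sum>j\<in>I. if k i = k j then c i * c j else 0)) {0..1}"
proof -
  have eq: "complex_of_real ((cmod (\<Sum>i\<in>I. of_real (c i) * unit_exp (of_int (k i) * x)))\<^sup>2)
     = (\<Sum>i\<in>I. \<Sum>j\<in>I. of_real (c i * c j) * unit_exp (of_int (k i - k j) * x))" for x
  proof -
    have "complex_of_real ((cmod (\<Sum>i\<in>I. of_real (c i) * unit_exp (of_int (k i) * x)))\<^sup>2)
       = (\<Sum>i\<in>I. of_real (c i) * unit_exp (of_int (k i) * x)) * cnj (\<Sum>j\<in>I. of_real (c j) * unit_exp (of_int (k j) * x))"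
      by (rule complex_norm_square)
    also have "\<dots> = (\<Sum>i\<in>I. \<Sum>j\<in>I. of_real (c i * c j) * (unit_exp (of_int (k i) * x) * unit_exp (- (of_int (k j) * x))))"
      by (simp add: sum_product cnj_unit_exp mult_ac)
    also have "\<dots> = (\<Sum>i\<in>I. \<Sum>j\<in>I. of_real (c i * c j) * unit_exp (of_int (k i - k j) * x))"
      by (simp flip: unit_exp_add add: algebra_simps)
    finally show ?thesis .
  qed
  have "((\<lambda>x. \<Sum>i\<in>I. \<Sum>j\<in>I. of_real (c i * c j) * unit_exp (of_int (k i - k j) * x)) has_integral
     (\<Sum>i\<in>I. \<Sum>j\<in>I. of_real (c i * c j) * (if k i - k j = 0 then 1 else 0))) {0..1}"
    by (intro has_integral_sum assms has_integral_mult_right has_integral_unit_exp)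
  then have "((\<lambda>x. complex_of_real ((cmod (\<Sum>i\<in>I. of_real (c i) * unit_exp (of_int (k i) * x)))\<^sup>2)) has_integral
     (\<Sum>i\<in>I. \<Sum>j\<in>I. of_real (c i * c j) * (if k i - k j = 0 then 1 else 0))) {0..1}"
    unfolding eq .
  from has_integral_Re[OF this] show ?thesis
    by (simp only: Re_complex_of_real) (erule has_integral_eq_rhs, auto intro!: sum.cong)
qed

lemma Lp_pow_2_trig:
  fixes k :: "'i \<Rightarrow> int" and c :: "'i \<Rightarrow> real"
  assumes "finite I" "inj_on k I"
  shows "Lp_pow 2 (\<lambda>x. \<Sum>i\<in>I. of_real (c i) * unit_exp (of_int (k i) * x)) = ennreal (\<Sum>i\<in>I. (c i)\<^sup>2)"
proof -
  have "(\<Sum>i\<in>I. \<Sum>j\<in>I. if k i = k j then c i * c j else 0) = (\<Sum>i\<in>I. \<Sum>j\<in>I. if i = j then c i * c j else 0)"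
    using assms(2) by (intro sum.cong) (auto dest: inj_onD)
  also have "\<dots> = (\<Sum>i\<in>I. (c i)\<^sup>2)"
    using assms(1) by (simp add: power2_eq_square)
  finally have *: "(\<Sum>i\<in>I. \<Sum>j\<in>I. if k i = k j then c i * c j else 0) = (\<Sum>i\<in>I. (c i)\<^sup>2)" .
  show ?thesis
    unfolding Lp_pow_def *[symmetric]
    using has_integral_norm_sq_trig[OF assms(1), of c k]
    by (simp add: nn_integral_has_integral_lebesgue')
qed

section \<open>Weyl differencing with tent weights\<close>

definition tent :: "real \<Rightarrow> real \<Rightarrow> real" where
  "tent w t = max 0 (1 - \<bar>t - w\<bar> / w)"

lemma tent_nonneg: "0 \<le> tent w t"
  by (simp add: tent_def)

lemma tent_le_1: "w > 0 \<Longrightarrow> tent w t \<le> 1"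
  by (simp add: tent_def)

lemma tent_0: "w > 0 \<Longrightarrow> tent w 0 = 0"
  by (simp add: tent_def)

lemma tent_eq_0: "w > 0 \<Longrightarrow> 2 * w \<le> t \<Longrightarrow> tent w t = 0"
  by (simp add: tent_def field_simps)

lemma tent_ramps:
  assumes "w > 0" "t \<ge> 0"
  shows "tent w t = (max 0 t - 2 * max 0 (t - w) + max 0 (t - 2 * w)) / w"
  using assms by (auto simp: tent_def max_def abs_if field_simps)

lemma tent_diff_le:
  assumes "w > 0"
  shows "\<bar>tent w (t + 1) - tent w t\<bar> \<le> 1 / w"
proof -
  have "\<bar>tent w (t + 1) - tent w t\<bar> \<le> \<bar>\<bar>t + 1 - w\<bar> / w - \<bar>t - w\<bar> / w\<bar>"
    by (auto simp: tent_def max_def abs_if)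
  also have "\<dots> = \<bar>\<bar>t + 1 - w\<bar> - \<bar>t - w\<bar>\<bar> / w"
    using assms by (simp add: diff_divide_distrib[symmetric])
  also have "\<dots> \<le> 1 / w"
    using assms by (intro divide_right_mono) auto
  finally show ?thesis .
qed

lemma sum_abs_second_diff_ramp:
  fixes c :: real
  shows "(\<Sum>m<M. \<bar>max 0 (real (m + 2) - c) - 2 * max 0 (real (m + 1) - c) + max 0 (real m - c)\<bar>) \<le> 1"
proof -
  define r where "r m = max 0 (real (m + 1) - c) - max 0 (real m - c)" for m
  have "(\<Sum>m<M. \<bar>max 0 (real (m + 2) - c) - 2 * max 0 (real (m + 1) - c) + max 0 (real m - c)\<bar>)
      = (\<Sum>m<M. r (Suc m) - r m)"
    by (intro sum.cong) (auto simp: r_def max_def)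
  also have "\<dots> = r M - r 0" by (rule sum_lessThan_telescope)
  also have "\<dots> \<le> 1" by (auto simp: r_def max_def)
  finally show ?thesis .
qed

text \<open>A tent combines ramps starting at its kinks \<open>0\<close>, \<open>w\<close>,
  \<open>2 * w\<close> with coefficients 1, -2, 1 divided by \<open>w\<close>; hence
  \<open>(1 + 2 + 1) / w\<close>.\<close>

lemma sum_abs_second_diff_tent:
  assumes "w > 0"
  shows "(\<Sum>m<M. \<bar>tent w (real (m + h + 2)) - 2 * tent w (real (m + h + 1)) + tent w (real (m + h))\<bar>) \<le> 4 / w"
proof -
  define D where "D c m = \<bar>max 0 (real (m + 2) - c) - 2 * max 0 (real (m + 1) - c) + max 0 (real m - c)\<bar>" for c m
  have gen: "\<bar>(X - 2 * Y + Z) / w\<bar> \<le> (\<bar>X\<bar> + 2 * \<bar>Y\<bar> + \<bar>Z\<bar>) / w" for X Y Z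
    using assms by (simp add: abs_divide divide_right_mono)
  have "(\<Sum>m<M. \<bar>tent w (real (m + h + 2)) - 2 * tent w (real (m + h + 1)) + tent w (real (m + h))\<bar>)
     \<le> (\<Sum>m<M. (D (-real h) m + 2 * D (w - real h) m + D (2 * w - real h) m) / w)"
  proof (rule sum_mono)
    fix m
    have "tent w (real (m + h + 2)) - 2 * tent w (real (m + h + 1)) + tent w (real (m + h))
      = ((max 0 (real (m + 2) - (- real h)) - 2 * max 0 (real (m + 1) - (- real h)) + max 0 (real m - (- real h)))
       - 2 * (max 0 (real (m + 2) - (w - real h)) - 2 * max 0 (real (m + 1) - (w - real h)) + max 0 (real m - (w - real h)))
       + (max 0 (real (m + 2) - (2 * w - real h)) - 2 * max 0 (real (m + 1) - (2 * w - real h)) + max 0 (real m - (2 * w - real h)))) / w"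
      using assms by (subst (1 2 3) tent_ramps) (auto simp: algebra_simps add_divide_distrib diff_divide_distrib)
    then show "\<bar>tent w (real (m + h + 2)) - 2 * tent w (real (m + h + 1)) + tent w (real (m + h))\<bar>
       \<le> (D (-real h) m + 2 * D (w - real h) m + D (2 * w - real h) m) / w"
      unfolding D_def by (simp only: gen)
  qed
  also have "\<dots> = ((\<Sum>m<M. D (-real h) m) + 2 * (\<Sum>m<M. D (w - real h) m) + (\<Sum>m<M. D (2 * w - real h) m)) / w"
    by (simp add: sum.distrib sum_divide_distrib[symmetric] sum_distrib_left)
  also have "\<dots> \<le> (1 + 2 * 1 + 1) / w"
    using assms unfolding D_def by (intro divide_right_mono add_mono mult_left_mono sum_abs_second_diff_ramp) auto
  finally show ?thesis by simp
qed

lemma sum_abs_diff_tent: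
  assumes "w \<ge> 1/2"
  shows "(\<Sum>m<M. \<bar>tent w (real m + 1) - tent w (real m)\<bar>) \<le> 4"
proof -
  have "(\<Sum>m<M. \<bar>tent w (real m + 1) - tent w (real m)\<bar>)
      = (\<Sum>m\<in>{m. m < M \<and> real m < 2 * w}. \<bar>tent w (real m + 1) - tent w (real m)\<bar>)"
  proof (rule sum.mono_neutral_right)
    have "tent w (real m + 1) = tent w (real m)" if "\<not> real m < 2 * w" for m
      using that assms by (simp add: tent_eq_0)
    then show "\<forall>m\<in>{..<M} - {m. m < M \<and> real m < 2 * w}. \<bar>tent w (real m + 1) - tent w (real m)\<bar> = 0"
      by simp
  qed auto
  also have "\<dots> \<le> (\<Sum>m\<in>{m. m < M \<and> real m < 2 * w}. 1 / w)"
    using assms by (intro sum_mono tent_diff_le) auto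
  also have "\<dots> = real (card {m. m < M \<and> real m < 2 * w}) / w" by simp
  also have "card {m. m < M \<and> real m < 2 * w} \<le> card {..<nat \<lceil>2 * w\<rceil>}"
    by (intro card_mono) (auto, linarith)
  then have "real (card {m. m < M \<and> real m < 2 * w}) / w \<le> (2 * w + 1) / w"
    using assms by (intro divide_right_mono) (auto, linarith)
  also have "\<dots> \<le> 4" using assms by (simp add: field_simps)
  finally show ?thesis .
qed

lemma sum_shift_zero:
  fixes f :: "nat \<Rightarrow> 'a::comm_ring_1"
  assumes "f M = 0"
  shows "(\<Sum>m<M. f (Suc m)) = (\<Sum>m<M. f m) - f 0"
  using sum.lessThan_Suc_shift[of f M] assms by simp

text \<open>Two summations by parts at once. As \<open>v\<close> vanishes at 0 and from
  \<open>M\<close> on, the only boundary term left is \<open>v 1 * z\<close>.\<close>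

lemma second_difference_sum:
  fixes v :: "nat \<Rightarrow> complex" and z :: complex
  assumes "v 0 = 0" "\<And>m. m \<ge> M \<Longrightarrow> v m = 0"
  shows "(1 - z)\<^sup>2 * (\<Sum>m<M. v m * z ^ m) =
     v 1 * z + (\<Sum>m<M. (v (m + 2) - 2 * v (m + 1) + v m) * z ^ (m + 2))"
proof -
  define S where "S = (\<Sum>m<M. v m * z ^ m)"
  have 1: "(\<Sum>m<M. v (m + 1) * z ^ (m + 1)) = S"
    using sum_shift_zero[of "\<lambda>m. v m * z ^ m" M] assms by (simp add: S_def)
  have 2: "(\<Sum>m<M. v (m + 2) * z ^ (m + 2)) = S - v 1 * z"
    using sum_shift_zero[of "\<lambda>m. v (m + 1) * z ^ (m + 1)" M] assms 1 by simp
  have "(\<Sum>m<M. (v (m + 2) - 2 * v (m + 1) + v m) * z ^ (m + 2))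
     = (\<Sum>m<M. v (m + 2) * z ^ (m + 2)) - 2 * z * (\<Sum>m<M. v (m + 1) * z ^ (m + 1)) + z\<^sup>2 * S"
    by (simp add: S_def sum_distrib_left sum.distrib sum_subtractf algebra_simps power2_eq_square)
  also have "\<dots> = (1 - z)\<^sup>2 * S - v 1 * z"
    unfolding 1 2 by (simp add: algebra_simps power2_eq_square)
  finally show ?thesis by (simp add: S_def)
qed

text \<open>The double sum grouped by the difference \<open>h\<close> of the indices; negative
  differences are the conjugates of positive ones, whence twice the real part.\<close>

lemma norm_sq_sum:
  fixes c :: "nat \<Rightarrow> complex"
  shows "(cmod (\<Sum>l<M. c l))\<^sup>2 = (\<Sum>l<M. (cmod (c l))\<^sup>2)
     + 2 * Re (\<Sum>h\<in>{1..<M}. \<Sum>m<M-h. c (m + h) * cnj (c m))"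
proof (induction M)
  case 0
  then show ?case by simp
next
  case (Suc M)
  have "(\<Sum>h\<in>{1..<Suc M}. \<Sum>m<Suc M-h. c (m + h) * cnj (c m))
     = (\<Sum>h\<in>{1..<Suc M}. (\<Sum>m<M-h. c (m + h) * cnj (c m)) + c M * cnj (c (M - h)))"
    by (intro sum.cong) (auto simp: Suc_diff_le)
  also have "\<dots> = (\<Sum>h\<in>{1..<M}. (\<Sum>m<M-h. c (m + h) * cnj (c m))) + c M * (\<Sum>h\<in>{1..<Suc M}. cnj (c (M - h)))"
    by (cases "M = 0") (simp_all add: sum.distrib sum_distrib_left distrib_left)
  also have "(\<Sum>h\<in>{1..<Suc M}. cnj (c (M - h))) = cnj (\<Sum>m<M. c m)"
    unfolding cnj_sum
    by (rule sum.reindex_bij_witness[of _ "\<lambda>m. M - m" "\<lambda>m. M - m"]) auto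
  finally have *: "(\<Sum>h\<in>{1..<Suc M}. \<Sum>m<Suc M-h. c (m + h) * cnj (c m))
     = (\<Sum>h\<in>{1..<M}. (\<Sum>m<M-h. c (m + h) * cnj (c m))) + c M * cnj (\<Sum>m<M. c m)" .
  have "(cmod (z + w))\<^sup>2 = (cmod z)\<^sup>2 + (cmod w)\<^sup>2 + 2 * Re (w * cnj z)" for z w
    unfolding cmod_power2 by (simp add: algebra_simps power2_eq_square)
  from this[of "\<Sum>l<M. c l" "c M"] show ?case
    unfolding * by (simp add: Suc.IH)
qed

lemma sum_tent_le:
  assumes "w \<ge> 1/2" "\<And>m. f m \<le> tent w (real m)"
  shows "(\<Sum>m<M. f m) \<le> 2 * w + 1"
proof -
  have "(\<Sum>m<M. f m) \<le> (\<Sum>m<M. tent w (real m))"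
    using assms by (intro sum_mono) auto
  also have "\<dots> = (\<Sum>m\<in>{m. m < M \<and> real m < 2 * w}. tent w (real m))"
  proof (rule sum.mono_neutral_right)
    show "\<forall>m\<in>{..<M} - {m. m < M \<and> real m < 2 * w}. tent w (real m) = 0"
    proof
      fix m assume "m \<in> {..<M} - {m. m < M \<and> real m < 2 * w}"
      then have "2 * w \<le> real m" by auto
      then show "tent w (real m) = 0" using assms(1) by (intro tent_eq_0) auto
    qed
  qed auto
  also have "\<dots> \<le> (\<Sum>m\<in>{m. m < M \<and> real m < 2 * w}. 1)"
    using assms by (intro sum_mono tent_le_1) auto
  also have "\<dots> = real (card {m. m < M \<and> real m < 2 * w})" by simp
  also have "card {m. m < M \<and> real m < 2 * w} \<le> card {..<nat \<lceil>2 * w\<rceil>}"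
    by (intro card_mono) (auto, linarith)
  then have "real (card {m. m < M \<and> real m < 2 * w}) \<le> (2 * w + 1)"
    using assms by (auto, linarith)
  finally show ?thesis .
qed

text \<open>By the discrete Leibniz rule the second difference of a product of two tents consists of
  a second difference of either factor, each of total \<open>4 / w\<close>, and twice a product of
  first differences, of total at most \<open>2 / w * 4\<close>. The boundary term adds
  \<open>1 / w\<close>, which makes 17.\<close>

lemma tent_autocorrelation_bound:
  fixes z :: complex
  assumes "w \<ge> 1/2" "2 * w \<le> real M" "cmod z = 1"
  shows "(cmod (1 - z))\<^sup>2 * cmod (\<Sum>m<M. of_real (tent w (real m) * tent w (real (m + h))) * z ^ m) \<le> 17 / w"
proof -
  define f where "f m = tent w (real m)" for m
  define g where "g m = tent w (real (m + h))" for m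
  have k: "w > 0" using assms by simp
  have f: "0 \<le> f m" "f m \<le> 1" "0 \<le> g m" "g m \<le> 1" for m
    using k by (auto simp: f_def g_def tent_nonneg tent_le_1)
  have df: "\<bar>f (m + 1) - f m\<bar> \<le> 1/w" "\<bar>g (m + 1) - g m\<bar> \<le> 1/w" for m
    using tent_diff_le[OF k, of "real m"] tent_diff_le[OF k, of "real (m + h)"]
    by (simp_all add: f_def g_def add_ac)
  define v where "v m = f m * g m" for m
  define d where "d m = v (m + 2) - 2 * v (m + 1) + v m" for m
  have v0: "v 0 = 0" "\<And>m. m \<ge> M \<Longrightarrow> v m = 0"
    using assms k by (auto simp: v_def f_def tent_0 tent_eq_0)
  have d_le: "\<bar>d m\<bar> \<le> \<bar>f (m + 2) - 2 * f (m + 1) + f m\<bar> + \<bar>g (m + 2) - 2 * g (m + 1) + g m\<bar>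
      + 2 / w * \<bar>f (m + 1) - f m\<bar>" for m
  proof -
    have "d m = g (m + 2) * (f (m + 2) - 2 * f (m + 1) + f m) + f m * (g (m + 2) - 2 * g (m + 1) + g m)
       + 2 * (g (m + 2) - g (m + 1)) * (f (m + 1) - f m)"
      by (simp add: d_def v_def algebra_simps)
    then have "\<bar>d m\<bar> \<le> \<bar>g (m + 2) * (f (m + 2) - 2 * f (m + 1) + f m)\<bar> + \<bar>f m * (g (m + 2) - 2 * g (m + 1) + g m)\<bar>
       + \<bar>2 * (g (m + 2) - g (m + 1)) * (f (m + 1) - f m)\<bar>"
      by linarith
    also have "\<dots> \<le> 1 * \<bar>f (m + 2) - 2 * f (m + 1) + f m\<bar> + 1 * \<bar>g (m + 2) - 2 * g (m + 1) + g m\<bar>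
       + 2 * (1 / w) * \<bar>f (m + 1) - f m\<bar>"
      unfolding abs_mult
      by (intro add_mono mult_mono) (use f df[of "m + 1"] k in auto)
    finally show ?thesis by simp
  qed
  have "(\<Sum>m<M. \<bar>d m\<bar>) \<le> (\<Sum>m<M. \<bar>f (m + 2) - 2 * f (m + 1) + f m\<bar>)
      + (\<Sum>m<M. \<bar>g (m + 2) - 2 * g (m + 1) + g m\<bar>) + 2 / w * (\<Sum>m<M. \<bar>f (m + 1) - f m\<bar>)"
    unfolding sum_distrib_left sum.distrib[symmetric] by (intro sum_mono d_le)
  also have "\<dots> \<le> 4 / w + 4 / w + 2 / w * 4"
  proof (intro add_mono mult_left_mono)
    show "(\<Sum>m<M. \<bar>f (m + 2) - 2 * f (m + 1) + f m\<bar>) \<le> 4 / w"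
      using sum_abs_second_diff_tent[OF k, where h = 0 and M = M] by (simp add: f_def)
    show "(\<Sum>m<M. \<bar>g (m + 2) - 2 * g (m + 1) + g m\<bar>) \<le> 4 / w"
      using sum_abs_second_diff_tent[OF k, where h = h and M = M] by (simp add: g_def add_ac)
    show "(\<Sum>m<M. \<bar>f (m + 1) - f m\<bar>) \<le> 4"
      using sum_abs_diff_tent[OF assms(1), of M] by (simp add: f_def add_ac)
  qed (use k in auto)
  finally have D: "(\<Sum>m<M. \<bar>d m\<bar>) \<le> 16 / w" by simp
  have "v 1 \<le> 1 / w"
  proof -
    have "v 1 \<le> f 1 * 1" unfolding v_def using f by (intro mult_left_mono) auto
    also have "f 1 \<le> 1/w" using df(1)[of 0] k by (simp add: f_def tent_0)
    finally show ?thesis by simp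
  qed
  moreover have "v 1 \<ge> 0" using f by (simp add: v_def)
  ultimately have v1: "\<bar>v 1\<bar> \<le> 1/w" by simp
  have "(cmod (1 - z))\<^sup>2 * cmod (\<Sum>m<M. of_real (v m) * z ^ m)
      = cmod (of_real (v 1) * z + (\<Sum>m<M. (of_real (v (m + 2)) - 2 * of_real (v (m + 1)) + of_real (v m)) * z ^ (m + 2)))"
    using second_difference_sum[of "\<lambda>m. complex_of_real (v m)" M z] v0
    by (simp only: norm_mult[symmetric] norm_power[symmetric] of_real_0)
  also have "\<dots> = cmod (of_real (v 1) * z + (\<Sum>m<M. of_real (d m) * z ^ (m + 2)))"
    by (simp add: d_def)
  also have "\<dots> \<le> cmod (of_real (v 1) * z) + (\<Sum>m<M. cmod (of_real (d m) * z ^ (m + 2)))"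
    by (rule order_trans[OF norm_triangle_ineq]) (intro add_left_mono norm_sum)
  also have "\<dots> = \<bar>v 1\<bar> + (\<Sum>m<M. \<bar>d m\<bar>)"
    using assms(3) by (simp add: norm_mult norm_power)
  also have "\<dots> \<le> 1/w + 16/w" using v1 D by (intro add_mono)
  finally show ?thesis by (simp add: v_def f_def g_def)
qed

text \<open>The shift \<open>D\<close> makes room for tents placed anywhere on the line: differencing turns it into
  a phase that is constant in the inner sum, so every bound below is uniform in \<open>D\<close>.\<close>

definition tent_sum :: "real \<Rightarrow> nat \<Rightarrow> real \<Rightarrow> real \<Rightarrow> complex" where
  "tent_sum w M D x = (\<Sum>l<M. of_real (tent w (real l)) * unit_exp ((D + real l)\<^sup>2 * x))"

text \<open>A bound for \<open>\<Sum>m. tent m * tent (m + h) * z ^ m\<close> with \<open>z = unit_exp y\<close>: the trivial one, or the one from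
  two summations by parts. The quadratic decay is what makes the sum over \<open>h\<close> converge without a logarithm.\<close>

definition corr_bound :: "real \<Rightarrow> real \<Rightarrow> real" where
  "corr_bound w y = (if unit_exp y = 1 then 2 * w + 1 else min (2 * w + 1) (17 / (w * (cmod (1 - unit_exp y))\<^sup>2)))"

lemma corr_bound_nonneg: "w > 0 \<Longrightarrow> 0 \<le> corr_bound w y"
  by (auto simp: corr_bound_def)

text \<open>For two indices at distance \<open>h\<close> the phase difference is linear in the
  smaller one, with slope \<open>2 * h * x\<close>; so each inner sum is an autocorrelation of the
  tent. Tents at distance \<open>2 * w\<close> or more do not overlap, which limits
  \<open>t = 2 * h\<close> to \<open>4 * w\<close>.\<close>

lemma weyl_tent:
  assumes "w \<ge> 1/2" "2 * w \<le> real M"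
  shows "(cmod (tent_sum w M D x))\<^sup>2 \<le> (2 * w + 1) + 2 * (\<Sum>t\<in>{1..nat \<lfloor>4 * w\<rfloor>}. corr_bound w (real t * x))"
proof -
  have k: "w > 0" using assms by simp
  define c where "c l = of_real (tent w (real l)) * unit_exp ((D + real l)\<^sup>2 * x)" for l
  define H where "H = {h. 1 \<le> h \<and> real h < 2 * w}"
  have finH: "finite H"
    by (rule finite_subset[of _ "{..nat \<lceil>2 * w\<rceil>}"]) (auto simp: H_def, linarith)
  have A: "cmod (\<Sum>m<M-h. c (m + h) * cnj (c m)) \<le> (if h \<in> H then corr_bound w (real (2 * h) * x) else 0)" if "h \<ge> 1" for h
  proof (cases "h \<in> H")
    case False
    then have "c (m + h) = 0" for m
      using that k by (auto simp: H_def c_def tent_eq_0)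
    then show ?thesis using False by simp
  next
    case True
    define z where "z = unit_exp (real (2 * h) * x)"
    have z: "cmod z = 1" by (simp add: z_def)
    have "c (m + h) * cnj (c m) = unit_exp ((2 * D * h + h\<^sup>2) * x) * (of_real (tent w (real m) * tent w (real (m + h))) * z ^ m)" for m
    proof -
      have "c (m + h) * cnj (c m) = of_real (tent w (real m) * tent w (real (m + h))) *
          (unit_exp ((D + real (m + h))\<^sup>2 * x) * unit_exp (- ((D + real m)\<^sup>2 * x)))"
        by (simp add: c_def cnj_unit_exp mult_ac)
      also have "unit_exp ((D + real (m + h))\<^sup>2 * x) * unit_exp (- ((D + real m)\<^sup>2 * x))
         = unit_exp ((2 * D * h + h\<^sup>2) * x) * z ^ m"
        unfolding z_def unit_exp_power unit_exp_add[symmetric]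
        by (rule arg_cong[of _ _ unit_exp]) (simp add: algebra_simps power2_eq_square)
      finally show ?thesis by (simp add: mult_ac)
    qed
    then have "(\<Sum>m<M-h. c (m + h) * cnj (c m)) =
        unit_exp ((2 * D * h + h\<^sup>2) * x) * (\<Sum>m<M-h. of_real (tent w (real m) * tent w (real (m + h))) * z ^ m)"
      by (simp add: sum_distrib_left)
    also have "(\<Sum>m<M-h. of_real (tent w (real m) * tent w (real (m + h))) * z ^ m)
        = (\<Sum>m<M. of_real (tent w (real m) * tent w (real (m + h))) * z ^ m)"
      using assms k by (intro sum.mono_neutral_left) (auto simp: tent_eq_0)
    finally have e: "cmod (\<Sum>m<M-h. c (m + h) * cnj (c m)) =
        cmod (\<Sum>m<M. of_real (tent w (real m) * tent w (real (m + h))) * z ^ m)" (is "_ = cmod ?A")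
      by (simp add: norm_mult)
    have "cmod ?A \<le> (\<Sum>m<M. tent w (real m) * tent w (real (m + h)))"
      by (rule order_trans[OF norm_sum]) (simp add: norm_mult norm_power z tent_nonneg)
    also have "\<dots> \<le> 2 * w + 1"
      using k by (intro sum_tent_le assms mult_left_le tent_le_1 tent_nonneg)
    finally have 1: "cmod ?A \<le> 2 * w + 1" .
    have 2: "cmod ?A \<le> 17 / (w * (cmod (1 - z))\<^sup>2)" if "z \<noteq> 1"
      using tent_autocorrelation_bound[OF assms z, of h] that k
      by (simp add: field_simps)
    have "cmod ?A \<le> corr_bound w (real (2 * h) * x)"
      unfolding corr_bound_def z_def[symmetric] using 1 2
      by (cases "z = 1") (simp_all only: if_True if_False simp_thms min.bounded_iff)
    then show ?thesis using True by (simp only: e if_True)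
  qed
  have "(cmod (tent_sum w M D x))\<^sup>2 = (\<Sum>l<M. (cmod (c l))\<^sup>2)
     + 2 * Re (\<Sum>h\<in>{1..<M}. \<Sum>m<M-h. c (m + h) * cnj (c m))"
    unfolding tent_sum_def c_def by (rule norm_sq_sum)
  also have "\<dots> \<le> (2 * w + 1) + 2 * (\<Sum>t\<in>{1..nat \<lfloor>4 * w\<rfloor>}. corr_bound w (real t * x))"
  proof (intro add_mono mult_left_mono)
    show "(\<Sum>l<M. (cmod (c l))\<^sup>2) \<le> 2 * w + 1"
      by (rule sum_tent_le[OF assms(1)])
         (use k in \<open>auto simp: c_def norm_mult power2_eq_square tent_nonneg intro!: mult_left_le tent_le_1\<close>)
    have "Re (\<Sum>h\<in>{1..<M}. \<Sum>m<M-h. c (m + h) * cnj (c m)) \<le> cmod (\<Sum>h\<in>{1..<M}. \<Sum>m<M-h. c (m + h) * cnj (c m))"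
      by (rule complex_Re_le_cmod)
    also have "\<dots> \<le> (\<Sum>h\<in>{1..<M}. if h \<in> H then corr_bound w (real (2 * h) * x) else 0)"
      by (rule order_trans[OF norm_sum sum_mono]) (use A in auto)
    also have "\<dots> = (\<Sum>h\<in>{1..<M} \<inter> H. corr_bound w (real (2 * h) * x))"
      by (rule sum.inter_restrict[symmetric]) simp
    also have "\<dots> \<le> (\<Sum>h\<in>H. corr_bound w (real (2 * h) * x))"
      using k by (intro sum_mono2 finH corr_bound_nonneg) auto
    also have "\<dots> = (\<Sum>t\<in>(\<lambda>h. 2 * h) ` H. corr_bound w (real t * x))"
      by (subst sum.reindex) (auto simp: inj_on_def)
    \<comment> \<open>Odd \<open>t\<close> are added at no cost, the terms being nonnegative. Then
      \<open>t\<close> runs through complete residue systems for denominators of either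
      parity.\<close>
    also have "\<dots> \<le> (\<Sum>t\<in>{1..nat \<lfloor>4 * w\<rfloor>}. corr_bound w (real t * x))"
      using k by (intro sum_mono2 corr_bound_nonneg) (auto simp: H_def le_nat_iff le_floor_iff)
    finally show "Re (\<Sum>h\<in>{1..<M}. \<Sum>m<M-h. c (m + h) * cnj (c m)) \<le> (\<Sum>t\<in>{1..nat \<lfloor>4 * w\<rfloor>}. corr_bound w (real t * x))" .
  qed simp
  finally show ?thesis .
qed

text \<open>The modulus is \<open>2 * \<bar>sin (pi * u)\<bar>\<close>. The cubic Taylor remainder
  gives \<open>sin t \<ge> t / 2\<close> for \<open>t \<le> 1.6\<close>, a range that contains
  \<open>pi / 2\<close>, and 3 is a lower bound for \<open>pi\<close>.\<close>

lemma norm_1_minus_unit_exp_ge: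
  assumes "\<bar>u\<bar> \<le> 1/2"
  shows "3 * \<bar>u\<bar> \<le> cmod (1 - unit_exp u)"
proof -
  define t where "t = pi * \<bar>u\<bar>"
  have t0: "t \<ge> 0" by (simp add: t_def)
  have t: "t \<le> 1.6"
  proof -
    have "t \<le> pi * (1/2)" unfolding t_def using assms by (intro mult_left_mono) auto
    also have "\<dots> \<le> 1.6" using pi_less_4 pi_approx by simp
    finally show ?thesis .
  qed
  have "(\<Sum>m<3. sin_coeff m * t ^ m) = t"
    by (simp add: eval_nat_numeral sin_coeff_def)
  then have "\<bar>sin t - t\<bar> \<le> t ^ 3 / 6"
    using Maclaurin_sin_bound[of t 3] t0 by (simp add: eval_nat_numeral field_simps)
  moreover have "t ^ 3 / 6 \<le> t / 2"
  proof -
    have "t ^ 2 \<le> 1.6 ^ 2" using t t0 by (intro power_mono)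
    then have "t * t ^ 2 \<le> t * 3" using t0 by (intro mult_left_mono) (auto simp: power2_eq_square)
    then show ?thesis by (simp add: eval_nat_numeral)
  qed
  ultimately have s: "sin t \<ge> t / 2" by linarith
  have "(cmod (1 - unit_exp u))\<^sup>2 = (1 - cos (2 * (pi * u)))\<^sup>2 + (sin (2 * (pi * u)))\<^sup>2"
    by (simp add: unit_exp_def cmod_power2 mult.assoc)
  also have "\<dots> = 2 - 2 * cos (2 * (pi * u))"
    using sin_cos_squared_add[of "2 * (pi * u)"] by (simp add: power2_eq_square algebra_simps)
  also have "\<dots> = (2 * sin (pi * u))\<^sup>2"
    by (simp add: cos_double_sin power2_eq_square)
  also have "\<dots> = (2 * sin t)\<^sup>2"
    by (cases "u \<ge> 0") (auto simp: t_def)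
  finally have "cmod (1 - unit_exp u) = \<bar>2 * sin t\<bar>"
    by (metis norm_ge_zero real_sqrt_abs real_sqrt_unique)
  also have "\<dots> \<ge> t" using s t0 by linarith
  also have "t \<ge> 3 * \<bar>u\<bar>" unfolding t_def using pi_gt3 by (intro mult_right_mono) auto
  finally show ?thesis .
qed

section \<open>Correlation bounds at points near a fraction\<close>

lemma unit_exp_add_int: "unit_exp (of_int m + u) = unit_exp u"
  by (simp add: unit_exp_add)

lemma corr_bound_add_int: "corr_bound w (of_int m + u) = corr_bound w u"
  by (simp add: corr_bound_def unit_exp_add_int)

lemma corr_bound_le:
  assumes "w > 0" "\<bar>u\<bar> \<le> 1/2" "d > 0" "d \<le> \<bar>u\<bar>"
  shows "corr_bound w u \<le> 2 / (w * d\<^sup>2)"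
proof -
  have 1: "3 * d \<le> cmod (1 - unit_exp u)" using norm_1_minus_unit_exp_ge[OF assms(2)] assms by linarith
  then have ne: "unit_exp u \<noteq> 1" using assms by auto
  have "corr_bound w u \<le> 17 / (w * (cmod (1 - unit_exp u))\<^sup>2)"
    using ne by (simp add: corr_bound_def)
  also have "\<dots> \<le> 17 / (w * (3 * d)\<^sup>2)"
    using assms 1 by (intro divide_left_mono mult_left_mono power_mono mult_pos_pos) auto
  also have "\<dots> \<le> 2 / (w * d\<^sup>2)"
    using assms by (simp add: power_mult_distrib divide_simps)
  finally show ?thesis .
qed

lemma corr_bound_le_4: "w \<ge> 1/2 \<Longrightarrow> corr_bound w u \<le> 4 * w"
  by (auto simp: corr_bound_def min_def)

text \<open>Multiplication by \<open>a\<close> permutes the residues modulo \<open>Q\<close>, so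
  every block of \<open>Q\<close> consecutive \<open>t\<close> contributes one full sum over
  residues, and \<open>T div Q + 1\<close> blocks cover the range.\<close>

lemma sum_residues_le:
  fixes a :: int and Q :: nat and g :: "int \<Rightarrow> real"
  assumes "coprime a (int Q)" "Q > 0" "\<And>r. g r \<ge> 0"
  shows "(\<Sum>t<T. g ((int t * a) mod int Q)) \<le> real (T div Q + 1) * (\<Sum>r<Q. g (int r))"
proof -
  define f where "f t = g ((int t * a) mod int Q)" for t
  define n where "n = T div Q + 1"
  have "T \<le> n * Q"
    using assms(2) by (simp add: n_def dividend_less_div_times less_imp_le)
  then have "(\<Sum>t<T. f t) \<le> (\<Sum>t<n * Q. f t)"
    using assms by (intro sum_mono2) (auto simp: f_def)
  also have "\<dots> = (\<Sum>m<n. sum f {m * Q..<m * Q + Q})"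
    by (rule sum.nat_group[symmetric])
  also have "\<dots> = (\<Sum>m<n. \<Sum>r<Q. g (int r))"
  proof (rule sum.cong[OF refl])
    fix m
    define \<phi> where "\<phi> t = nat ((int t * a) mod int Q)" for t
    have inj: "inj_on \<phi> {m * Q..<m * Q + Q}"
    proof (rule inj_onI)
      fix t t' assume tt: "t \<in> {m * Q..<m * Q + Q}" "t' \<in> {m * Q..<m * Q + Q}" "\<phi> t = \<phi> t'"
      then have "(int t * a) mod int Q = (int t' * a) mod int Q"
        using assms(2) by (simp add: \<phi>_def nat_eq_iff2)
      then have "int Q dvd int t * a - int t' * a" by (simp add: mod_eq_dvd_iff)
      then have "int Q dvd (int t - int t') * a" by (simp add: left_diff_distrib)
      then have "int Q dvd int t - int t'"
        using assms(1) by (simp add: coprime_dvd_mult_left_iff coprime_commute)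
      moreover have "\<bar>int t - int t'\<bar> < int Q" using tt by auto
      ultimately show "t = t'" using zdvd_not_zless[of "\<bar>int t - int t'\<bar>" "int Q"] by force
    qed
    have "\<phi> ` {m * Q..<m * Q + Q} = {..<Q}"
    proof (rule card_subset_eq)
      show "\<phi> ` {m * Q..<m * Q + Q} \<subseteq> {..<Q}"
        using assms(2) by (auto simp: \<phi>_def nat_less_iff)
      show "card (\<phi> ` {m * Q..<m * Q + Q}) = card {..<Q}"
        using inj by (simp add: card_image)
    qed simp
    then have "bij_betw \<phi> {m * Q..<m * Q + Q} {..<Q}" using inj by (simp add: bij_betw_def)
    from sum.reindex_bij_betw[OF this, of "\<lambda>r. g (int r)"]
    show "sum f {m * Q..<m * Q + Q} = (\<Sum>r<Q. g (int r))"
      using assms(2) by (simp add: f_def \<phi>_def)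
  qed
  finally show ?thesis by (simp add: f_def n_def)
qed

lemma sum_inverse_squares_le: "(\<Sum>r=1..n. 1 / (real r)\<^sup>2) \<le> 2"
proof -
  have *: "(\<Sum>r=1..Suc n. 1 / (real r)\<^sup>2) \<le> 2 - 1 / real (Suc n)" for n
  proof (induction n)
    case (Suc n)
    have "1 / (real (Suc (Suc n)))\<^sup>2 \<le> 1 / (real (Suc n) * real (Suc (Suc n)))"
      unfolding power2_eq_square by (intro divide_left_mono mult_right_mono) auto
    also have "\<dots> = 1 / real (Suc n) - 1 / real (Suc (Suc n))"
      by (simp add: field_simps)
    finally show ?case using Suc by simp
  qed auto
  show ?thesis
  proof (cases n)
    case (Suc m)
    have "1 / real (Suc m) \<ge> 0" by simp
    then show ?thesis using *[of m] unfolding Suc by linarith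
  qed simp
qed

text \<open>Comparison with an integral, made termwise: concavity of
  \<open>t powr (1 - \<eta>)\<close>, in the form of Young's inequality at
  \<open>n / (n + 1)\<close>, bounds each term by a telescoping difference.\<close>

lemma sum_powr_le:
  assumes "0 < \<eta>" "\<eta> < 1"
  shows "(\<Sum>k=1..n. real k powr (- \<eta>)) \<le> real n powr (1 - \<eta>) / (1 - \<eta>)"
proof (induction n)
  case (Suc n)
  have *: "real (Suc n) powr (- \<eta>) * (1 - \<eta>) \<le> real (Suc n) powr (1 - \<eta>) - real n powr (1 - \<eta>)"
  proof -
    define N where "N = real (Suc n)"
    have N: "N > 0" "real n / N \<ge> 0" by (auto simp: N_def)
    have "(real n / N) powr (1 - \<eta>) * 1 powr \<eta> \<le> (1 - \<eta>) * (real n / N) + \<eta> * 1"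
    proof (cases "n = 0")
      case False
      then show ?thesis using assms N by (intro Youngs_inequality_0) auto
    qed (use assms in auto)
    then have "N powr (1 - \<eta>) * (real n / N) powr (1 - \<eta>) \<le> N powr (1 - \<eta>) * ((1 - \<eta>) * (real n / N) + \<eta>)"
      by (intro mult_left_mono) auto
    also have "N powr (1 - \<eta>) * (real n / N) powr (1 - \<eta>) = real n powr (1 - \<eta>)"
      using N by (simp add: powr_divide)
    also have "real n / N = 1 - 1 / N" by (simp add: N_def field_simps)
    also have "N powr (1 - \<eta>) * ((1 - \<eta>) * (1 - 1 / N) + \<eta>) = N powr (1 - \<eta>) - (N powr (1 - \<eta>) / N) * (1 - \<eta>)"
      using N by (simp add: algebra_simps)
    also have "N powr (1 - \<eta>) / N = N powr (- \<eta>)"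
      using N by (simp add: powr_diff powr_minus field_simps)
    finally show ?thesis by (simp add: N_def)
  qed
  then have "real (Suc n) powr (- \<eta>) \<le> (real (Suc n) powr (1 - \<eta>) - real n powr (1 - \<eta>)) / (1 - \<eta>)"
    using assms by (simp add: field_simps)
  then show ?case using Suc by (simp add: diff_divide_distrib)
qed (use assms in auto)

lemma sum_reflected_inverse_squares_le:
  "(\<Sum>r<Q. if r = 0 then 0 else 1 / (real r)\<^sup>2 + 1 / (real Q - real r)\<^sup>2) \<le> 4"
proof -
  have "(\<Sum>r<Q. if r = 0 then 0 else 1 / (real r)\<^sup>2 + 1 / (real Q - real r)\<^sup>2)
      = (\<Sum>r\<in>{1..<Q}. 1 / (real r)\<^sup>2 + 1 / (real Q - real r)\<^sup>2)"
    by (rule sum.mono_neutral_cong_right) auto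
  also have "\<dots> = (\<Sum>r\<in>{1..<Q}. 1 / (real r)\<^sup>2) + (\<Sum>r\<in>{1..<Q}. 1 / (real Q - real r)\<^sup>2)"
    by (rule sum.distrib)
  also have "(\<Sum>r\<in>{1..<Q}. 1 / (real Q - real r)\<^sup>2) = (\<Sum>r\<in>{1..<Q}. 1 / (real r)\<^sup>2)"
    by (rule sum.reindex_bij_witness[of _ "\<lambda>r. Q - r" "\<lambda>r. Q - r"]) (auto simp: of_nat_diff)
  also have "(\<Sum>r\<in>{1..<Q}. 1 / (real r)\<^sup>2) \<le> (\<Sum>r=1..Q. 1 / (real r)\<^sup>2)"
    by (intro sum_mono2) auto
  also have "\<dots> \<le> 2" by (rule sum_inverse_squares_le)
  finally show ?thesis by simp
qed

text \<open>Modulo 1, \<open>real t * x\<close> is \<open>r / Q\<close> moved by at most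
  \<open>1 / (2 * Q)\<close>. As \<open>1 \<le> r \<le> Q - 1\<close>, the move eats up at most half
  of the distance to either of the integers 0 and 1. Adding the bounds for both ends removes the
  question which one is nearer.\<close>

lemma corr_bound_nonresidue:
  fixes a :: int and Q :: nat
  assumes "w > 0" "Q > 0" "\<bar>real t * (x - of_int a / real Q)\<bar> \<le> 1 / (2 * real Q)"
    and r: "r = (int t * a) mod int Q" "r \<noteq> 0"
  shows "corr_bound w (real t * x) \<le> 8 / w * (real Q)\<^sup>2 * (1 / (real_of_int r)\<^sup>2 + 1 / (real Q - real_of_int r)\<^sup>2)"
proof -
  define b where "b = real t * (x - of_int a / real Q)"
  define m where "m = (int t * a) div int Q"
  define q where "q = real Q"
  define R where "R = real_of_int r"
  have q: "q > 0" using assms by (simp add: q_def)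
  have r1: "1 \<le> r" "r \<le> int Q - 1"
    using r assms(2) by (smt (verit) of_nat_0_less_iff pos_mod_bound pos_mod_sign)+
  have R: "1 \<le> R" "R \<le> q - 1"
    unfolding R_def q_def using r1 by linarith+
  have "int t * a = m * int Q + r" by (simp add: m_def r)
  then have "real t * of_int a = of_int m * q + R"
    unfolding q_def R_def by (metis of_int_add of_int_mult of_int_of_nat_eq)
  then have "real t * x = of_int m + (R / q + b)"
    using q by (simp add: b_def q_def field_simps)
  then have w: "corr_bound w (real t * x) = corr_bound w (R / q + b)"
    by (simp add: corr_bound_add_int)
  have w': "corr_bound w (R / q + b) = corr_bound w (R / q + b - 1)"
    using corr_bound_add_int[of w "-1" "R / q + b"] by (simp add: algebra_simps)
  have b: "\<bar>b\<bar> \<le> 1 / (2 * q)" using assms by (simp add: b_def q_def)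
  have main: "2 / (w * (R' / (2 * q))\<^sup>2) = 8 / w * q\<^sup>2 * (1 / R'\<^sup>2)" if "R' > 0" for R'
    using q assms that by (simp add: field_simps power2_eq_square)
  have i: "1 / (2 * q) \<le> R / (2 * q)" "1 / (2 * q) \<le> (q - R) / (2 * q)"
    using R q by (auto intro!: divide_right_mono)
  have ii: "R / q = 2 * (R / (2 * q))" "(q - R) / q = 2 * ((q - R) / (2 * q))" "R / q + (q - R) / q = 1"
    using q by (auto simp: field_simps)
  have "corr_bound w (R / q + b) \<le> 8 / w * q\<^sup>2 * (1 / R\<^sup>2) \<or> corr_bound w (R / q + b) \<le> 8 / w * q\<^sup>2 * (1 / (q - R)\<^sup>2)"
  proof (cases "R / q + b \<le> 1/2")
    case True
    have "corr_bound w (R / q + b) \<le> 2 / (w * (R / (2 * q))\<^sup>2)"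
    proof (rule corr_bound_le)
      have "R / (2 * q) > 0" using R q by simp
      then show "\<bar>R / q + b\<bar> \<le> 1 / 2" "R / (2 * q) \<le> \<bar>R / q + b\<bar>" using True b i ii by linarith+
    qed (use R q assms in auto)
    then show ?thesis using main[of R] R by simp
  next
    case False
    have "corr_bound w (R / q + b - 1) \<le> 2 / (w * ((q - R) / (2 * q))\<^sup>2)"
    proof (rule corr_bound_le)
      have "(q - R) / (2 * q) > 0" using R q by simp
      then show "\<bar>R / q + b - 1\<bar> \<le> 1 / 2" "(q - R) / (2 * q) \<le> \<bar>R / q + b - 1\<bar>" using False b i ii by linarith+
    qed (use R q assms in auto)
    then show ?thesis using main[of "q - R"] R w' by simp
  qed
  moreover have "8 / w * q\<^sup>2 * (1 / R\<^sup>2) \<le> 8 / w * q\<^sup>2 * (1 / R\<^sup>2 + 1 / (q - R)\<^sup>2)"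
    "8 / w * q\<^sup>2 * (1 / (q - R)\<^sup>2) \<le> 8 / w * q\<^sup>2 * (1 / R\<^sup>2 + 1 / (q - R)\<^sup>2)"
    using assms by (intro mult_left_mono; simp)+
  ultimately show ?thesis unfolding w q_def[symmetric] R_def[symmetric] by linarith
qed

text \<open>With \<open>y = w * Y\<close> this is
  \<open>min 1 (y powr (-2)) \<le> y powr (-\<eta>)\<close>. A single power of \<open>Y\<close> can
  be summed over multiples without separating large from small arguments.\<close>

lemma min_le_powr:
  fixes B w Y \<eta> :: real
  assumes "w > 0" "Y > 0" "0 < \<eta>" "\<eta> < 1" "B \<le> 4 * w" "B \<le> 2 / (w * Y\<^sup>2)"
  shows "B \<le> 4 * w * (w * Y) powr (- \<eta>)"
proof (cases "w * Y \<le> 1")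
  case True
  have "1 = 1 powr (-\<eta>)" by simp
  also have "\<dots> \<le> (w * Y) powr (- \<eta>)" using assms True by (intro powr_mono2') auto
  finally have "4 * w * 1 \<le> 4 * w * (w * Y) powr (- \<eta>)" using assms by (intro mult_left_mono) auto
  then show ?thesis using assms(5) by linarith
next
  case False
  have "B \<le> 2 / (w * Y\<^sup>2)" by fact
  also have "\<dots> = 2 * w * (w * Y) powr (- 2)"
    using assms by (simp add: powr_minus divide_simps power2_eq_square)
  also have "\<dots> \<le> 2 * w * (w * Y) powr (- \<eta>)"
    using assms False by (intro mult_left_mono powr_mono) auto
  also have "\<dots> \<le> 4 * w * (w * Y) powr (- \<eta>)"
    using assms by (intro mult_right_mono) auto
  finally show ?thesis .
qed

text \<open>The main term of an arc, from the \<open>t\<close> divisible by its denominator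
  \<open>q\<close>. Near the centre, \<open>w\<^sup>2 * \<bar>b\<bar> \<le> 1\<close>, the trivial
  bound for at most \<open>4 * w / q\<close> terms suffices, as the decay factor is at least 1/2
  there. Farther out the power bound is summed, and the powers of \<open>w\<close> and
  \<open>q\<close> combine to \<open>w\<^sup>2 / q\<close>.\<close>

lemma sum_multiples_corr_bound:
  assumes k: "w \<ge> 1/2" and q: "q > 0" "real n \<le> 4 * w / q" and e: "0 < \<eta>" "\<eta> < 1"
    and b: "\<And>k. k \<in> {1..n} \<Longrightarrow> \<bar>real k * q * b\<bar> \<le> 1/2"
  shows "(\<Sum>k=1..n. corr_bound w (real k * q * b)) \<le> 32 / (1 - \<eta>) * (w\<^sup>2 / q) * (1 + w\<^sup>2 * \<bar>b\<bar>) powr (- \<eta>)"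
proof (cases "w\<^sup>2 * \<bar>b\<bar> \<le> 1")
  case True
  have "(\<Sum>k=1..n. corr_bound w (real k * q * b)) \<le> (\<Sum>k=1..n. 4 * w)"
    by (intro sum_mono corr_bound_le_4 k)
  also have "\<dots> = real n * (4 * w)" by simp
  also have "\<dots> \<le> 4 * w / q * (4 * w)" using q k by (intro mult_right_mono) auto
  also have "\<dots> = 16 * (w\<^sup>2 / q)" by (simp add: power2_eq_square)
  also have "\<dots> \<le> 32 / (1 - \<eta>) * (w\<^sup>2 / q) * (1 + w\<^sup>2 * \<bar>b\<bar>) powr (- \<eta>)"
  proof -
    have "1 / 2 = 2 powr (- 1 :: real)" by (simp add: powr_minus)
    also have "\<dots> \<le> 2 powr (- \<eta>)" using e by (intro powr_mono) auto
    also have "\<dots> \<le> (1 + w\<^sup>2 * \<bar>b\<bar>) powr (- \<eta>)"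
      using True e by (intro powr_mono2') (auto simp: add_pos_nonneg)
    finally have 1: "1/2 \<le> (1 + w\<^sup>2 * \<bar>b\<bar>) powr (- \<eta>)" .
    have "16 * (w\<^sup>2 / q) = 32 / 1 * (w\<^sup>2 / q) * (1/2)" by simp
    also have "\<dots> \<le> 32 / (1 - \<eta>) * (w\<^sup>2 / q) * (1 + w\<^sup>2 * \<bar>b\<bar>) powr (- \<eta>)"
      using q e by (intro mult_mono divide_left_mono 1) auto
    finally show ?thesis .
  qed
  finally show ?thesis .
next
  case False
  then have b0: "\<bar>b\<bar> > 0" by (cases "b = 0") auto
  have k0: "w > 0" using k by simp
  have pt: "corr_bound w (real k * q * b) \<le> 4 * w * (w * q * \<bar>b\<bar>) powr (- \<eta>) * real k powr (- \<eta>)" if "k \<in> {1..n}" for k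
  proof -
    have pos: "real k * q * \<bar>b\<bar> > 0" using that q b0 by simp
    have "corr_bound w (real k * q * b) \<le> 2 / (w * (real k * q * \<bar>b\<bar>)\<^sup>2)"
      using b[OF that] pos q by (intro corr_bound_le k0) (auto simp: abs_mult)
    then have "corr_bound w (real k * q * b) \<le> 4 * w * (w * (real k * q * \<bar>b\<bar>)) powr (- \<eta>)"
      by (intro min_le_powr k0 pos e corr_bound_le_4 k)
    also have "w * (real k * q * \<bar>b\<bar>) = (w * q * \<bar>b\<bar>) * real k" by simp
    finally show ?thesis using k0 q by (simp add: powr_mult mult_ac)
  qed
  have "(\<Sum>k=1..n. corr_bound w (real k * q * b)) \<le> (\<Sum>k=1..n. 4 * w * (w * q * \<bar>b\<bar>) powr (- \<eta>) * real k powr (- \<eta>))"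
    by (intro sum_mono pt)
  also have "\<dots> = 4 * w * (w * q * \<bar>b\<bar>) powr (- \<eta>) * (\<Sum>k=1..n. real k powr (- \<eta>))"
    by (simp add: sum_distrib_left)
  also have "\<dots> \<le> 4 * w * (w * q * \<bar>b\<bar>) powr (- \<eta>) * ((4 * w / q) powr (1 - \<eta>) / (1 - \<eta>))"
  proof (intro mult_left_mono)
    have "(\<Sum>k=1..n. real k powr (- \<eta>)) \<le> real n powr (1 - \<eta>) / (1 - \<eta>)"
      by (rule sum_powr_le) (use e in auto)
    also have "\<dots> \<le> (4 * w / q) powr (1 - \<eta>) / (1 - \<eta>)"
      using q e by (intro divide_right_mono powr_mono2) auto
    finally show "(\<Sum>k=1..n. real k powr (- \<eta>)) \<le> (4 * w / q) powr (1 - \<eta>) / (1 - \<eta>)" .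
  qed (use k in auto)
  also have "\<dots> = 4 * 4 powr (1 - \<eta>) / (1 - \<eta>) * (w\<^sup>2 / q) * (w\<^sup>2 * \<bar>b\<bar>) powr (- \<eta>)"
  proof -
    have "w * (w * q * \<bar>b\<bar>) powr (- \<eta>) * (4 * w / q) powr (1 - \<eta>)
       = 4 powr (1 - \<eta>) * (w\<^sup>2 / q) * (w\<^sup>2 * \<bar>b\<bar>) powr (- \<eta>)"
      using k0 q b0 by (simp add: powr_mult powr_divide powr_diff powr_minus power2_eq_square field_simps)
    then have "4 / (1 - \<eta>) * (w * (w * q * \<bar>b\<bar>) powr (- \<eta>) * (4 * w / q) powr (1 - \<eta>))
       = 4 / (1 - \<eta>) * (4 powr (1 - \<eta>) * (w\<^sup>2 / q) * (w\<^sup>2 * \<bar>b\<bar>) powr (- \<eta>))"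
      by (rule arg_cong)
    then show ?thesis by (simp add: mult_ac)
  qed
  also have "\<dots> \<le> 4 * 4 / (1 - \<eta>) * (w\<^sup>2 / q) * (2 * (1 + w\<^sup>2 * \<bar>b\<bar>) powr (- \<eta>))"
  proof (intro mult_mono divide_right_mono mult_left_mono)
    show "4 powr (1 - \<eta>) \<le> (4::real)" using powr_mono[of "1 - \<eta>" 1 "4::real"] e by simp
    have "2 * (1 + w\<^sup>2 * \<bar>b\<bar>) powr (- \<eta>) \<ge> 2 * (2 * (w\<^sup>2 * \<bar>b\<bar>)) powr (- \<eta>)"
    proof -
      have F: "1 + w\<^sup>2 * \<bar>b\<bar> \<le> 2 * (w\<^sup>2 * \<bar>b\<bar>)" "0 < 1 + w\<^sup>2 * \<bar>b\<bar>"
        using False by linarith+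
      show ?thesis by (rule mult_left_mono[OF powr_mono2'[OF _ F(2) F(1)]]) (use e in auto)
    qed
    also have "2 * (2 * (w\<^sup>2 * \<bar>b\<bar>)) powr (- \<eta>) = 2 * 2 powr (- \<eta>) * (w\<^sup>2 * \<bar>b\<bar>) powr (- \<eta>)"
      by (simp add: powr_mult)
    also have "\<dots> \<ge> 2 * 2 powr (- 1) * (w\<^sup>2 * \<bar>b\<bar>) powr (- \<eta>)"
      using e by (intro mult_left_mono mult_right_mono powr_mono) auto
    finally show "(w\<^sup>2 * \<bar>b\<bar>) powr - \<eta> \<le> 2 * (1 + w\<^sup>2 * \<bar>b\<bar>) powr - \<eta>"
      by (simp add: powr_minus)
  qed (use e q in auto)
  finally show ?thesis by simp
qed

text \<open>The shifts \<open>t\<close> not divisible by \<open>Q\<close> contribute about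
  \<open>(T / Q + 1) * Q\<^sup>2 / w\<close>, which is of order \<open>w\<close> because
  \<open>T \<le> 4 * w\<close> and \<open>Q \<le> 10 * w\<close>; the divisible ones give the main
  term. The radius \<open>1 / (8 * w * Q)\<close> is what makes \<open>t * (x - a / Q)\<close> at
  most \<open>1 / (2 * Q)\<close> for every \<open>t \<le> 4 * w\<close>. The constant 20000 merely
  rounds up 10244.\<close>

lemma tent_sum_pointwise:
  fixes a :: int and Q :: nat
  assumes k: "w \<ge> 1/2" "2 * w \<le> real M" and e: "0 < \<eta>" "\<eta> < 1"
    and Q: "Q > 0" "real Q \<le> 10 * w" and cop: "coprime a (int Q)"
    and x: "\<bar>x - of_int a / real Q\<bar> \<le> 1 / (8 * w * real Q)"
  shows "(cmod (tent_sum w M D x))\<^sup>2 \<le> 20000 / (1 - \<eta>) *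
      (w + w\<^sup>2 / real Q * (1 + w\<^sup>2 * \<bar>x - of_int a / real Q\<bar>) powr (- \<eta>))"
proof -
  define b where "b = x - of_int a / real Q"
  define T where "T = nat \<lfloor>4 * w\<rfloor>"
  define G where "G r = (if r = 0 then 0 else 1 / (real_of_int r)\<^sup>2 + 1 / (real Q - real_of_int r)\<^sup>2)" for r
  have k0: "w > 0" using k by simp
  have T: "real T \<le> 4 * w" using k by (simp add: T_def)
  have tb: "\<bar>real t * b\<bar> \<le> 1 / (2 * real Q)" if "t \<le> T" for t
  proof -
    have "\<bar>real t * b\<bar> = real t * \<bar>b\<bar>" by (simp add: abs_mult)
    also have "\<dots> \<le> 4 * w * (1 / (8 * w * real Q))"
      using that T x k0 by (intro mult_mono) (auto simp: b_def)
    also have "\<dots> = 1 / (2 * real Q)" using k0 by simp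
    finally show ?thesis .
  qed
  have pt: "corr_bound w (real t * x) \<le> 8 / w * (real Q)\<^sup>2 * G ((int t * a) mod int Q)
      + (if Q dvd t then corr_bound w (real t * x) else 0)" if "t \<in> {1..T}" for t
  proof (cases "(int t * a) mod int Q = 0")
    case True
    then have "int Q dvd int t * a" by auto
    then have "Q dvd t" using cop
      by (metis coprime_commute coprime_dvd_mult_left_iff int_dvd_int_iff)
    then show ?thesis using True by (simp add: G_def)
  next
    case False
    have "corr_bound w (real t * x) \<le> 8 / w * (real Q)\<^sup>2 * G ((int t * a) mod int Q)"
      using corr_bound_nonresidue[OF k0 Q(1) _ refl False] tb[of t] that False by (simp add: b_def G_def)
    moreover have "0 \<le> (if Q dvd t then corr_bound w (real t * x) else 0)"
      using corr_bound_nonneg[OF k0, of "real t * x"] by simp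
    ultimately show ?thesis by linarith
  qed
  have "(\<Sum>t\<in>{1..T}. corr_bound w (real t * x)) \<le>
      (\<Sum>t\<in>{1..T}. 8 / w * (real Q)\<^sup>2 * G ((int t * a) mod int Q)) + (\<Sum>t\<in>{1..T}. if Q dvd t then corr_bound w (real t * x) else 0)"
    unfolding sum.distrib[symmetric] by (intro sum_mono pt)
  also have "(\<Sum>t\<in>{1..T}. 8 / w * (real Q)\<^sup>2 * G ((int t * a) mod int Q)) \<le> 5120 * w"
  proof -
    have "(\<Sum>t\<in>{1..T}. G ((int t * a) mod int Q)) \<le> (\<Sum>t<T+1. G ((int t * a) mod int Q))"
      by (intro sum_mono2) (auto simp: G_def)
    also have "\<dots> \<le> real ((T + 1) div Q + 1) * (\<Sum>r<Q. G (int r))"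
      by (rule sum_residues_le[OF cop Q(1)]) (simp add: G_def)
    also have "(\<Sum>r<Q. G (int r)) \<le> 4"
      using sum_reflected_inverse_squares_le[of Q] by (simp add: G_def cong: if_cong)
    also have "real ((T + 1) div Q + 1) \<le> (real T + 1) / real Q + 1"
      using of_nat_div_le_of_nat[of "T + 1" Q, where ?'a = real] by (simp add: add.commute)
    finally have "(\<Sum>t\<in>{1..T}. G ((int t * a) mod int Q)) \<le> ((real T + 1) / real Q + 1) * 4"
      by (simp add: mult_right_mono)
    then have "8 / w * (real Q)\<^sup>2 * (\<Sum>t\<in>{1..T}. G ((int t * a) mod int Q))
        \<le> 8 / w * (real Q)\<^sup>2 * (((real T + 1) / real Q + 1) * 4)"
      using k0 by (intro mult_left_mono) auto
    also have "\<dots> = 32 / w * (real Q * (real T + 1) + real Q * real Q)"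
      using Q k0 by (simp add: field_simps power2_eq_square)
    also have "\<dots> \<le> 32 / w * (10 * w * (6 * w) + 10 * w * (10 * w))"
      using Q T k by (intro mult_left_mono add_mono mult_mono) auto
    also have "\<dots> = 5120 * w" using k0 by (simp add: field_simps)
    finally show ?thesis by (simp add: sum_distrib_left)
  qed
  also have "(\<Sum>t\<in>{1..T}. if Q dvd t then corr_bound w (real t * x) else 0) \<le>
      32 / (1 - \<eta>) * (w\<^sup>2 / real Q) * (1 + w\<^sup>2 * \<bar>b\<bar>) powr (- \<eta>)"
  proof -
    have "(\<Sum>t\<in>{1..T}. if Q dvd t then corr_bound w (real t * x) else 0)
       = (\<Sum>t\<in>{t\<in>{1..T}. Q dvd t}. corr_bound w (real t * x))"
      by (rule sum.inter_filter[symmetric]) simp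
    also have "\<dots> = (\<Sum>k=1..T div Q. corr_bound w (real (k * Q) * x))"
    proof (rule sum.reindex_bij_witness[of _ "\<lambda>k. k * Q" "\<lambda>t. t div Q"])
      fix k assume "k \<in> {1..T div Q}"
      then show "k * Q \<in> {t\<in>{1..T}. Q dvd t}" "k * Q div Q = k" using Q
        by (auto simp: less_eq_div_iff_mult_less_eq)
    qed (use Q in \<open>auto simp: div_le_mono dvd_imp_le div_greater_zero_iff Suc_le_eq\<close>)
    also have "\<dots> = (\<Sum>k=1..T div Q. corr_bound w (real k * real Q * b))"
    proof (rule sum.cong[OF refl])
      fix k
      have "real (k * Q) * x = of_int (int k * a) + real k * real Q * b"
        using Q by (simp add: b_def field_simps)
      then show "corr_bound w (real (k * Q) * x) = corr_bound w (real k * real Q * b)"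
        by (simp only: corr_bound_add_int)
    qed
    also have "\<dots> \<le> 32 / (1 - \<eta>) * (w\<^sup>2 / real Q) * (1 + w\<^sup>2 * \<bar>b\<bar>) powr (- \<eta>)"
    proof (rule sum_multiples_corr_bound[OF k(1) _ _ e])
      show "real (T div Q) \<le> 4 * w / real Q"
        using of_nat_div_le_of_nat[of T Q, where ?'a = real] T Q by (smt (verit) divide_right_mono of_nat_0_le_iff)
      fix k assume "k \<in> {1..T div Q}"
      then have "k * Q \<le> T" using Q by (auto simp: less_eq_div_iff_mult_less_eq)
      then have "\<bar>real (k * Q) * b\<bar> \<le> 1 / (2 * real Q)" by (rule tb)
      also have "\<dots> \<le> 1/2" using Q by simp
      finally show "\<bar>real k * real Q * b\<bar> \<le> 1/2" by simp
    qed (use Q in auto)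
    finally show ?thesis .
  qed
  finally have S: "(\<Sum>t\<in>{1..T}. corr_bound w (real t * x)) \<le> 5120 * w
     + 32 / (1 - \<eta>) * (w\<^sup>2 / real Q) * (1 + w\<^sup>2 * \<bar>b\<bar>) powr (- \<eta>)" by simp
  define Z where "Z = w\<^sup>2 / real Q * (1 + w\<^sup>2 * \<bar>b\<bar>) powr (- \<eta>)"
  have Z: "Z \<ge> 0" by (simp add: Z_def)
  have "(cmod (tent_sum w M D x))\<^sup>2 \<le> (2 * w + 1) + 2 * (\<Sum>t\<in>{1..T}. corr_bound w (real t * x))"
    unfolding T_def by (rule weyl_tent[OF k])
  also have "\<dots> \<le> 4 * w + 2 * (5120 * w + 32 / (1 - \<eta>) * Z)"
    using S k by (simp add: Z_def mult.assoc)
  also have "\<dots> = 10244 * w + 64 / (1 - \<eta>) * Z" by simp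
  also have "\<dots> \<le> 20000 / (1 - \<eta>) * w + 20000 / (1 - \<eta>) * Z"
  proof (intro add_mono mult_right_mono)
    show "10244 \<le> 20000 / (1 - \<eta>)" using e by (simp add: field_simps)
    show "64 / (1 - \<eta>) \<le> 20000 / (1 - \<eta>)" using e by (intro divide_right_mono) auto
  qed (use Z k in auto)
  finally show ?thesis by (simp add: Z_def b_def distrib_left)
qed

section \<open>Integration over the major arcs\<close>

lemma nn_integral_decay:
  assumes "\<rho> > 1" "A > 0"
  shows "(\<integral>\<^sup>+ x. ennreal ((1 + A * \<bar>x - c\<bar>) powr (- \<rho>)) \<partial>lborel) \<le> ennreal (2 / (A * (\<rho> - 1)))"
proof -
  define g where "g x = (1 + A * \<bar>x\<bar>) powr (- \<rho>)" for x :: real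
  have [measurable]: "g \<in> borel_measurable borel" unfolding g_def by measurable
  have half: "(\<integral>\<^sup>+ x. ennreal (g x) * indicator {0..} x \<partial>lborel) = ennreal (1 / (A * (\<rho> - 1)))"
  proof -
    define F where "F x = - ((1 + A * x) powr (1 - \<rho>)) / (A * (\<rho> - 1))" for x :: real
    have "(\<integral>\<^sup>+ x. ennreal ((1 + A * x) powr (- \<rho>)) * indicator {0..} x \<partial>lborel) = 0 - F 0"
    proof (rule nn_integral_FTC_atLeast)
      fix x :: real assume "0 \<le> x"
      then have p: "1 + A * x > 0" using assms by (simp add: add_pos_nonneg)
      show "DERIV F x :> (1 + A * x) powr - \<rho>"
      proof -
        have "((\<lambda>x. (1 + A * x) powr (1 - \<rho>)) has_real_derivative
            (1 - \<rho>) * (1 + A * x) powr (1 - \<rho> - of_nat 1) * A) (at x)"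
          using p by (intro DERIV_fun_powr) (auto intro!: derivative_eq_intros)
        then have "(F has_real_derivative
            - ((1 - \<rho>) * (1 + A * x) powr (1 - \<rho> - of_nat 1) * A) / (A * (\<rho> - 1))) (at x)"
          unfolding F_def by (intro DERIV_cdivide DERIV_minus)
        also have "- ((1 - \<rho>) * (1 + A * x) powr (1 - \<rho> - of_nat 1) * A) / (A * (\<rho> - 1))
            = (1 + A * x) powr - \<rho>"
          using assms by (simp add: divide_simps) (simp add: algebra_simps)
        finally show ?thesis .
      qed
      show "0 \<le> (1 + A * x) powr - \<rho>" by simp
    next
      have "((\<lambda>x. (1 + A * x) powr (1 - \<rho>)) \<longlongrightarrow> 0) at_top"
        using assms
        by (intro tendsto_neg_powr filterlim_tendsto_add_at_top[OF tendsto_const]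
              filterlim_tendsto_pos_mult_at_top[OF tendsto_const] filterlim_ident) auto
      then have "(F \<longlongrightarrow> - 0 / (A * (\<rho> - 1))) at_top"
        unfolding F_def using assms by (intro tendsto_intros) auto
      then show "(F \<longlongrightarrow> 0) at_top" by simp
    qed simp
    also have "0 - F 0 = 1 / (A * (\<rho> - 1))" by (simp add: F_def)
    finally have "(\<integral>\<^sup>+ x. ennreal ((1 + A * x) powr (- \<rho>)) * indicator {0..} x \<partial>lborel) = ennreal (1 / (A * (\<rho> - 1)))"
      by simp
    moreover have "(\<integral>\<^sup>+ x. ennreal (g x) * indicator {0..} x \<partial>lborel)
       = (\<integral>\<^sup>+ x. ennreal ((1 + A * x) powr (- \<rho>)) * indicator {0..} x \<partial>lborel)"
      by (intro nn_integral_cong) (auto simp: g_def indicator_def)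
    ultimately show ?thesis by simp
  qed
  have "(\<integral>\<^sup>+ x. ennreal ((1 + A * \<bar>x - c\<bar>) powr (- \<rho>)) \<partial>lborel) = (\<integral>\<^sup>+ x. ennreal (g x) \<partial>lborel)"
    by (subst nn_integral_real_affine[where c = 1 and t = c]) (auto simp: g_def)
  also have "\<dots> \<le> (\<integral>\<^sup>+ x. ennreal (g x) * indicator {0..} x + ennreal (g x) * indicator {..0} x \<partial>lborel)"
    by (intro nn_integral_mono) (auto simp: indicator_def)
  also have "\<dots> = (\<integral>\<^sup>+ x. ennreal (g x) * indicator {0..} x \<partial>lborel) + (\<integral>\<^sup>+ x. ennreal (g x) * indicator {..0} x \<partial>lborel)"
    by (rule nn_integral_add) auto
  also have "(\<integral>\<^sup>+ x. ennreal (g x) * indicator {..0} x \<partial>lborel) = (\<integral>\<^sup>+ x. ennreal (g x) * indicator {0..} x \<partial>lborel)"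
    by (subst nn_integral_real_affine[where c = "-1" and t = 0]) (auto simp: g_def indicator_def intro!: nn_integral_cong)
  also have "(\<integral>\<^sup>+ x. ennreal (g x) * indicator {0..} x \<partial>lborel) + (\<integral>\<^sup>+ x. ennreal (g x) * indicator {0..} x \<partial>lborel)
     = ennreal (2 / (A * (\<rho> - 1)))"
    unfolding half using assms by (simp flip: ennreal_plus)
  finally show ?thesis .
qed

lemma powr_add_le_2:
  fixes u v r :: real
  assumes "u \<ge> 0" "v \<ge> 0" "r \<ge> 0"
  shows "(u + v) powr r \<le> 2 powr r * (u powr r + v powr r)"
proof -
  have "(u + v) powr r \<le> (2 * max u v) powr r" using assms by (intro powr_mono2) auto
  also have "\<dots> = 2 powr r * max u v powr r" using assms by (simp add: powr_mult)
  also have "\<dots> \<le> 2 powr r * (u powr r + v powr r)"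
    by (intro mult_left_mono) (auto simp: max_def)
  finally show ?thesis .
qed

lemma continuous_on_tent_sum: "continuous_on S (tent_sum w M D)"
  unfolding tent_sum_def by (intro continuous_intros)

text \<open>The fraction near \<open>x\<close> depends on \<open>x\<close>. Replacing its term by
  the sum over all fractions gives one explicit majorant, so that neither disjointness nor
  measurability of arcs has to be discussed. Dirichlet's theorem of order \<open>N0\<close> supplies
  the radius \<open>1 / (8 * w * Q)\<close>, and \<open>w \<ge> 1/2\<close> gives
  \<open>N0 \<le> 10 * w\<close>.\<close>

lemma tent_sum_pointwise_all:
  assumes k: "w \<ge> 1/2" "2 * w \<le> real M" and e: "0 < \<eta>" "\<eta> < 1" and x: "x \<in> {0..1}" and "r \<ge> 0"
    and N0: "N0 = nat \<lceil>8 * w\<rceil>"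
  shows "(cmod (tent_sum w M D x)) powr (2 * r) \<le> (40000 / (1 - \<eta>)) powr r *
      (w powr r + (\<Sum>Q\<in>{1..N0}. \<Sum>a\<in>{0..Q}. (w\<^sup>2 / real Q) powr r
         * (1 + w\<^sup>2 * \<bar>x - real a / real Q\<bar>) powr (- (\<eta> * r))))"
proof -
  have N0': "N0 > 0" "8 * w \<le> real N0" "real N0 \<le> 10 * w"
    using k unfolding N0 by (auto, linarith+)
  obtain h q where hq: "coprime h q" "0 < q" "q \<le> int N0" "\<bar>of_int q * x - of_int h\<bar> < 1 / real N0"
    using Dirichlet_approx_coprime[OF N0'(1), of x] by metis
  define Q where "Q = nat q"
  have Q: "q = int Q" "Q > 0" "Q \<le> N0" using hq by (auto simp: Q_def)
  have d: "\<bar>x - of_int h / real Q\<bar> = \<bar>of_int q * x - of_int h\<bar> / real Q"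
  proof -
    have "x - of_int h / real Q = (of_int q * x - of_int h) / real Q"
      using Q by (simp add: field_simps)
    then show ?thesis by (simp add: abs_divide)
  qed
  have "\<bar>of_int q * x - of_int h\<bar> < 1" using hq(4) N0' by (smt (verit) divide_le_eq_1_pos of_nat_0_less_iff of_nat_1 of_nat_le_iff less_eq_Suc_le One_nat_def)
  moreover have "0 \<le> real_of_int q * x" "real_of_int q * x \<le> real_of_int q" using x hq by (auto intro: mult_left_le)
  ultimately have "real_of_int h > -1" "real_of_int h < real_of_int q + 1" by linarith+
  then have h: "0 \<le> h" "h \<le> q" by linarith+
  define a where "a = nat h"
  have a: "h = int a" "a \<in> {0..Q}" using h Q by (auto simp: a_def)
  have "\<bar>x - of_int h / real Q\<bar> \<le> 1 / (8 * w * real Q)"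
  proof -
    have "\<bar>of_int q * x - of_int h\<bar> \<le> 1 / (8 * w)"
    proof -
      have "1 / real N0 \<le> 1 / (8 * w)" using N0' k by (intro divide_left_mono) auto
      then show ?thesis using hq(4) by linarith
    qed
    then have "\<bar>of_int q * x - of_int h\<bar> / real Q \<le> 1 / (8 * w) / real Q"
      by (intro divide_right_mono) auto
    then show ?thesis by (simp add: d)
  qed
  then have P: "(cmod (tent_sum w M D x))\<^sup>2 \<le> 20000 / (1 - \<eta>) *
      (w + w\<^sup>2 / real Q * (1 + w\<^sup>2 * \<bar>x - of_int h / real Q\<bar>) powr (- \<eta>))"
    using Q N0' hq by (intro tent_sum_pointwise k e) auto
  define Z where "Z Q a = w\<^sup>2 / real Q * (1 + w\<^sup>2 * \<bar>x - real a / real Q\<bar>) powr (- \<eta>)" for Q a :: nat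
  have Zr: "Z Q a powr r = (w\<^sup>2 / real Q) powr r * (1 + w\<^sup>2 * \<bar>x - real a / real Q\<bar>) powr (- (\<eta> * r))" for Q a
    unfolding Z_def by (subst powr_mult) (simp add: powr_powr)
  have Z0: "Z Q a \<ge> 0" for Q a by (simp add: Z_def)
  have "(cmod (tent_sum w M D x)) powr (2 * r) = ((cmod (tent_sum w M D x))\<^sup>2) powr r"
    by (simp add: powr_powr[symmetric])
  also have "\<dots> \<le> (20000 / (1 - \<eta>) * (w + Z Q a)) powr r"
    using P assms(6) by (intro powr_mono2) (auto simp: Z_def a)
  also have "\<dots> = (20000 / (1 - \<eta>)) powr r * (w + Z Q a) powr r"
    by (rule powr_mult)
  also have "\<dots> \<le> (20000 / (1 - \<eta>)) powr r * (2 powr r * (w powr r + Z Q a powr r))"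
    using k Z0 assms(6) by (intro mult_left_mono powr_add_le_2) auto
  also have "\<dots> = (40000 / (1 - \<eta>)) powr r * (w powr r + Z Q a powr r)"
  proof -
    have "(40000 / (1 - \<eta>)) powr r = (20000 / (1 - \<eta>) * 2) powr r" by simp
    also have "\<dots> = (20000 / (1 - \<eta>)) powr r * 2 powr r" by (rule powr_mult)
    finally show ?thesis by simp
  qed
  also have "\<dots> \<le> (40000 / (1 - \<eta>)) powr r * (w powr r + (\<Sum>Q\<in>{1..N0}. \<Sum>a\<in>{0..Q}. Z Q a powr r))"
  proof (intro mult_left_mono add_left_mono)
    have "Z Q a powr r \<le> (\<Sum>a\<in>{0..Q}. Z Q a powr r)"
      using a by (intro member_le_sum) auto
    also have "\<dots> \<le> (\<Sum>Q\<in>{1..N0}. \<Sum>a\<in>{0..Q}. Z Q a powr r)"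
      using Q by (intro member_le_sum) (auto intro!: sum_nonneg)
    finally show "Z Q a powr r \<le> (\<Sum>Q\<in>{1..N0}. \<Sum>a\<in>{0..Q}. Z Q a powr r)" .
  qed simp
  finally show ?thesis by (simp only: Zr)
qed

abbreviation arc_sum :: "real \<Rightarrow> real \<Rightarrow> real" where
  "arc_sum p w \<equiv> (\<Sum>Q\<in>{1..nat \<lceil>8 * w\<rceil>}. real Q powr (1 - p/2))"

text \<open>\<eta> is the midpoint of \<open>2 / p\<close> and 1, so that \<eta> < 1 and
  \<open>\<eta> * (p/2) > 1\<close>. Each arc can then be integrated over the whole line and yields
  a multiple of \<open>w powr (-2)\<close>; the at most \<open>2 * Q\<close> numerators turn
  \<open>Q powr (- p/2)\<close> into the summand of \<open>arc_sum\<close>.\<close>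

lemma Lp_pow_tent_sum_le:
  assumes k: "w \<ge> 1/2" "2 * w \<le> real M" and p: "p > 2"
  defines "\<eta> \<equiv> (1 + 2 / p) / 2"
  shows "Lp_pow p (tent_sum w M D) \<le> ennreal ((40000 / (1 - \<eta>)) powr (p/2) *
      (w powr (p/2) + 4 / (\<eta> * (p/2) - 1) * w powr (p - 2) * arc_sum p w))"
proof -
  define r where "r = p / 2"
  define C where "C = (40000 / (1 - \<eta>)) powr r"
  define N0 where "N0 = nat \<lceil>8 * w\<rceil>"
  have e: "0 < \<eta>" "\<eta> < 1" using p by (auto simp: \<eta>_def field_simps)
  have er: "\<eta> * r > 1" using p by (auto simp: \<eta>_def r_def field_simps)
  have k0: "w > 0" using k by simp
  define Z where "Z Q a x = (w\<^sup>2 / real Q) powr r * (1 + w\<^sup>2 * \<bar>x - real a / real Q\<bar>) powr (- (\<eta> * r))" for Q a :: nat and x :: real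
  have Z0: "Z Q a x \<ge> 0" for Q a x by (simp add: Z_def)
  have [measurable]: "Z Q a \<in> borel_measurable borel" for Q a unfolding Z_def by measurable
  have C: "C \<ge> 0" by (simp add: C_def)
  have pt: "(cmod (tent_sum w M D x)) powr p \<le> C * (w powr r + (\<Sum>Q\<in>{1..N0}. \<Sum>a\<in>{0..Q}. Z Q a x))" if "x \<in> {0..1}" for x
    using tent_sum_pointwise_all[OF k e that _ refl, of r D] p unfolding C_def Z_def N0_def r_def by simp
  have "Lp_pow p (tent_sum w M D) \<le> (\<integral>\<^sup>+ x. ennreal C * (ennreal (w powr r) * indicator {0..1} x + (\<Sum>Q\<in>{1..N0}. \<Sum>a\<in>{0..Q}. ennreal (Z Q a x))) \<partial>lborel)"
    unfolding Lp_pow_def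
  proof (rule nn_integral_mono)
    fix x
    show "ennreal (cmod (tent_sum w M D x) powr p) * indicator {0..1} x \<le> ennreal C * (ennreal (w powr r) * indicator {0..1} x + (\<Sum>Q\<in>{1..N0}. \<Sum>a\<in>{0..Q}. ennreal (Z Q a x)))"
    proof (cases "x \<in> {0..1}")
      case True
      have "ennreal (cmod (tent_sum w M D x) powr p) \<le> ennreal (C * (w powr r + (\<Sum>Q\<in>{1..N0}. \<Sum>a\<in>{0..Q}. Z Q a x)))"
        by (intro ennreal_leI pt True)
      also have "\<dots> = ennreal C * (ennreal (w powr r) + (\<Sum>Q\<in>{1..N0}. \<Sum>a\<in>{0..Q}. ennreal (Z Q a x)))"
        using C Z0 by (simp add: ennreal_mult sum_nonneg sum_ennreal)
      finally show ?thesis using True by simp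
    qed simp
  qed
  also have "\<dots> = ennreal C * (ennreal (w powr r) + (\<Sum>Q\<in>{1..N0}. \<Sum>a\<in>{0..Q}. \<integral>\<^sup>+ x. ennreal (Z Q a x) \<partial>lborel))"
    by (simp add: nn_integral_cmult nn_integral_add nn_integral_sum)
  also have "\<dots> \<le> ennreal C * (ennreal (w powr r) + (\<Sum>Q\<in>{1..N0}. \<Sum>a\<in>{0..Q}. ennreal ((w\<^sup>2 / real Q) powr r * (2 / (w\<^sup>2 * (\<eta> * r - 1))))))"
  proof (intro mult_left_mono add_left_mono sum_mono)
    fix Q a
    have "(\<integral>\<^sup>+ x. ennreal (Z Q a x) \<partial>lborel) = ennreal ((w\<^sup>2 / real Q) powr r) * (\<integral>\<^sup>+ x. ennreal ((1 + w\<^sup>2 * \<bar>x - real a / real Q\<bar>) powr (- (\<eta> * r))) \<partial>lborel)"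
      unfolding Z_def by (simp add: ennreal_mult nn_integral_cmult)
    also have "\<dots> \<le> ennreal ((w\<^sup>2 / real Q) powr r) * ennreal (2 / (w\<^sup>2 * (\<eta> * r - 1)))"
      using er k0 by (intro mult_left_mono nn_integral_decay) auto
    also have "\<dots> = ennreal ((w\<^sup>2 / real Q) powr r * (2 / (w\<^sup>2 * (\<eta> * r - 1))))"
      using er by (intro ennreal_mult[symmetric]) auto
    finally show "(\<integral>\<^sup>+ x. ennreal (Z Q a x) \<partial>lborel) \<le> ennreal ((w\<^sup>2 / real Q) powr r * (2 / (w\<^sup>2 * (\<eta> * r - 1))))" .
  qed simp_all
  also have "\<dots> = ennreal (C * (w powr r + (\<Sum>Q\<in>{1..N0}. \<Sum>a\<in>{0..Q}. (w\<^sup>2 / real Q) powr r * (2 / (w\<^sup>2 * (\<eta> * r - 1))))))"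
  proof -
    have nn: "(w\<^sup>2 / real Q) powr r * (2 / (w\<^sup>2 * (\<eta> * r - 1))) \<ge> 0" for Q using er by simp
    show ?thesis using nn C
      by (simp add: ennreal_mult sum_nonneg sum_ennreal del: sum_constant)
  qed
  also have "\<dots> \<le> ennreal (C * (w powr r + 4 / (\<eta> * r - 1) * w powr (p - 2) * (\<Sum>Q\<in>{1..N0}. real Q powr (1 - r))))"
  proof (intro ennreal_leI mult_left_mono add_left_mono C)
    show "(\<Sum>Q\<in>{1..N0}. \<Sum>a\<in>{0..Q}. (w\<^sup>2 / real Q) powr r * (2 / (w\<^sup>2 * (\<eta> * r - 1))))
       \<le> 4 / (\<eta> * r - 1) * w powr (p - 2) * (\<Sum>Q\<in>{1..N0}. real Q powr (1 - r))"
      unfolding sum_distrib_left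
    proof (rule sum_mono)
      fix Q assume Q: "Q \<in> {1..N0}"
      have "(\<Sum>a\<in>{0..Q}. (w\<^sup>2 / real Q) powr r * (2 / (w\<^sup>2 * (\<eta> * r - 1))))
         = (real Q + 1) * ((w\<^sup>2 / real Q) powr r * (2 / (w\<^sup>2 * (\<eta> * r - 1))))" by simp
      also have "\<dots> \<le> (2 * real Q) * ((w\<^sup>2 / real Q) powr r * (2 / (w\<^sup>2 * (\<eta> * r - 1))))"
        using Q er by (intro mult_right_mono) auto
      also have eq: "(w\<^sup>2 / real Q) powr r = w powr p * real Q powr (- r)"
      proof -
        have "(w\<^sup>2) powr r = (w powr 2) powr r" using k0 by simp
        also have "\<dots> = w powr p" unfolding powr_powr r_def by simp
        finally show ?thesis using Q by (simp add: powr_divide powr_minus_divide)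
      qed
      also have "2 * real Q * (w powr p * real Q powr - r * (2 / (w\<^sup>2 * (\<eta> * r - 1))))
         = 4 / (\<eta> * r - 1) * (w powr p / w\<^sup>2) * (real Q * real Q powr - r)" by (simp add: mult_ac)
      also have "w powr p / w\<^sup>2 = w powr (p - 2)" using k0 by (simp add: powr_diff)
      also have "real Q * real Q powr - r = real Q powr (1 - r)"
        using Q by (simp add: powr_diff powr_minus_divide)
      finally show "(\<Sum>a\<in>{0..Q}. (w\<^sup>2 / real Q) powr r * (2 / (w\<^sup>2 * (\<eta> * r - 1))))
         \<le> 4 / (\<eta> * r - 1) * w powr (p - 2) * real Q powr (1 - r)" unfolding eq .
    qed
  qed
  finally show ?thesis unfolding C_def N0_def r_def .
qed

text \<open>The summand \<open>2\<close> keeps the factor positive down to \<open>K = 1/2\<close>, the smallest tent used.\<close>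

definition growth :: "real \<Rightarrow> real \<Rightarrow> real" where
  "growth p K = (if p < 4 then 1 else if p = 4 then 2 + ln K else K powr (p/2 - 2))"

lemma ln_ge_minus_1: 
  assumes "K \<ge> 1/2" shows "ln K \<ge> (-1::real)"
proof -
  have "ln (1/K) \<le> 1/K - 1" using assms by (intro ln_le_minus_one) auto
  also have "\<dots> \<le> 1" using assms by (simp add: field_simps)
  finally show ?thesis using assms by (simp add: ln_div)
qed

lemma growth_pos: "K \<ge> 1/2 \<Longrightarrow> growth p K > 0"
  using ln_ge_minus_1[of K] by (auto simp: growth_def)

lemma growth_mono: "1/2 \<le> x \<Longrightarrow> x \<le> y \<Longrightarrow> growth p x \<le> growth p y"
  by (auto simp: growth_def intro!: powr_mono2)

lemma harm_le_ln: "n \<ge> 1 \<Longrightarrow> (\<Sum>Q\<in>{1..n}. real Q powr (-1)) \<le> 1 + ln (real n)"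
proof -
  assume "n \<ge> 1"
  then obtain m where m: "n = Suc m" by (cases n) auto
  have "harm (Suc m) - ln (real (Suc m)) \<le> harm (Suc 0) - ln (real (Suc 0))"
    using decseq_harm_diff_ln by (rule decseqD) simp
  then have "harm n \<le> 1 + ln (real n)" by (simp add: m harm_def)
  then show ?thesis by (simp add: harm_def powr_minus)
qed

lemma major_arc_sum_le:
  assumes "p > 2" "c \<ge> 0"
  obtains B where "B > 0"
    "\<And>w. w \<ge> 1/2 \<Longrightarrow> w powr (p/2) + c * w powr (p - 2) * arc_sum p w
        \<le> B * w powr (p/2) * growth p w"
proof -
  have N0: "1 \<le> nat \<lceil>8 * w\<rceil>" "real (nat \<lceil>8 * w\<rceil>) \<le> 10 * w" if "w \<ge> 1/2" for w :: real
    using that by linarith+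
  consider "p < 4" | "p = 4" | "p > 4" by linarith
  then show thesis
  proof cases
    case 1
    define \<sigma> where "\<sigma> = p/2 - 1"
    have s: "0 < \<sigma>" "\<sigma> < 1" using assms 1 by (auto simp: \<sigma>_def)
    show thesis
    proof (rule that)
      show "1 + c * (10 powr (1 - \<sigma>) / (1 - \<sigma>)) > 0"
        using s assms by (intro add_pos_nonneg mult_nonneg_nonneg) auto
      fix w :: real assume k: "w \<ge> 1/2"
      have "arc_sum p w \<le> real (nat \<lceil>8 * w\<rceil>) powr (1 - \<sigma>) / (1 - \<sigma>)"
        using sum_powr_le[OF s, of "nat \<lceil>8 * w\<rceil>"] by (simp add: \<sigma>_def)
      also have "\<dots> \<le> (10 * w) powr (1 - \<sigma>) / (1 - \<sigma>)"
        using s N0[OF k] by (intro divide_right_mono powr_mono2) auto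
      finally have "c * w powr (p - 2) * arc_sum p w
          \<le> c * w powr (p - 2) * ((10 * w) powr (1 - \<sigma>) / (1 - \<sigma>))"
        using assms by (intro mult_left_mono) auto
      also have "\<dots> = c * (10 powr (1 - \<sigma>) / (1 - \<sigma>)) * (w powr (p - 2) * w powr (1 - \<sigma>))"
        unfolding powr_mult by simp
      also have "w powr (p - 2) * w powr (1 - \<sigma>) = w powr (p/2)"
        by (simp add: powr_add[symmetric] \<sigma>_def)
      finally show "w powr (p/2) + c * w powr (p - 2) * arc_sum p w
        \<le> (1 + c * (10 powr (1 - \<sigma>) / (1 - \<sigma>))) * w powr (p/2) * growth p w"
        using 1 by (simp add: growth_def distrib_right)
    qed
  next
    case 2
    show thesis
    proof (rule that)
      show "1 + 5 * c > 0" using assms by simp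
      fix w :: real assume k: "w \<ge> 1/2"
      have l: "ln w \<ge> - 1" by (rule ln_ge_minus_1[OF k])
      have "arc_sum p w \<le> 1 + ln (real (nat \<lceil>8 * w\<rceil>))"
        using harm_le_ln[OF N0(1)[OF k]] 2 by simp
      also have "ln (real (nat \<lceil>8 * w\<rceil>)) \<le> ln (10 * w)"
        using N0[OF k] by (intro ln_mono) auto
      also have "ln (10 * w) = ln 10 + ln w" using k by (simp add: ln_mult)
      also have "ln 10 \<le> (3::real)"
      proof -
        have "ln 10 = ln (16 * (10/16) :: real)" by simp
        also have "\<dots> = ln 16 + ln (10/16 :: real)" by (subst ln_mult) auto
        also have "ln 16 = 4 * ln (2::real)" using ln_realpow[of 2 4] by simp
        also have "ln (10/16 :: real) \<le> 10/16 - 1" by (rule ln_le_minus_one) simp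
        finally show ?thesis using ln_2_less_1 ln2_le_25_over_36 by simp
      qed
      finally have "arc_sum p w \<le> 5 * (2 + ln w)"
        using l by simp
      then have "c * w powr (p - 2) * arc_sum p w
         \<le> c * w powr (p - 2) * (5 * (2 + ln w))"
        using assms by (intro mult_left_mono) auto
      moreover have "w powr (p / 2) * 1 \<le> w powr (p / 2) * (2 + ln w)"
        using l by (intro mult_left_mono) auto
      ultimately show "w powr (p/2) + c * w powr (p - 2) * arc_sum p w
        \<le> (1 + 5 * c) * w powr (p/2) * growth p w"
        using 2 by (simp add: growth_def algebra_simps)
    qed
  next
    case 3
    define Z where "Z = (\<Sum>n. real n powr (1 - p/2))"
    have summ: "summable (\<lambda>n. real n powr (1 - p/2))"
      using 3 by (subst summable_real_powr_iff) auto
    have Z0: "Z \<ge> 0" unfolding Z_def by (intro suminf_nonneg summ) auto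
    show thesis
    proof (rule that)
      show "2 powr (p/2 - 2) + c * Z > 0" using assms Z0 by (intro add_pos_nonneg) auto
      fix w :: real assume k: "w \<ge> 1/2"
      have "arc_sum p w \<le> Z"
        unfolding Z_def by (intro sum_le_suminf summ) auto
      then have "c * w powr (p - 2) * arc_sum p w \<le> c * w powr (p - 2) * Z"
        using assms by (intro mult_left_mono) auto
      also have eq: "w powr (p - 2) = w powr (p/2) * w powr (p/2 - 2)"
        by (simp add: powr_add[symmetric])
      finally have 1: "c * w powr (p - 2) * arc_sum p w
         \<le> c * (w powr (p/2) * w powr (p/2 - 2)) * Z" unfolding eq .
      \<comment> \<open>For \<open>w\<close> between 1/2 and 1 the growth factor is below 1;
        doubling \<open>w\<close> inside the power absorbs the square-root term at the price of
        \<open>2 powr (p/2 - 2)\<close>.\<close>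
      have "1 \<le> (2 * w) powr (p/2 - 2)" using k 3 by (intro ge_one_powr_ge_zero) auto
      then have "w powr (p/2) * 1 \<le> w powr (p/2) * (2 * w) powr (p/2 - 2)"
        by (intro mult_left_mono) auto
      then have 2: "w powr (p/2) \<le> 2 powr (p/2 - 2) * w powr (p/2) * w powr (p/2 - 2)"
        unfolding powr_mult by (simp add: mult_ac)
      show "w powr (p/2) + c * w powr (p - 2) * arc_sum p w
        \<le> (2 powr (p/2 - 2) + c * Z) * w powr (p/2) * growth p w"
        using add_mono[OF 2 1] 3 by (simp add: growth_def algebra_simps)
    qed
  qed
qed

text \<open>The size of the \<open>p\<close>-norm of a quadratic Weyl sum of length
  \<open>K\<close>: square-root cancellation, corrected by the contribution of the major
  arcs.\<close>

definition gauss_rate :: "real \<Rightarrow> real \<Rightarrow> real" where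
  "gauss_rate p K = sqrt K * growth p K powr (1 / p)"

lemma gauss_rate_nonneg: "K \<ge> 0 \<Longrightarrow> gauss_rate p K \<ge> 0"
  by (simp add: gauss_rate_def)

lemma gauss_rate_mono: "1/2 \<le> x \<Longrightarrow> x \<le> y \<Longrightarrow> p > 0 \<Longrightarrow> gauss_rate p x \<le> gauss_rate p y"
  unfolding gauss_rate_def
  by (intro mult_mono powr_mono2 growth_mono) (auto simp: less_imp_le growth_pos)

lemma gauss_rate_powr: "K \<ge> 1/2 \<Longrightarrow> p > 0 \<Longrightarrow> gauss_rate p K powr p = K powr (p/2) * growth p K"
proof -
  assume K: "K \<ge> 1/2" "p > 0"
  have "gauss_rate p K powr p = sqrt K powr p * (growth p K powr (1/p)) powr p"
    unfolding gauss_rate_def by (rule powr_mult)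
  also have "sqrt K powr p = K powr (p/2)" using K by (simp add: powr_half_sqrt[symmetric] powr_powr)
  also have "(growth p K powr (1/p)) powr p = growth p K" using K growth_pos[of K p] by (simp add: powr_powr)
  finally show ?thesis .
qed

lemma Lp_bound_tent_sum:
  assumes p: "p > 2"
  obtains C where "C > 0"
    "\<And>w M D. w \<ge> 1/2 \<Longrightarrow> 2 * w \<le> real M \<Longrightarrow> Lp_bound p (tent_sum w M D) (C * gauss_rate p w)"
proof -
  define \<eta> where "\<eta> = (1 + 2 / p) / 2"
  define c where "c = 4 / (\<eta> * (p/2) - 1)"
  define A where "A = (40000 / (1 - \<eta>)) powr (p/2)"
  have e: "0 < \<eta>" "\<eta> < 1" using p by (auto simp: \<eta>_def field_simps)
  have "\<eta> * (p/2) > 1" using p by (auto simp: \<eta>_def field_simps)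
  then have c: "c \<ge> 0" by (simp add: c_def)
  have A: "A > 0" using e by (simp add: A_def)
  obtain B where B: "B > 0"
    "\<And>w. w \<ge> 1/2 \<Longrightarrow> w powr (p/2) + c * w powr (p - 2) * arc_sum p w
        \<le> B * w powr (p/2) * growth p w"
    using major_arc_sum_le[OF p c] by blast
  show thesis
  proof (rule that)
    show "(A * B) powr (1 / p) > 0" using A B by simp
    fix w D :: real and M :: nat assume k: "w \<ge> 1/2" "2 * w \<le> real M"
    have "Lp_pow p (tent_sum w M D) \<le> ennreal (A * (w powr (p/2) + c * w powr (p - 2) * arc_sum p w))"
      using Lp_pow_tent_sum_le[OF k p, of D] unfolding A_def c_def \<eta>_def .
    also have "\<dots> \<le> ennreal (A * (B * w powr (p/2) * growth p w))"
      using A by (intro ennreal_leI mult_left_mono B(2) k) auto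
    also have "A * (B * w powr (p/2) * growth p w) = ((A * B) powr (1 / p) * gauss_rate p w) powr p"
      using k p A B by (simp add: powr_mult gauss_rate_powr powr_powr)
    finally show "Lp_bound p (tent_sum w M D) ((A * B) powr (1 / p) * gauss_rate p w)"
      using k unfolding Lp_bound_def
      by (auto intro!: borel_measurable_continuous_onI continuous_on_tent_sum mult_nonneg_nonneg gauss_rate_nonneg)
  qed
qed

section \<open>Sums over intervals and their tails\<close>

text \<open>Half a tent is the difference of two saturated ramps whose scales differ by a factor 2,
  so tents of dyadic widths telescope.\<close>

lemma tent_ramp_diff:
  assumes "w > 0" "t \<ge> 0"
  shows "tent w t / 2 = min 1 (t / w) - min 1 (t / (2 * w))"
  using assms by (auto simp: tent_def min_def max_def abs_if field_simps)

text \<open>The indicator of an integer interval is a superposition of tents whose widths decrease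
  geometrically towards the two endpoints; this is what removes the logarithm that Weyl
  differencing loses on sharply cut sums.\<close>

lemma indicator_eq_sum_tents:
  fixes N :: nat
  assumes N: "N \<ge> 2" and J: "N < 2 ^ Suc J" and t: "t \<in> {1..real N - 1}"
  defines "K \<equiv> real N / 2"
  shows "1 = tent K t + (\<Sum>j\<in>{1..J}. tent (K / 2 ^ j) t / 2 + tent (K / 2 ^ j) (real N - t) / 2)"
proof -
  have K: "K > 0" using N by (simp add: K_def)
  have ramp: "(\<Sum>j\<in>{1..J}. tent (K / 2 ^ j) u / 2) = 1 - min 1 (u / K)" if "u \<ge> 1" for u
  proof -
    have "(\<Sum>j\<in>{1..n}. tent (K / 2 ^ j) u / 2) = min 1 (u / (K / 2 ^ n)) - min 1 (u / K)" for n
    proof (induction n)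
      case (Suc n)
      have "tent (K / 2 ^ Suc n) u / 2 = min 1 (u / (K / 2 ^ Suc n)) - min 1 (u / (2 * (K / 2 ^ Suc n)))"
        using K that by (intro tent_ramp_diff) auto
      also have "2 * (K / 2 ^ Suc n) = K / 2 ^ n" by simp
      finally have "tent (K / 2 ^ Suc n) u / 2 = min 1 (u / (K / 2 ^ Suc n)) - min 1 (u / (K / 2 ^ n))" .
      moreover have "(\<Sum>j\<in>{1..Suc n}. tent (K / 2 ^ j) u / 2) = (\<Sum>j\<in>{1..n}. tent (K / 2 ^ j) u / 2) + tent (K / 2 ^ Suc n) u / 2"
        by simp
      ultimately show ?case using Suc by linarith
    qed simp
    \<comment> \<open>At scale at most 1 the last ramp is already saturated for every
      \<open>u \<ge> 1\<close>; this is why \<open>J\<close> may stop at the binary logarithm of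
      \<open>N\<close>.\<close>
    moreover have "K / 2 ^ J \<le> 1"
    proof -
      have "real N < real (2 ^ Suc J)" using J by (simp only: of_nat_less_iff)
      then show ?thesis by (simp add: K_def field_simps)
    qed
    then have "K / 2 ^ J \<le> u" using that by linarith
    then have "u / (K / 2 ^ J) \<ge> 1" using K by (subst le_divide_eq_1_pos) auto
    ultimately show ?thesis by simp
  qed
  have "tent K t = min 1 (t / K) + min 1 ((real N - t) / K) - 1"
    using t K by (auto simp: tent_def min_def max_def abs_if K_def field_simps)
  then show ?thesis using ramp[of t] ramp[of "real N - t"] t by (simp add: sum.distrib)
qed

lemma gauss_sum_eq_tent_sum:
  fixes N A :: nat
  assumes N: "N \<ge> 2" and J: "N < 2 ^ Suc J"
  defines "K \<equiv> real N / 2"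
  shows "(\<Sum>n\<in>{A+1..<A+N}. unit_exp ((real n)\<^sup>2 * x)) = tent_sum K N (real A) x +
     (\<Sum>j\<in>{1..J}. (1/2) * tent_sum (K / 2 ^ j) N (real A) x + (1/2) * tent_sum (K / 2 ^ j) N (- real (A + N)) x)"
proof -
  have K: "K > 0" using N by (simp add: K_def)
  define E where "E t = unit_exp ((real A + real t)\<^sup>2 * x)" for t
  have left: "tent_sum w N (real A) x = (\<Sum>t\<in>{1..<N}. of_real (tent w (real t)) * E t)" if "w > 0" for w
    unfolding tent_sum_def E_def using that
    by (intro sum.mono_neutral_right) (auto simp: tent_0 Suc_le_eq)
  have right: "tent_sum w N (- real (A + N)) x = (\<Sum>t\<in>{1..<N}. of_real (tent w (real N - real t)) * E t)" if "w > 0" for w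
  proof -
    have "tent_sum w N (- real (A + N)) x = (\<Sum>l\<in>{1..<N}. of_real (tent w (real l)) * unit_exp ((- real (A + N) + real l)\<^sup>2 * x))"
      unfolding tent_sum_def using that
      by (intro sum.mono_neutral_right) (auto simp: tent_0 Suc_le_eq)
    also have "\<dots> = (\<Sum>t\<in>{1..<N}. of_real (tent w (real N - real t)) * E t)"
    proof (rule sum.reindex_bij_witness[of _ "\<lambda>t. N - t" "\<lambda>t. N - t"])
      fix l assume l: "l \<in> {1..<N}"
      \<comment> \<open>Tents at the right end are tents at the left end of the reflected interval:
        squares do not see the sign, so the negative shift \<open>- real (A + N)\<close> realises
        them.\<close>
      have "(- real (A + N) + real l)\<^sup>2 = (real A + real (N - l))\<^sup>2"
        using l by (simp add: of_nat_diff power2_eq_square algebra_simps)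
      then show "of_real (tent w (real N - real (N - l))) * E (N - l) = of_real (tent w (real l)) * unit_exp ((- real (A + N) + real l)\<^sup>2 * x)"
        using l by (simp add: E_def of_nat_diff)
    qed auto
    finally show ?thesis .
  qed
  have "(\<Sum>n\<in>{A+1..<A+N}. unit_exp ((real n)\<^sup>2 * x)) = (\<Sum>t\<in>{1..<N}. E t)"
    by (rule sum.reindex_bij_witness[of _ "\<lambda>t. A + t" "\<lambda>n. n - A"]) (auto simp: E_def of_nat_diff)
  also have "\<dots> = (\<Sum>t\<in>{1..<N}. of_real (tent K (real t) + (\<Sum>j\<in>{1..J}. tent (K / 2 ^ j) (real t) / 2 + tent (K / 2 ^ j) (real N - real t) / 2)) * E t)"
  proof (rule sum.cong[OF refl])
    fix t assume t: "t \<in> {1..<N}"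
    then have "real t \<in> {1..real N - 1}" by auto
    from indicator_eq_sum_tents[OF N J this]
    have 1: "tent K (real t) + (\<Sum>j\<in>{1..J}. tent (K / 2 ^ j) (real t) / 2 + tent (K / 2 ^ j) (real N - real t) / 2) = 1"
      unfolding K_def by simp
    show "E t = of_real (tent K (real t) + (\<Sum>j\<in>{1..J}. tent (K / 2 ^ j) (real t) / 2 + tent (K / 2 ^ j) (real N - real t) / 2)) * E t"
      unfolding 1 by simp
  qed
  also have "\<dots> = (\<Sum>t\<in>{1..<N}. of_real (tent K (real t)) * E t) +
      (\<Sum>t\<in>{1..<N}. \<Sum>j\<in>{1..J}. (1/2) * (of_real (tent (K / 2 ^ j) (real t)) * E t) + (1/2) * (of_real (tent (K / 2 ^ j) (real N - real t)) * E t))"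
    by (simp add: distrib_right sum_distrib_right sum.distrib)
  also have "(\<Sum>t\<in>{1..<N}. \<Sum>j\<in>{1..J}. (1/2) * (of_real (tent (K / 2 ^ j) (real t)) * E t) + (1/2) * (of_real (tent (K / 2 ^ j) (real N - real t)) * E t))
     = (\<Sum>j\<in>{1..J}. \<Sum>t\<in>{1..<N}. (1/2) * (of_real (tent (K / 2 ^ j) (real t)) * E t) + (1/2) * (of_real (tent (K / 2 ^ j) (real N - real t)) * E t))"
    by (rule sum.swap)
  also have "\<dots> = (\<Sum>j\<in>{1..J}. (1/2) * tent_sum (K / 2 ^ j) N (real A) x + (1/2) * tent_sum (K / 2 ^ j) N (- real (A + N)) x)"
  proof (rule sum.cong[OF refl])
    fix j
    have pos: "K / 2 ^ j > 0" using K by simp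
    show "(\<Sum>t\<in>{1..<N}. (1/2) * (of_real (tent (K / 2 ^ j) (real t)) * E t) + (1/2) * (of_real (tent (K / 2 ^ j) (real N - real t)) * E t))
        = (1/2) * tent_sum (K / 2 ^ j) N (real A) x + (1/2) * tent_sum (K / 2 ^ j) N (- real (A + N)) x"
      unfolding left[OF pos] right[OF pos] sum.distrib sum_distrib_left ..
  qed
  finally show ?thesis using left[OF K] by simp
qed

text \<open>The square root gains a fixed factor with every halving of the width. The tents of all
  scales therefore add up to a geometric series, and their logarithmic number is not felt.\<close>

lemma gauss_rate_halving:
  assumes "p > 0" "K / 2 ^ j \<ge> 1/2"
  shows "gauss_rate p (K / 2 ^ j) \<le> (1 / sqrt 2) ^ j * gauss_rate p K"
proof -
  have K: "K \<ge> 1/2"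
  proof -
    have "1/2 * 2 ^ j \<le> K" using assms by (simp add: field_simps)
    moreover have "(1::real) \<le> 2 ^ j" by simp
    ultimately show ?thesis by linarith
  qed
  have "sqrt (K / 2 ^ j) = (1 / sqrt 2) ^ j * sqrt K"
    by (simp add: real_sqrt_divide real_sqrt_power power_divide)
  moreover have "growth p (K / 2 ^ j) powr (1/p) \<le> growth p K powr (1/p)"
    using assms K by (intro powr_mono2 growth_mono less_imp_le[OF growth_pos]) (auto simp: divide_le_eq mult_left_le)
  ultimately show ?thesis unfolding gauss_rate_def using K
    by (simp add: mult.assoc mult_left_mono)
qed

lemma exists_log2:
  assumes "N \<ge> (1::nat)"
  obtains J where "2 ^ J \<le> N" "N < 2 ^ Suc J"
  using ex_power_ivl1[of 2 N] assms by auto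

lemma Lp_bound_gauss_sum_gt_2:
  assumes p: "p > 2"
  obtains C where "C > 0"
    "\<And>A M. M \<ge> 1 \<Longrightarrow> Lp_bound p (\<lambda>x. \<Sum>n\<in>{A+1..A+M}. unit_exp ((real n)\<^sup>2 * x)) (C * gauss_rate p (real M))"
proof -
  obtain C where C: "C > 0"
    "\<And>w M D. w \<ge> 1/2 \<Longrightarrow> 2 * w \<le> real M \<Longrightarrow> Lp_bound p (tent_sum w M D) (C * gauss_rate p w)"
    using Lp_bound_tent_sum[OF p] by blast
  define q where "q = 1 / sqrt 2"
  have q: "0 < q" "q < 1" by (auto simp: q_def)
  define G where "G = 1 / (1 - q)"
  have G: "(\<Sum>j\<in>{1..J}. q ^ j) \<le> G" for J
  proof -
    have "(\<Sum>j\<in>{1..J}. q ^ j) \<le> (\<Sum>j. q ^ j)"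
      using q by (intro sum_le_suminf summable_geometric) auto
    also have "\<dots> = G" using q by (simp add: suminf_geometric G_def)
    finally show ?thesis .
  qed
  have G0: "G > 0" using q by (simp add: G_def)
  show thesis
  proof (rule that)
    show "C * (1 + G) > 0" using C G0 by simp
    fix A M :: nat assume M: "M \<ge> 1"
    \<comment> \<open>The tents vanish at both ends, so the decomposition covers the
      \<open>N - 1\<close> interior points; these are to be the \<open>M\<close> terms.\<close>
    define N where "N = M + 1"
    define K where "K = real N / 2"
    have N: "N \<ge> 2" using M by (simp add: N_def)
    \<comment> \<open>The lower inequality keeps every width at least 1/2, as the tent estimate
      requires; the upper one saturates the last ramp.\<close>
    obtain J where J: "2 ^ J \<le> N" "N < 2 ^ Suc J" using exists_log2[of N] N by auto
    have KJ: "K / 2 ^ j \<ge> 1/2" if "j \<le> J" for j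
    proof -
      have "(2::nat) ^ j \<le> 2 ^ J" using that by (intro power_increasing) auto
      then have "2 ^ j \<le> N" using J by linarith
      then have "real (2 ^ j) \<le> real N" by (simp only: of_nat_le_iff)
      then show ?thesis by (simp add: K_def field_simps)
    qed
    have kN: "2 * (K / 2 ^ j) \<le> real N" for j
      using N by (simp add: K_def divide_le_eq mult_left_le)
    have R0: "gauss_rate p K \<ge> 0" by (intro gauss_rate_nonneg) (simp add: K_def)
    have t: "Lp_bound p (\<lambda>x. (1/2) * tent_sum (K / 2 ^ j) N D x) (1/2 * (C * (q ^ j * gauss_rate p K)))" if "j \<in> {1..J}" for j D
    proof -
      have "Lp_bound p (tent_sum (K / 2 ^ j) N D) (C * (q ^ j * gauss_rate p K))"
      proof (rule Lp_bound_mono)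
        show "Lp_bound p (tent_sum (K / 2 ^ j) N D) (C * gauss_rate p (K / 2 ^ j))"
          using that by (intro C KJ kN) auto
        show "C * gauss_rate p (K / 2 ^ j) \<le> C * (q ^ j * gauss_rate p K)"
          unfolding q_def using C p that by (intro mult_left_mono gauss_rate_halving KJ) auto
      qed (use p in auto)
      from Lp_bound_scale[OF this, of "1/2"] p show ?thesis by (simp add: norm_divide)
    qed
    have "Lp_bound p (\<lambda>x. tent_sum K N (real A) x +
       (\<Sum>j\<in>{1..J}. (1/2) * tent_sum (K / 2 ^ j) N (real A) x + (1/2) * tent_sum (K / 2 ^ j) N (- real (A + N)) x))
       (C * gauss_rate p K + (\<Sum>j\<in>{1..J}. 1/2 * (C * (q ^ j * gauss_rate p K)) + 1/2 * (C * (q ^ j * gauss_rate p K))))"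
    proof (intro Lp_bound_add Lp_bound_sum t)
      show "Lp_bound p (tent_sum K N (real A)) (C * gauss_rate p K)"
        using KJ[of 0] kN[of 0] by (intro C) auto
    qed (use p in auto)
    then have "Lp_bound p (\<lambda>x. \<Sum>n\<in>{A+1..<A+N}. unit_exp ((real n)\<^sup>2 * x))
       (C * gauss_rate p K + (\<Sum>j\<in>{1..J}. 1/2 * (C * (q ^ j * gauss_rate p K)) + 1/2 * (C * (q ^ j * gauss_rate p K))))"
      unfolding gauss_sum_eq_tent_sum[OF N J(2)] K_def .
    then show "Lp_bound p (\<lambda>x. \<Sum>n\<in>{A+1..A+M}. unit_exp ((real n)\<^sup>2 * x)) (C * (1 + G) * gauss_rate p (real M))"
    proof -
      have "{A+1..<A+N} = {A+1..A+M}" by (auto simp: N_def)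
      moreover have "C * gauss_rate p K + (\<Sum>j\<in>{1..J}. 1/2 * (C * (q ^ j * gauss_rate p K)) + 1/2 * (C * (q ^ j * gauss_rate p K)))
          \<le> C * (1 + G) * gauss_rate p (real M)"
      proof -
        have "C * gauss_rate p K + (\<Sum>j\<in>{1..J}. 1/2 * (C * (q ^ j * gauss_rate p K)) + 1/2 * (C * (q ^ j * gauss_rate p K)))
           = C * gauss_rate p K * (1 + (\<Sum>j\<in>{1..J}. q ^ j))"
          by (simp add: sum_distrib_left sum_distrib_right distrib_left mult_ac)
        also have "\<dots> \<le> C * gauss_rate p K * (1 + G)"
          using C R0 G by (intro mult_left_mono add_left_mono) auto
        also have "\<dots> \<le> C * gauss_rate p (real M) * (1 + G)"
          using C G0 M p by (intro mult_left_mono mult_right_mono gauss_rate_mono) (auto simp: K_def N_def)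
        finally show ?thesis by (simp add: mult_ac)
      qed
      ultimately show ?thesis
        using \<open>Lp_bound p (\<lambda>x. \<Sum>n\<in>{A+1..<A+N}. unit_exp ((real n)\<^sup>2 * x)) _\<close> p
        by (auto elim: Lp_bound_mono)
    qed
  qed
qed

text \<open>At \<open>p = 2\<close> there is no \<eta> between \<open>2 / p\<close> and 1, but
  orthogonality gives the norm \<open>sqrt M\<close> exactly.\<close>

lemma Lp_bound_gauss_sum:
  assumes p: "p \<ge> 2"
  obtains C where "C > 0"
    "\<And>A M. M \<ge> 1 \<Longrightarrow> Lp_bound p (\<lambda>x. \<Sum>n\<in>{A+1..A+M}. unit_exp ((real n)\<^sup>2 * x)) (C * gauss_rate p (real M))"
proof (cases "p = 2")
  case False
  then show thesis using Lp_bound_gauss_sum_gt_2[of p] that p by auto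
next
  case True
  show thesis
  proof (rule that[of 1])
    fix A M :: nat
    define f where "f x = (\<Sum>n\<in>{A+1..A+M}. unit_exp ((real n)\<^sup>2 * x))" for x
    have "Lp_pow 2 f = Lp_pow 2 (\<lambda>x. \<Sum>n\<in>{A+1..A+M}. of_real 1 * unit_exp (of_int (int (n^2)) * x))"
      by (simp add: f_def[abs_def])
    also have "\<dots> = ennreal (\<Sum>n\<in>{A+1..A+M}. 1\<^sup>2)"
      by (rule Lp_pow_2_trig) (auto simp: inj_on_def simp del: of_nat_power)
    finally have "Lp_pow 2 f = ennreal (real M)" by simp
    moreover have "f \<in> borel_measurable borel"
      unfolding f_def by (intro borel_measurable_continuous_onI continuous_intros)
    ultimately show "Lp_bound p (\<lambda>x. \<Sum>n\<in>{A+1..A+M}. unit_exp ((real n)\<^sup>2 * x)) (1 * gauss_rate p (real M))"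
      unfolding f_def[symmetric] by (simp add: Lp_bound_def True gauss_rate_def growth_def)
  qed simp
qed

section \<open>Partial summation and dyadic blocks of the weighted series\<close>

lemma abel_summation:
  fixes a :: "nat \<Rightarrow> 'a::comm_ring_1"
  shows "(\<Sum>i\<le>m. a i * z i) = a m * (\<Sum>j\<le>m. z j) + (\<Sum>i<m. (a i - a (Suc i)) * (\<Sum>j\<le>i. z j))"
  by (induction m) (simp_all add: algebra_simps)

text \<open>For nonincreasing nonnegative weights the total of \<open>a m\<close> and the
  differences \<open>a i - a (Suc i)\<close> telescopes to \<open>a 0\<close>, so no factor is
  lost.\<close>

lemma Lp_bound_abel:
  fixes a :: "nat \<Rightarrow> real"
  assumes "\<And>i. i \<le> m \<Longrightarrow> Lp_bound p (\<lambda>x. \<Sum>j\<le>i. z j x) B"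
    and "\<And>i. a (Suc i) \<le> a i" "\<And>i. 0 \<le> a i" "p \<ge> 1"
  shows "Lp_bound p (\<lambda>x. \<Sum>i\<le>m. of_real (a i) * z i x) (a 0 * B)"
proof -
  have "Lp_bound p (\<lambda>x. of_real (a m) * (\<Sum>j\<le>m. z j x) + (\<Sum>i<m. of_real (a i - a (Suc i)) * (\<Sum>j\<le>i. z j x)))
    (cmod (of_real (a m)) * B + (\<Sum>i<m. cmod (of_real (a i - a (Suc i))) * B))"
    using assms by (intro Lp_bound_add Lp_bound_sum Lp_bound_scale) auto
  moreover have "(\<lambda>x. of_real (a m) * (\<Sum>j\<le>m. z j x) + (\<Sum>i<m. of_real (a i - a (Suc i)) * (\<Sum>j\<le>i. z j x)))
     = (\<lambda>x. \<Sum>i\<le>m. of_real (a i) * z i x)"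
    by (simp add: abel_summation fun_eq_iff)
  moreover have "cmod (of_real (a m)) * B + (\<Sum>i<m. cmod (of_real (a i - a (Suc i))) * B) = a 0 * B"
  proof -
    have "cmod (of_real (a m)) * B + (\<Sum>i<m. cmod (of_real (a i - a (Suc i))) * B) = a m * B + (\<Sum>i<m. a i - a (Suc i)) * B"
      using assms(2,3) by (simp del: of_real_diff add: sum_distrib_right)
    also have "(\<Sum>i<m. a i - a (Suc i)) = a 0 - a m" by (rule sum_lessThan_telescope')
    finally show ?thesis by (simp add: algebra_simps)
  qed
  ultimately show ?thesis by simp
qed

definition sq_term :: "real \<Rightarrow> nat \<Rightarrow> real \<Rightarrow> complex" where
  "sq_term s n x = of_real (real n powr (- 2 * s)) * unit_exp ((real n)\<^sup>2 * x)"

abbreviation sq_sum :: "real \<Rightarrow> nat \<Rightarrow> nat \<Rightarrow> real \<Rightarrow> complex" where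
  "sq_sum s L M \<equiv> (\<lambda>x. \<Sum>n\<in>{L..<M}. sq_term s n x)"

text \<open>The size of the dyadic block that starts at \<open>L\<close>; above the threshold
  \<open>s_star\<close> the same expression bounds the whole tail.\<close>

definition tail_rate :: "real \<Rightarrow> real \<Rightarrow> real \<Rightarrow> real" where
  "tail_rate p s L = L powr (- 2 * s) * gauss_rate p L"

lemma tail_rate_nonneg: "L \<ge> 0 \<Longrightarrow> tail_rate p s L \<ge> 0"
  by (simp add: tail_rate_def gauss_rate_nonneg)

text \<open>A block \<open>M \<le> 2 * L\<close> has at most \<open>L\<close> terms, so all its
  initial sums obey one bound, and Abel summation takes out the first and largest weight,
  \<open>L powr (-2*s)\<close>.\<close>

lemma Lp_bound_block:
  assumes p: "p \<ge> 2" and s: "s > 0"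
  obtains C where "C > 0"
    "\<And>L M. L \<ge> 1 \<Longrightarrow> M \<le> 2 * L \<Longrightarrow> Lp_bound p (sq_sum s L M) (C * tail_rate p s (real L))"
proof -
  obtain C where C: "C > 0"
    "\<And>A M. M \<ge> 1 \<Longrightarrow> Lp_bound p (\<lambda>x. \<Sum>n\<in>{A+1..A+M}. unit_exp ((real n)\<^sup>2 * x)) (C * gauss_rate p (real M))"
    using Lp_bound_gauss_sum[OF p] by blast
  show thesis
  proof (rule that)
    show "C > 0" by fact
    fix L M :: nat assume L: "L \<ge> 1" "M \<le> 2 * L"
    have R0: "gauss_rate p (real L) \<ge> 0" by (simp add: gauss_rate_nonneg)
    show "Lp_bound p (sq_sum s L M) (C * tail_rate p s (real L))"
    proof (cases "M \<le> L")
      case True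
      have "Lp_bound p (\<lambda>x. 0) (C * tail_rate p s (real L))"
        using C p tail_rate_nonneg[of "real L" p s] by (intro Lp_bound_mono[OF Lp_bound_zero]) auto
      then show ?thesis using True by simp
    next
      case False
      define m where "m = M - L - 1"
      have m: "M = L + m + 1" "m < L" using False L by (auto simp: m_def)
      have "Lp_bound p (\<lambda>x. \<Sum>i\<le>m. of_real (real (L + i) powr (- 2 * s)) * unit_exp ((real (L + i))\<^sup>2 * x))
          (real (L + 0) powr (- 2 * s) * (C * gauss_rate p (real L)))"
      proof (rule Lp_bound_abel)
        fix i assume i: "i \<le> m"
        have "(\<lambda>x. \<Sum>j\<le>i. unit_exp ((real (L + j))\<^sup>2 * x)) = (\<lambda>x. \<Sum>n\<in>{(L-1)+1..(L-1)+(i+1)}. unit_exp ((real n)\<^sup>2 * x))"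
          using L by (intro ext sum.reindex_bij_witness[of _ "\<lambda>n. n - L" "\<lambda>j. L + j"]) auto
        moreover have "Lp_bound p \<dots> (C * gauss_rate p (real (i + 1)))" by (rule C) simp
        moreover have "C * gauss_rate p (real (i + 1)) \<le> C * gauss_rate p (real L)"
          using C i m p by (intro mult_left_mono gauss_rate_mono) auto
        ultimately show "Lp_bound p (\<lambda>x. \<Sum>j\<le>i. unit_exp ((real (L + j))\<^sup>2 * x)) (C * gauss_rate p (real L))"
          using p by (auto elim: Lp_bound_mono)
      next
        fix i
        show "real (L + Suc i) powr (- 2 * s) \<le> real (L + i) powr (- 2 * s)"
          using L s by (intro powr_mono2') auto
      qed (use p in auto)
      moreover have "(\<lambda>x. \<Sum>i\<le>m. of_real (real (L + i) powr (- 2 * s)) * unit_exp ((real (L + i))\<^sup>2 * x)) = (sq_sum s L M)"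
        unfolding sq_term_def m
        by (intro ext sum.reindex_bij_witness[of _ "\<lambda>n. n - L" "\<lambda>j. L + j"]) auto
      ultimately show ?thesis by (simp add: tail_rate_def mult_ac)
    qed
  qed
qed

lemma Lp_bound_dyadic:
  assumes p: "p \<ge> 2" and C: "C > 0"
    "\<And>L M. L \<ge> 1 \<Longrightarrow> M \<le> 2 * L \<Longrightarrow> Lp_bound p (sq_sum s L M) (C * tail_rate p s (real L))"
    and L: "L \<ge> 1"
  shows "M \<le> 2 ^ j * L \<Longrightarrow> Lp_bound p (sq_sum s L M) (\<Sum>k<j. C * tail_rate p s (2 ^ k * real L))"
proof (induction j arbitrary: M)
  case 0
  then show ?case using Lp_bound_zero[of p] by simp
next
  case (Suc j)
  have pos: "2 ^ j * L \<ge> 1" using L by simp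
  have T: "C * tail_rate p s (2 ^ j * real L) \<ge> 0" using C tail_rate_nonneg[of "2 ^ j * real L" p s] by simp
  show ?case
  proof (cases "M \<le> 2 ^ j * L")
    case True
    show ?thesis by (rule Lp_bound_mono[OF Suc.IH[OF True]]) (use T p in auto)
  next
    case False
    have "Lp_bound p (\<lambda>x. (\<Sum>n\<in>{L..<2 ^ j * L}. sq_term s n x) + (\<Sum>n\<in>{2 ^ j * L..<M}. sq_term s n x))
      ((\<Sum>k<j. C * tail_rate p s (2 ^ k * real L)) + C * tail_rate p s (real (2 ^ j * L)))"
      using Suc.prems p pos by (intro Lp_bound_add Suc.IH C) auto
    moreover have "(\<Sum>n\<in>{L..<2 ^ j * L}. sq_term s n x) + (\<Sum>n\<in>{2 ^ j * L..<M}. sq_term s n x) = (\<Sum>n\<in>{L..<M}. sq_term s n x)" for x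
      using False by (intro sum.atLeastLessThan_concat) auto
    ultimately show ?thesis by simp
  qed
qed

text \<open>The place where \<open>s_star\<close> acts. Up to the logarithm,
  \<open>tail_rate\<close> is a power of its argument, with exponent \<open>-(2*s - 1/2)\<close> for
  \<open>p \<le> 4\<close> and \<open>-(2*s - 1 + 2/p)\<close> for \<open>p > 4\<close>, negative
  precisely when \<open>s > s_star p\<close>. At \<open>p = 4\<close> half of the exponent is spent
  on the logarithm.\<close>

lemma tail_rate_decay:
  assumes p: "p \<ge> 2" and s: "s > s_star p"
  obtains C \<delta> where "C > 0" "\<delta> > 0"
    "\<And>x y. x \<ge> 1 \<Longrightarrow> y \<ge> 1 \<Longrightarrow> tail_rate p s (y * x) \<le> C * y powr (- \<delta>) * tail_rate p s x"
proof -
  consider "p < 4" | "p = 4" | "p > 4" by linarith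
  then show thesis
  proof cases
    case 1
    show thesis
    proof (rule that[of 1 "2 * s - 1/2"])
      show "2 * s - 1/2 > 0" using s 1 by (simp add: s_star_def)
      fix x y :: real assume xy: "x \<ge> 1" "y \<ge> 1"
      have *: "tail_rate p s z = z powr (- (2 * s - 1/2))" if "z \<ge> 1" for z
      proof -
        have "tail_rate p s z = z powr (- 2 * s) * z powr (1/2)"
          using 1 that by (simp add: tail_rate_def gauss_rate_def growth_def powr_half_sqrt)
        also have "\<dots> = z powr (- 2 * s + 1/2)" unfolding powr_add ..
        finally show ?thesis by (simp add: algebra_simps)
      qed
      have "y * x \<ge> 1" using mult_mono[of 1 y 1 x] xy by simp
      then show "tail_rate p s (y * x) \<le> 1 * y powr (- (2 * s - 1/2)) * tail_rate p s x"
        using xy by (simp add: * powr_mult)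
    qed simp
  next
    case 2
    define D where "D = 2 * s - 1/2"
    have D: "D > 0" using s 2 by (simp add: s_star_def D_def)
    show thesis
    proof (rule that[of "1 + 2 / D" "D / 2"])
      show "D / 2 > 0" "1 + 2 / D > 0" using D by (auto intro: add_pos_pos)
      fix x y :: real assume xy: "x \<ge> 1" "y \<ge> 1"
      have ly: "ln y \<ge> 0" "ln x \<ge> 0" using xy by auto
      have *: "tail_rate p s z = z powr (- D) * growth p z powr (1/p)" if "z \<ge> 1" for z
      proof -
        have "tail_rate p s z = (z powr (- 2 * s) * z powr (1/2)) * growth p z powr (1/p)"
          using that by (simp add: tail_rate_def gauss_rate_def powr_half_sqrt)
        also have "z powr (- 2 * s) * z powr (1/2) = z powr (- 2 * s + 1/2)" unfolding powr_add ..
        finally show ?thesis by (simp add: D_def algebra_simps)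
      qed
      have yx: "y * x \<ge> 1" using mult_mono[of 1 y 1 x] xy by simp
      \<comment> \<open>The logarithm of the product separates as
        \<open>2 + ln y + ln x \<le> (1 + ln y) * (2 + ln x)\<close>, which keeps the decay in
        \<open>y\<close> uniform in \<open>x\<close>.\<close>
      have "growth p (y * x) \<le> (1 + ln y) * growth p x"
        using 2 xy ly by (simp add: growth_def ln_mult algebra_simps)
      then have "growth p (y * x) powr (1/p) \<le> ((1 + ln y) * growth p x) powr (1/p)"
        using 2 xy ly by (intro powr_mono2) (auto simp: growth_def ln_mult)
      also have "\<dots> = (1 + ln y) powr (1/p) * growth p x powr (1/p)" by (rule powr_mult)
      also have "\<dots> \<le> ((1 + 2 / D) * y powr (D / 2)) * growth p x powr (1/p)"
      proof (intro mult_right_mono)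
        have "(1 + ln y) powr (1/p) \<le> (1 + ln y) powr 1" using ly 2 by (intro powr_mono) auto
        also have "\<dots> = 1 + ln y" using ly by simp
        also have "\<dots> \<le> y powr (D / 2) + y powr (D / 2) / (D / 2)"
          using xy D by (intro add_mono ln_powr_bound ge_one_powr_ge_zero) auto
        finally show "(1 + ln y) powr (1/p) \<le> (1 + 2 / D) * y powr (D / 2)" by (simp add: algebra_simps)
      qed simp
      finally have l: "growth p (y * x) powr (1/p) \<le> (1 + 2 / D) * y powr (D / 2) * growth p x powr (1/p)" .
      have "tail_rate p s (y * x) = (y powr (- D) * x powr (- D)) * growth p (y * x) powr (1/p)"
        using *[OF yx] by (simp add: powr_mult)
      also have "\<dots> \<le> (y powr (- D) * x powr (- D)) * ((1 + 2 / D) * y powr (D / 2) * growth p x powr (1/p))"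
        by (intro mult_left_mono l) auto
      also have "\<dots> = (1 + 2 / D) * (y powr (- D) * y powr (D / 2)) * (x powr (- D) * growth p x powr (1/p))"
        by (simp add: mult_ac)
      also have "y powr (- D) * y powr (D / 2) = y powr (- (D / 2))" by (simp add: powr_add[symmetric])
      also have "x powr (- D) * growth p x powr (1/p) = tail_rate p s x"
        using *[OF xy(1)] by simp
      finally show "tail_rate p s (y * x) \<le> (1 + 2 / D) * y powr (- (D / 2)) * tail_rate p s x" .
    qed
  next
    case 3
    have e: "(p / 2 - 2) * (1/p) = 1/2 - 2/p" using 3 by (simp add: field_simps)
    show thesis
    proof (rule that[of 1 "2 * s - 1 + 2 / p"])
      show "2 * s - 1 + 2 / p > 0" using s 3 by (simp add: s_star_def)
      fix x y :: real assume xy: "x \<ge> 1" "y \<ge> 1"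
      have *: "tail_rate p s z = z powr (- (2 * s - 1 + 2 / p))" if "z \<ge> 1" for z
      proof -
        have "tail_rate p s z = z powr (- 2 * s) * (z powr (1/2) * z powr ((p / 2 - 2) * (1/p)))"
          using 3 that by (simp add: tail_rate_def gauss_rate_def growth_def powr_half_sqrt powr_powr)
        also have "\<dots> = z powr (- 2 * s + (1/2 + (1/2 - 2/p)))" unfolding e powr_add ..
        finally show ?thesis by (simp add: algebra_simps)
      qed
      have "y * x \<ge> 1" using mult_mono[of 1 y 1 x] xy by simp
      then show "tail_rate p s (y * x) \<le> 1 * y powr (- (2 * s - 1 + 2 / p)) * tail_rate p s x"
        using xy by (simp add: * powr_mult)
    qed simp
  qed
qed

lemma s_star_ge: "p \<ge> 2 \<Longrightarrow> s_star p \<ge> 1/4"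
  by (auto simp: s_star_def field_simps)

lemma Lp_bound_tail:
  assumes p: "p \<ge> 2" and s: "s > s_star p"
  obtains C where "C > 0"
    "\<And>L M. L \<ge> 1 \<Longrightarrow> Lp_bound p (sq_sum s L M) (C * tail_rate p s (real L))"
proof -
  have s0: "s > 0" using s s_star_ge[OF p] by linarith
  obtain C where C: "C > 0"
    "\<And>L M. L \<ge> 1 \<Longrightarrow> M \<le> 2 * L \<Longrightarrow> Lp_bound p (sq_sum s L M) (C * tail_rate p s (real L))"
    using Lp_bound_block[OF p s0] by blast
  obtain B \<delta> where B: "B > 0" "\<delta> > 0"
    "\<And>x y. x \<ge> 1 \<Longrightarrow> y \<ge> 1 \<Longrightarrow> tail_rate p s (y * x) \<le> B * y powr (- \<delta>) * tail_rate p s x"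
    using tail_rate_decay[OF p s] by blast
  define q where "q = 2 powr (- \<delta>)"
  have q: "0 < q" "q < 1" using B powr_less_mono[of "-\<delta>" 0 2] by (auto simp: q_def)
  show thesis
  proof (rule that)
    show "C * B / (1 - q) > 0" using C B q by simp
    fix L M :: nat assume L: "L \<ge> 1"
    have T0: "tail_rate p s (real L) \<ge> 0" by (simp add: tail_rate_nonneg)
    \<comment> \<open>Any number of blocks that reaches \<open>M\<close> will do, since the
      geometric series bounds them uniformly; \<open>M\<close> blocks are more than enough.\<close>
    have "M < 2 ^ M" by (rule less_exp)
    then have "M \<le> 2 ^ M * L" using L by (metis le_trans less_imp_le mult_le_mono2 mult.right_neutral)
    from Lp_bound_dyadic[OF p C L this]
    have 1: "Lp_bound p (sq_sum s L M) (\<Sum>k<M. C * tail_rate p s (2 ^ k * real L))" .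
    have "(\<Sum>k<M. C * tail_rate p s (2 ^ k * real L)) \<le> (\<Sum>k<M. C * (B * q ^ k * tail_rate p s (real L)))"
    proof (intro sum_mono mult_left_mono)
      fix k
      have "tail_rate p s (2 ^ k * real L) \<le> B * (2 ^ k) powr (- \<delta>) * tail_rate p s (real L)"
        using L by (intro B) auto
      also have "(2 ^ k) powr (- \<delta>) = q ^ k"
        by (simp add: q_def powr_realpow[symmetric] powr_powr mult.commute)
      finally show "tail_rate p s (2 ^ k * real L) \<le> B * q ^ k * tail_rate p s (real L)" .
    qed (use C in auto)
    also have "\<dots> = C * B * tail_rate p s (real L) * (\<Sum>k<M. q ^ k)"
      unfolding sum_distrib_left by (intro sum.cong) (auto simp: mult_ac)
    also have "\<dots> \<le> C * B * tail_rate p s (real L) * (1 / (1 - q))"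
    proof (intro mult_left_mono)
      have "(\<Sum>k<M. q ^ k) \<le> (\<Sum>k. q ^ k)" using q by (intro sum_le_suminf summable_geometric) auto
      then show "(\<Sum>k<M. q ^ k) \<le> 1 / (1 - q)" using q by (simp add: suminf_geometric)
    qed (use C B T0 in auto)
    finally show "Lp_bound p (sq_sum s L M) (C * B / (1 - q) * tail_rate p s (real L))"
      using p by (intro Lp_bound_mono[OF 1]) (auto simp: mult_ac)
  qed
qed

section \<open>Limits of partial sums\<close>

lemma continuous_on_sq_term: "continuous_on A (sq_term s n)"
  unfolding sq_term_def by (intro continuous_intros)

lemma borel_measurable_sum_sq_term [measurable]: "(\<lambda>x. \<Sum>n\<in>A. sq_term s n x) \<in> borel_measurable borel"
  by (intro borel_measurable_continuous_onI continuous_on_sum continuous_on_sq_term)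

lemma le_add_powr:
  fixes c y p :: real
  assumes "c > 0" "y \<ge> 0" "p \<ge> 1"
  shows "y \<le> c + c powr (1 - p) * y powr p"
proof (cases "y \<le> c")
  case True
  then show ?thesis by (simp add: add_increasing2)
next
  case False
  have "c powr (1 - p) * y powr p = c * (y / c) powr p"
    using assms by (simp add: powr_diff powr_divide)
  also have "\<dots> \<ge> c * (y / c) powr 1"
    using assms False by (intro mult_left_mono powr_mono) auto
  also have "c * (y / c) powr 1 = y" using assms by simp
  finally show ?thesis using assms by simp
qed

text \<open>Splitting at the height \<open>c\<close> replaces Hoelder's inequality and costs a
  factor 2. Geometric smallness in the \<open>p\<close>-norm thus becomes summability in the
  1-norm.\<close>

lemma nn_integral_norm_le_of_Lp_bound:
  assumes "Lp_bound p f c" "c > 0" "p \<ge> 1"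
  shows "(\<integral>\<^sup>+ x. ennreal (cmod (f x)) * indicator {0..1} x \<partial>lborel) \<le> ennreal (2 * c)"
proof -
  have m [measurable]: "f \<in> borel_measurable borel" using assms by (simp add: Lp_bound_def)
  have "(\<integral>\<^sup>+ x. ennreal (cmod (f x)) * indicator {0..1} x \<partial>lborel) \<le>
     (\<integral>\<^sup>+ x. ennreal c * indicator {0..1} x + ennreal (c powr (1 - p)) * (ennreal (cmod (f x) powr p) * indicator {0..1} x) \<partial>lborel)"
    by (rule nn_integral_mono)
      (use le_add_powr[OF assms(2) _ assms(3)] assms(2) in \<open>auto simp: indicator_def ennreal_mult[symmetric] simp flip: ennreal_plus intro!: ennreal_leI\<close>)
  also have "\<dots> = ennreal c + ennreal (c powr (1 - p)) * Lp_pow p f"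
    unfolding Lp_pow_def by (subst nn_integral_add) (auto simp: nn_integral_cmult)
  also have "\<dots> \<le> ennreal c + ennreal (c powr (1 - p)) * ennreal (c powr p)"
    using assms by (intro add_mono mult_left_mono) (auto simp: Lp_bound_def)
  also have "\<dots> = ennreal (c + c powr (1 - p) * c powr p)"
    using assms by (simp add: ennreal_mult)
  also have "c powr (1 - p) * c powr p = c"
    using assms by (simp add: powr_add[symmetric])
  finally show ?thesis by simp
qed

lemma tail_rate_tendsto_0:
  assumes "p \<ge> 2" "s > s_star p"
  shows "(\<lambda>n. tail_rate p s (real n)) \<longlonglongrightarrow> 0"
proof -
  obtain B \<delta> where B: "B > 0" "\<delta> > 0"
    "\<And>x y. x \<ge> 1 \<Longrightarrow> y \<ge> 1 \<Longrightarrow> tail_rate p s (y * x) \<le> B * y powr (- \<delta>) * tail_rate p s x"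
    using tail_rate_decay[OF assms] by blast
  have "(\<lambda>n. B * real n powr (- \<delta>) * tail_rate p s 1) \<longlonglongrightarrow> B * 0 * tail_rate p s 1"
    using B by (intro tendsto_intros tendsto_neg_powr filterlim_real_sequentially) auto
  then have *: "(\<lambda>n. B * real n powr (- \<delta>) * tail_rate p s 1) \<longlonglongrightarrow> 0" by simp
  show ?thesis
  proof (rule tendsto_sandwich[OF _ _ tendsto_const *])
    show "\<forall>\<^sub>F n in sequentially. 0 \<le> tail_rate p s (real n)" by (simp add: tail_rate_nonneg)
    show "\<forall>\<^sub>F n in sequentially. tail_rate p s (real n) \<le> B * real n powr (- \<delta>) * tail_rate p s 1"
      using eventually_ge_at_top[of 1] by eventually_elim (use B(3)[of 1] in auto)
  qed
qed

lemma Lp_pow_minus_commute: "Lp_pow p (\<lambda>x. f x - g x) = Lp_pow p (\<lambda>x. g x - f x)"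
  by (simp add: Lp_pow_def norm_minus_commute)

text \<open>The Riesz-Fischer argument. Along the indices \<open>2 ^ k * L\<close> the increments
  have geometrically small norms, so they are absolutely summable almost everywhere, which defines
  \<open>g\<close>. Fatou's lemma then carries the tail bound to \<open>S M - g\<close> for every
  \<open>M \<ge> L\<close>, and so the full sequence converges, not just the subsequence.\<close>

lemma ex_Lp_limit_tail:
  assumes p: "p \<ge> 2" and s: "s > s_star p" and L: "L \<ge> 1"
  shows "\<exists>g. Lp_limit p (sq_sum s L) g"
proof -
  obtain C where C: "C > 0"
    "\<And>L M. L \<ge> 1 \<Longrightarrow> Lp_bound p (sq_sum s L M) (C * tail_rate p s (real L))"
    using Lp_bound_tail[OF p s] by blast
  obtain B \<delta> where B: "B > 0" "\<delta> > 0"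
    "\<And>x y. x \<ge> 1 \<Longrightarrow> y \<ge> 1 \<Longrightarrow> tail_rate p s (y * x) \<le> B * y powr (- \<delta>) * tail_rate p s x"
    using tail_rate_decay[OF p s] by blast
  define S where "S M x = (\<Sum>n\<in>{L..<M}. sq_term s n x)" for M x
  have S_diff: "S M' x - S M x = (\<Sum>n\<in>{M..<M'}. sq_term s n x)" if "L \<le> M" "M \<le> M'" for M M' x
    using sum.atLeastLessThan_concat[OF that, of "\<lambda>n. sq_term s n x"] by (simp add: S_def algebra_simps)
  have [measurable]: "S M \<in> borel_measurable borel" for M unfolding S_def by measurable
  define f where "f k x = S (2 ^ Suc k * L) x - S (2 ^ k * L) x" for k x
  define q where "q = 2 powr (- \<delta>)"
  have q: "0 < q" "q < 1" using B powr_less_mono[of "-\<delta>" 0 2] by (auto simp: q_def)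
  \<comment> \<open>The summand 1 makes the bound strictly positive, as the comparison with the
    1-norm demands.\<close>
  define E where "E = C * B * tail_rate p s (real L) + 1"
  have T0: "tail_rate p s (real L) \<ge> 0" by (simp add: tail_rate_nonneg)
  have E: "E > 0" unfolding E_def using C B T0 by (intro add_nonneg_pos) auto
  have fb: "Lp_bound p (f k) (E * q ^ k)" for k
  proof -
    have "f k = (sq_sum s (2 ^ k * L) (2 ^ Suc k * L))"
      unfolding f_def by (intro ext S_diff) auto
    moreover have "Lp_bound p \<dots> (C * tail_rate p s (real (2 ^ k * L)))"
      using L by (intro C) auto
    moreover have "C * tail_rate p s (real (2 ^ k * L)) \<le> E * q ^ k"
    proof -
      have "tail_rate p s (2 ^ k * real L) \<le> B * (2 ^ k) powr (- \<delta>) * tail_rate p s (real L)"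
        using L by (intro B) auto
      also have "(2 ^ k) powr (- \<delta>) = q ^ k"
        by (simp add: q_def powr_realpow[symmetric] powr_powr mult.commute)
      finally have "C * tail_rate p s (2 ^ k * real L) \<le> C * (B * q ^ k * tail_rate p s (real L))"
        using C by (intro mult_left_mono) auto
      also have "\<dots> = (E - 1) * q ^ k" by (simp add: E_def)
      also have "\<dots> \<le> E * q ^ k" using q by (intro mult_right_mono) auto
      finally show ?thesis by simp
    qed
    ultimately show ?thesis using p by (auto elim: Lp_bound_mono)
  qed
  have [measurable]: "f k \<in> borel_measurable borel" for k unfolding f_def by measurable
  have "(\<integral>\<^sup>+ x. (\<Sum>k. ennreal (cmod (f k x)) * indicator {0..1} x) \<partial>lborel)
     = (\<Sum>k. \<integral>\<^sup>+ x. ennreal (cmod (f k x)) * indicator {0..1} x \<partial>lborel)"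
    by (rule nn_integral_suminf) measurable
  also have "\<dots> \<le> (\<Sum>k. ennreal (2 * (E * q ^ k)))"
    using E q p by (intro suminf_le nn_integral_norm_le_of_Lp_bound[OF fb]) auto
  also have "\<dots> = ennreal (\<Sum>k. 2 * (E * q ^ k))"
    using E q by (intro suminf_ennreal_eq summable_sums summable_mult summable_geometric) auto
  also have "\<dots> < \<infinity>" by simp
  finally have fin: "(\<integral>\<^sup>+ x. (\<Sum>k. ennreal (cmod (f k x)) * indicator {0..1} x) \<partial>lborel) \<noteq> \<infinity>" by simp
  have "AE x in lborel. (\<Sum>k. ennreal (cmod (f k x)) * indicator {0..1} x) \<noteq> \<infinity>"
    by (rule nn_integral_PInf_AE[OF _ fin]) measurable
  then have conv: "AE x in lborel. x \<in> {0..1} \<longrightarrow> convergent (\<lambda>k. S (2 ^ k * L) x)"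
  proof (rule AE_mp, intro AE_I2 impI)
    fix x :: real assume fx: "(\<Sum>k. ennreal (cmod (f k x)) * indicator {0..1} x) \<noteq> \<infinity>" and x: "x \<in> {0..1}"
    have "summable (\<lambda>k. cmod (f k x))"
      using fx x by (intro summable_suminf_not_top) auto
    then have "summable (\<lambda>k. f k x)" by (rule summable_norm_cancel)
    then have "convergent (\<lambda>k. \<Sum>j<k. f j x)" by (simp add: summable_iff_convergent)
    moreover have "(\<Sum>j<k. f j x) = S (2 ^ k * L) x" for k
      unfolding f_def by (subst sum_lessThan_telescope) (simp add: S_def)
    ultimately show "convergent (\<lambda>k. S (2 ^ k * L) x)" by simp
  qed
  \<comment> \<open>On the null set of divergence inside the period, and wherever else convergence
    fails, \<open>lim\<close> has some unspecified value; \<open>g\<close> is measurable all the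
    same.\<close>
  define g where "g x = lim (\<lambda>k. S (2 ^ k * L) x)" for x
  have [measurable]: "g \<in> borel_measurable borel" unfolding g_def by measurable
  have main: "Lp_pow p (\<lambda>x. S M x - g x) \<le> ennreal ((C * tail_rate p s (real M)) powr p)" if M: "M \<ge> L" for M
  proof -
    have "Lp_pow p (\<lambda>x. S M x - g x) \<le>
      (\<integral>\<^sup>+ x. liminf (\<lambda>k. ennreal (cmod (S M x - S (2 ^ k * L) x) powr p) * indicator {0..1} x) \<partial>lborel)"
      unfolding Lp_pow_def
    proof (rule nn_integral_mono_AE, rule AE_mp[OF conv], intro AE_I2 impI)
      fix x :: real assume c: "x \<in> {0..1} \<longrightarrow> convergent (\<lambda>k. S (2 ^ k * L) x)"
      show "ennreal (cmod (S M x - g x) powr p) * indicator {0..1} x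
         \<le> liminf (\<lambda>k. ennreal (cmod (S M x - S (2 ^ k * L) x) powr p) * indicator {0..1} x)"
      proof (cases "x \<in> {0..1}")
        case True
        then have "(\<lambda>k. S (2 ^ k * L) x) \<longlonglongrightarrow> g x"
          using c unfolding g_def by (simp add: convergent_LIMSEQ_iff)
        then have "(\<lambda>k. ennreal (cmod (S M x - S (2 ^ k * L) x) powr p)) \<longlonglongrightarrow> ennreal (cmod (S M x - g x) powr p)"
          using p by (intro tendsto_ennrealI tendsto_powr' tendsto_intros) (auto intro!: always_eventually)
        then have "liminf (\<lambda>k. ennreal (cmod (S M x - S (2 ^ k * L) x) powr p)) = ennreal (cmod (S M x - g x) powr p)"
          by (intro lim_imp_Liminf) auto
        then show ?thesis using True by simp
      qed simp
    qed
    also have "\<dots> \<le> liminf (\<lambda>k. \<integral>\<^sup>+ x. ennreal (cmod (S M x - S (2 ^ k * L) x) powr p) * indicator {0..1} x \<partial>lborel)"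
      by (rule nn_integral_liminf) measurable
    also have "\<dots> \<le> ennreal ((C * tail_rate p s (real M)) powr p)"
    proof (rule Liminf_le)
      show "\<forall>\<^sub>F k in sequentially. (\<integral>\<^sup>+ x. ennreal (cmod (S M x - S (2 ^ k * L) x) powr p) * indicator {0..1} x \<partial>lborel)
          \<le> ennreal ((C * tail_rate p s (real M)) powr p)"
        using eventually_ge_at_top[of M]
      proof eventually_elim
        case (elim k)
        have "k < 2 ^ k" by (rule less_exp)
        then have "k \<le> 2 ^ k * L" using L by (metis le_trans less_imp_le mult_le_mono2 mult.right_neutral)
        then have Mk: "M \<le> 2 ^ k * L" using elim by linarith
        have "Lp_pow p (\<lambda>x. S M x - S (2 ^ k * L) x) = Lp_pow p (\<lambda>x. S (2 ^ k * L) x - S M x)"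
          by (rule Lp_pow_minus_commute)
        also have "\<dots> = Lp_pow p (sq_sum s M (2 ^ k * L))"
          using S_diff[OF M Mk] by simp
        also have "\<dots> \<le> ennreal ((C * tail_rate p s (real M)) powr p)"
          using C(2)[of M] M L by (auto simp: Lp_bound_def)
        finally show ?case unfolding Lp_pow_def .
      qed
    qed simp
    finally show ?thesis .
  qed
  have "(\<lambda>M. ennreal ((C * tail_rate p s (real M)) powr p)) \<longlonglongrightarrow> ennreal ((C * 0) powr p)"
    using p C by (intro tendsto_ennrealI tendsto_powr' tendsto_intros tail_rate_tendsto_0[OF p s])
      (auto intro!: always_eventually mult_nonneg_nonneg simp: tail_rate_nonneg)
  then have lim0: "(\<lambda>M. ennreal ((C * tail_rate p s (real M)) powr p)) \<longlonglongrightarrow> 0" using p by simp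
  have "(\<lambda>M. Lp_pow p (\<lambda>x. S M x - g x)) \<longlonglongrightarrow> 0"
  proof (rule tendsto_sandwich[OF _ _ tendsto_const lim0])
    show "\<forall>\<^sub>F M in sequentially. Lp_pow p (\<lambda>x. S M x - g x) \<le> ennreal ((C * tail_rate p s (real M)) powr p)"
      using eventually_ge_at_top[of L] by eventually_elim (rule main)
  qed simp
  then show ?thesis unfolding Lp_limit_def S_def by (intro exI[of _ g]) simp
qed

lemma Lp_limit_bound_diff:
  assumes "Lp_limit p S g" "\<epsilon> > 0" "\<And>M. S M \<in> borel_measurable borel"
  shows "\<forall>\<^sub>F M in sequentially. Lp_bound p (\<lambda>x. S M x - g x) \<epsilon>"
proof -
  have "(\<lambda>M. Lp_pow p (\<lambda>x. S M x - g x)) \<longlonglongrightarrow> 0" "g \<in> borel_measurable borel"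
    using assms by (auto simp: Lp_limit_def)
  note lim = this
  have "\<forall>\<^sub>F M in sequentially. Lp_pow p (\<lambda>x. S M x - g x) < ennreal (\<epsilon> powr p)"
    by (rule order_tendstoD(2)[OF lim(1)]) (use assms in auto)
  then show ?thesis
    by eventually_elim (use lim assms in \<open>auto simp: Lp_bound_def intro!: borel_measurable_diff less_imp_le\<close>)
qed

lemma Lp_limit_upper:
  assumes "Lp_limit p S g" "\<And>M. Lp_bound p (S M) a" "p \<ge> 1"
  shows "Lp_bound p g a"
proof -
  have m: "g \<in> borel_measurable borel" "a \<ge> 0" using assms(1) assms(2)[of 0] by (auto simp: Lp_limit_def Lp_bound_def)
  have "Lp_pow p g \<le> ennreal ((a + inverse (real (Suc n))) powr p)" for n
  proof -
    have "\<forall>\<^sub>F M in sequentially. Lp_bound p (\<lambda>x. S M x - g x) (inverse (real (Suc n)))"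
      using assms(2) by (intro Lp_limit_bound_diff[OF assms(1)]) (auto simp: Lp_bound_def)
    then obtain M where M: "Lp_bound p (\<lambda>x. S M x - g x) (inverse (real (Suc n)))"
      using eventually_happens'[OF sequentially_bot] by blast
    have "Lp_bound p (\<lambda>x. S M x + (- 1) * (S M x - g x)) (a + cmod (- 1) * inverse (real (Suc n)))"
      using assms(3) by (intro Lp_bound_add assms(2) Lp_bound_scale M) auto
    then show ?thesis by (simp add: Lp_bound_def)
  qed
  moreover have "(\<lambda>n. ennreal ((a + inverse (real (Suc n))) powr p)) \<longlonglongrightarrow> ennreal ((a + 0) powr p)"
    using assms(3) m by (intro tendsto_ennrealI tendsto_powr' tendsto_intros LIMSEQ_inverse_real_of_nat)
       (auto intro!: always_eventually)
  ultimately have "Lp_pow p g \<le> ennreal ((a + 0) powr p)" using LIMSEQ_le_const by blast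
  then show ?thesis using m by (simp add: Lp_bound_def)
qed

text \<open>The triangle inequality for \<open>S M = g + (S M - g)\<close>. Finiteness has to be
  assumed because \<open>enn2real\<close> sends infinity to 0, where the conclusion would
  fail.\<close>

lemma Lp_limit_lower:
  assumes "Lp_limit p S g" "\<And>M. S M \<in> borel_measurable borel" "p \<ge> 1" "l \<ge> 0"
    and lower: "\<forall>\<^sub>F M in sequentially. ennreal (l powr p) \<le> Lp_pow p (S M)"
    and fin: "Lp_pow p g < \<infinity>"
  shows "l powr p \<le> enn2real (Lp_pow p g)"
proof -
  define b where "b = enn2real (Lp_pow p g) powr (1 / p)"
  have bp: "b powr p = enn2real (Lp_pow p g)" using assms(3) by (simp add: b_def powr_powr)
  have gb: "Lp_bound p g b"
    unfolding Lp_bound_def bp using fin assms(1) by (auto simp: Lp_limit_def b_def)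
  have "l \<le> b + \<epsilon>" if "\<epsilon> > 0" for \<epsilon>
  proof -
    have "\<forall>\<^sub>F M in sequentially. Lp_bound p (\<lambda>x. S M x - g x) \<epsilon>"
      using that assms by (intro Lp_limit_bound_diff) auto
    then have "\<forall>\<^sub>F M in sequentially. Lp_bound p (\<lambda>x. S M x - g x) \<epsilon> \<and> ennreal (l powr p) \<le> Lp_pow p (S M)"
      using lower by eventually_elim auto
    then obtain M where M: "Lp_bound p (\<lambda>x. S M x - g x) \<epsilon>" "ennreal (l powr p) \<le> Lp_pow p (S M)"
      using eventually_happens'[OF sequentially_bot] by blast
    have "Lp_bound p (\<lambda>x. g x + (S M x - g x)) (b + \<epsilon>)"
      using assms(3) by (intro Lp_bound_add gb M) auto
    then have "Lp_pow p (S M) \<le> ennreal ((b + \<epsilon>) powr p)" by (simp add: Lp_bound_def)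
    with M(2) have "ennreal (l powr p) \<le> ennreal ((b + \<epsilon>) powr p)" by (rule order_trans)
    then have "l powr p \<le> (b + \<epsilon>) powr p" by (simp add: ennreal_le_iff)
    moreover have "b + \<epsilon> \<ge> 0" using that by (simp add: b_def)
    ultimately show ?thesis using assms(3) powr_less_mono2[of p "b + \<epsilon>" l] by linarith
  qed
  then have "l \<le> b" by (rule field_le_epsilon)
  then have "l powr p \<le> b powr p" using assms by (intro powr_mono2) auto
  then show ?thesis by (simp add: bp)
qed

text \<open>The denominator of the flatness is the 2-norm of the same \<open>g\<close>; this makes
  the estimates at exponent 2 applicable to it.\<close>

lemma Lp_limit_imp_L2_limit:
  assumes "Lp_limit p S g" "p \<ge> 2" "\<And>M. S M \<in> borel_measurable borel"
  shows "Lp_limit 2 S g"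
proof -
  have "(\<lambda>M. Lp_pow 2 (\<lambda>x. S M x - g x)) \<longlonglongrightarrow> 0"
  proof (rule order_tendstoI)
    fix a :: ennreal assume "0 < a"
    obtain \<epsilon> where e: "\<epsilon> > 0" "ennreal (\<epsilon> powr 2) < a"
    proof (cases a)
      case top
      then show thesis using that[of 1] by simp
    next
      case (real r)
      then have "r > 0" using \<open>0 < a\<close> by auto
      then show thesis using that[of "sqrt (r/2)"] real by (simp add: ennreal_less_iff)
    qed
    have "\<forall>\<^sub>F M in sequentially. Lp_bound p (\<lambda>x. S M x - g x) \<epsilon>"
      using e assms by (intro Lp_limit_bound_diff) auto
    then show "\<forall>\<^sub>F M in sequentially. Lp_pow 2 (\<lambda>x. S M x - g x) < a"
    proof eventually_elim
      case (elim M)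
      have "Lp_bound 2 (\<lambda>x. S M x - g x) \<epsilon>" by (rule Lp_bound_lower_exponent[OF elim assms(2) e(1)])
      then show ?case using e(2) by (auto simp: Lp_bound_def)
    qed
  qed simp
  then show ?thesis using assms by (simp add: Lp_limit_def)
qed

section \<open>Equal sums of two squares\<close>

lemma card_multiples_ge:
  fixes d P R :: nat
  assumes "d > 0"
  shows "R div d \<le> card {b \<in> {P<..P + R}. d dvd b}"
proof -
  define f where "f i = d * (P div d + 1 + i)" for i
  have "f ` {..<R div d} \<subseteq> {b \<in> {P<..P + R}. d dvd b}"
  proof (rule image_subsetI)
    fix i assume "i \<in> {..<R div d}"
    then have i: "i + 1 \<le> R div d" by simp
    have "P < d * (P div d + 1)" using assms
      by (metis dividend_less_div_times mult.commute mult_Suc_right Suc_eq_plus1 add.commute)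
    also have "\<dots> \<le> f i" by (simp add: f_def)
    finally have 1: "P < f i" .
    have "f i \<le> d * (P div d) + d * (R div d)"
      using i by (simp add: f_def algebra_simps) (metis add.commute add_le_cancel_left mult_Suc_right mult_le_mono2 Suc_eq_plus1)
    also have "\<dots> \<le> P + R" by (intro add_mono) (simp_all add: mult.commute)
    finally show "f i \<in> {b \<in> {P<..P + R}. d dvd b}" using 1 by (simp add: f_def)
  qed
  moreover have "inj_on f {..<R div d}" using assms by (auto simp: f_def inj_on_def)
  ultimately have "card {..<R div d} \<le> card {b \<in> {P<..P + R}. d dvd b}"
    by (intro card_inj_on_le[of f]) auto
  then show ?thesis by simp
qed

text \<open>Gauss's divisor identity gives \<open>1 / m\<close> as the sum of
  \<open>totient d / m\<^sup>2\<close> over \<open>d dvd m\<close>. Writing \<open>m = d * k\<close>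
  bounds the harmonic sum by the totient sum times the sum of \<open>1 / k\<^sup>2\<close>, which is
  at most 2.\<close>

lemma sum_totient_ge:
  "ln (real X + 1) / 2 \<le> (\<Sum>d\<in>{1..X}. real (totient d) / (real d)\<^sup>2)"
proof -
  define \<Phi> where "\<Phi> = (\<Sum>d\<in>{1..X}. real (totient d) / (real d)\<^sup>2)"
  have \<Phi>: "\<Phi> \<ge> 0" unfolding \<Phi>_def by (intro sum_nonneg) auto
  have "ln (real X + 1) \<le> (\<Sum>m\<in>{1..X}. 1 / real m)"
    using ln_le_harm[of X] by (simp add: harm_def inverse_eq_divide)
  also have "\<dots> = (\<Sum>m\<in>{1..X}. \<Sum>d\<in>{d. d dvd m}. real (totient d) / (real d)\<^sup>2 * (1 / (real (m div d))\<^sup>2))"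
  proof (rule sum.cong[OF refl])
    fix m assume m: "m \<in> {1..X}"
    have "(\<Sum>d\<in>{d. d dvd m}. real (totient d) / (real d)\<^sup>2 * (1 / (real (m div d))\<^sup>2))
       = (\<Sum>d\<in>{d. d dvd m}. real (totient d) / (real m)\<^sup>2)"
    proof (rule sum.cong[OF refl])
      fix d assume "d \<in> {d. d dvd m}"
      then obtain k where k: "m = d * k" by auto
      then show "real (totient d) / (real d)\<^sup>2 * (1 / (real (m div d))\<^sup>2) = real (totient d) / (real m)\<^sup>2"
        using m by (auto simp: power_mult_distrib)
    qed
    also have "\<dots> = real (\<Sum>d\<in>{d. d dvd m}. totient d) / (real m)\<^sup>2"
      by (simp add: sum_divide_distrib)
    also have "\<dots> = 1 / real m" using m by (simp add: totient_divisor_sum power2_eq_square)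
    finally show "1 / real m = (\<Sum>d\<in>{d. d dvd m}. real (totient d) / (real d)\<^sup>2 * (1 / (real (m div d))\<^sup>2))" ..
  qed
  also have "\<dots> = (\<Sum>(m, d)\<in>(SIGMA m:{1..X}. {d. d dvd m}). real (totient d) / (real d)\<^sup>2 * (1 / (real (m div d))\<^sup>2))"
    by (rule sum.Sigma) (auto intro!: finite_divisors_nat)
  also have "\<dots> \<le> (\<Sum>(d, k)\<in>{1..X} \<times> {1..X}. real (totient d) / (real d)\<^sup>2 * (1 / (real k)\<^sup>2))"
  proof -
    define h where "h = (\<lambda>(m, d). (d, m div d :: nat))"
    have inj: "inj_on h (SIGMA m:{1..X}. {d. d dvd m})"
      by (auto simp: inj_on_def h_def)
    have "(\<Sum>(m, d)\<in>(SIGMA m:{1..X}. {d. d dvd m}). real (totient d) / (real d)\<^sup>2 * (1 / (real (m div d))\<^sup>2))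
      = (\<Sum>(d, k)\<in>h ` (SIGMA m:{1..X}. {d. d dvd m}). real (totient d) / (real d)\<^sup>2 * (1 / (real k)\<^sup>2))"
      by (subst sum.reindex[OF inj]) (auto simp: h_def intro!: sum.cong)
    also have "\<dots> \<le> (\<Sum>(d, k)\<in>{1..X} \<times> {1..X}. real (totient d) / (real d)\<^sup>2 * (1 / (real k)\<^sup>2))"
    proof (rule sum_mono2)
      show "h ` (SIGMA m:{1..X}. {d. d dvd m}) \<subseteq> {1..X} \<times> {1..X}"
      proof (rule image_subsetI)
        fix t assume "t \<in> (SIGMA m:{1..X}. {d. d dvd m})"
        then obtain m d where md: "t = (m, d)" "m \<in> {1..X}" "d dvd m" by auto
        then have "d \<ge> 1" "d \<le> m" "m div d \<ge> 1" "m div d \<le> m"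
          by (auto simp: dvd_imp_le Suc_le_eq div_greater_zero_iff intro!: Nat.gr0I)
        then show "h t \<in> {1..X} \<times> {1..X}"
          using md le_trans[of "m div d" m X] by (auto simp: h_def)
      qed
    qed auto
    finally show ?thesis .
  qed
  also have "\<dots> = \<Phi> * (\<Sum>k\<in>{1..X}. 1 / (real k)\<^sup>2)"
    unfolding \<Phi>_def sum_product by (rule sum.cartesian_product[symmetric])
  also have "\<dots> \<le> \<Phi> * 2" using \<Phi> by (intro mult_left_mono sum_inverse_squares_le)
  finally show ?thesis by (simp add: \<Phi>_def)
qed

text \<open>Expand the gcd as the sum of \<open>totient d\<close> over common divisors and exchange
  sums: each \<open>d \<le> X\<close> is counted with the square of its number of multiples in the
  interval. That number is at least \<open>X div d\<close>, and rounding down costs at most a factor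
  2 since \<open>X div d \<ge> 1\<close>.\<close>

lemma sum_gcd_ge:
  "(real X)\<^sup>2 * ln (real X + 1) / 8 \<le> (\<Sum>a\<in>{X<..2*X}. \<Sum>c\<in>{X<..2*X}. real (gcd a c))"
proof -
  have "(real X)\<^sup>2 * ln (real X + 1) / 8 = (real X)\<^sup>2 / 4 * (ln (real X + 1) / 2)" by simp
  also have "\<dots> \<le> (real X)\<^sup>2 / 4 * (\<Sum>d\<in>{1..X}. real (totient d) / (real d)\<^sup>2)"
    by (intro mult_left_mono sum_totient_ge) auto
  also have "\<dots> = (\<Sum>d\<in>{1..X}. real (totient d) * (real X / (2 * real d))\<^sup>2)"
    by (simp add: sum_distrib_left power_divide power_mult_distrib mult_ac)
  also have "\<dots> \<le> (\<Sum>d\<in>{1..X}. real (totient d) * (real (card {b \<in> {X<..2*X}. d dvd b}))\<^sup>2)"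
  proof (intro sum_mono mult_left_mono power_mono)
    fix d assume d: "d \<in> {1..X}"
    have "real X / (2 * real d) \<le> real (X div d)"
    proof -
      have "X div d \<ge> 1" using d by (simp add: Suc_le_eq div_greater_zero_iff)
      moreover have "X < d * (X div d) + d"
        using d by (metis atLeastAtMost_iff dividend_less_times_div less_le_trans less_one add.commute)
      ultimately have "X < d * (X div d) + d * (X div d)"
        by (metis add_left_mono le_trans less_le_trans mult.right_neutral mult_le_mono2)
      then have "real X < real (d * (X div d) + d * (X div d))" by (simp only: of_nat_less_iff)
      then show ?thesis using d by (simp add: field_simps)
    qed
    also have "\<dots> \<le> real (card {b \<in> {X<..2*X}. d dvd b})"
      using card_multiples_ge[of d X X] d by (simp add: mult_2)
    finally show "real X / (2 * real d) \<le> real (card {b \<in> {X<..2*X}. d dvd b})" .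
  qed auto
  also have "\<dots> = (\<Sum>d\<in>{1..X}. \<Sum>a\<in>{X<..2*X}. \<Sum>c\<in>{X<..2*X}. if d dvd a \<and> d dvd c then real (totient d) else 0)"
  proof (rule sum.cong[OF refl])
    fix d
    have c: "real (card {b \<in> {X<..2*X}. d dvd b}) = (\<Sum>b\<in>{X<..2*X}. if d dvd b then 1 else 0)"
      by (simp add: sum.If_cases Int_def)
    have "real (totient d) * (real (card {b \<in> {X<..2*X}. d dvd b}))\<^sup>2
       = real (totient d) * ((\<Sum>a\<in>{X<..2*X}. if d dvd a then 1 else 0) * (\<Sum>c\<in>{X<..2*X}. if d dvd c then 1 else 0))"
      unfolding c power2_eq_square ..
    also have "\<dots> = (\<Sum>a\<in>{X<..2*X}. \<Sum>c\<in>{X<..2*X}. real (totient d) * ((if d dvd a then 1 else 0) * (if d dvd c then 1 else 0)))"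
      by (subst sum_product) (simp only: sum_distrib_left)
    also have "\<dots> = (\<Sum>a\<in>{X<..2*X}. \<Sum>c\<in>{X<..2*X}. if d dvd a \<and> d dvd c then real (totient d) else 0)"
      by (intro sum.cong refl) auto
    finally show "real (totient d) * (real (card {b \<in> {X<..2*X}. d dvd b}))\<^sup>2
       = (\<Sum>a\<in>{X<..2*X}. \<Sum>c\<in>{X<..2*X}. if d dvd a \<and> d dvd c then real (totient d) else 0)" .
  qed
  also have "\<dots> = (\<Sum>a\<in>{X<..2*X}. \<Sum>c\<in>{X<..2*X}. \<Sum>d\<in>{1..X}. if d dvd a \<and> d dvd c then real (totient d) else 0)"
    by (rule trans[OF sum.swap]) (intro sum.cong refl sum.swap)
  also have "\<dots> \<le> (\<Sum>a\<in>{X<..2*X}. \<Sum>c\<in>{X<..2*X}. real (gcd a c))"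
  proof (intro sum_mono)
    fix a c assume a: "a \<in> {X<..2*X}" "c \<in> {X<..2*X}"
    have "(\<Sum>d\<in>{1..X}. if d dvd a \<and> d dvd c then real (totient d) else 0)
      = (\<Sum>d\<in>{d\<in>{1..X}. d dvd a \<and> d dvd c}. real (totient d))"
      by (rule sum.inter_filter[symmetric]) simp
    also have "\<dots> \<le> (\<Sum>d\<in>{d. d dvd gcd a c}. real (totient d))"
      using a by (intro sum_mono2 finite_divisors_nat) auto
    also have "\<dots> = real (gcd a c)" using totient_divisor_sum[of "gcd a c"] by (simp only: of_nat_sum[symmetric])
    finally show "(\<Sum>d\<in>{1..X}. if d dvd a \<and> d dvd c then real (totient d) else 0) \<le> real (gcd a c)" .
  qed
  finally show ?thesis .
qed

text \<open>The solutions of \<open>n\<^sub>1\<^sup>2 + n\<^sub>2\<^sup>2 = n\<^sub>3\<^sup>2 + n\<^sub>4\<^sup>2\<close> are produced from factorisations \<open>a b = c d\<close>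
  as \<open>(b + a)\<^sup>2 + (d - c)\<^sup>2 = (b - a)\<^sup>2 + (d + c)\<^sup>2\<close>.\<close>

lemma many_equal_sums_of_two_squares:
  fixes L :: nat
  assumes L: "L \<ge> 2"
  obtains Q where "finite Q" "Q \<subseteq> ({L..17*L} \<times> {L..17*L}) \<times> ({L..17*L} \<times> {L..17*L})"
    "\<And>n1 n2 n3 n4. ((n1, n2), (n3, n4)) \<in> Q \<Longrightarrow> n1\<^sup>2 + n2\<^sup>2 = n3\<^sup>2 + n4\<^sup>2"
    "(real L)\<^sup>2 * ln (real L) / 256 \<le> real (card Q)"
proof -
  define X where "X = L div 2"
  have X: "2 * X \<le> L" "real L / 4 \<le> real X"
  proof -
    show "2 * X \<le> L" by (simp add: X_def)
    have "L \<le> 4 * X" using L by (simp add: X_def)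
    then have "real L \<le> real (4 * X)" by (simp only: of_nat_le_iff)
    then show "real L / 4 \<le> real X" by simp
  qed
  \<comment> \<open>With \<open>a\<close> and \<open>c\<close> at most \<open>L\<close> and within a
    factor 2 of each other, the range of \<open>b\<close> puts \<open>d = a * b div c\<close>
    between \<open>2 * L\<close> and \<open>16 * L\<close>. Hence \<open>b - a\<close> and
    \<open>d - c\<close> are at least \<open>L\<close>, and all four numbers lie between
    \<open>L\<close> and \<open>17 * L\<close>.\<close>
  define B where "B a c = {b \<in> {4*L<..8*L}. c dvd a * b}" for a c :: nat
  define T where "T = (SIGMA a:{X<..2*X}. SIGMA c:{X<..2*X}. B a c)"
  have finB: "finite (B a c)" for a c by (simp add: B_def)
  have finT: "finite T" unfolding T_def by (intro finite_SigmaI finB) auto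
  have gB: "gcd a c \<le> card (B a c)" if "a \<in> {X<..2*X}" "c \<in> {X<..2*X}" for a c
  proof -
    \<comment> \<open>Multiples \<open>b\<close> of \<open>c'\<close> satisfy
      \<open>c dvd a * b\<close>. As \<open>c \<le> 4 * L\<close>, an interval of length
      \<open>4 * L\<close> contains at least \<open>c div c' = gcd a c\<close> of them.\<close>
    define c' where "c' = c div gcd a c"
    have c: "c > 0" "c \<le> 4 * L" using that X by auto
    have cc: "c = gcd a c * c'" by (simp add: c'_def)
    then have c': "c' > 0" using c by (metis gr0I mult_0_right less_irrefl)
    have "gcd a c \<le> 4 * L div c'" using c c' cc by (metis div_le_mono nonzero_mult_div_cancel_right less_irrefl)
    also have "\<dots> \<le> card {b \<in> {4*L<..4*L+4*L}. c' dvd b}" by (rule card_multiples_ge[OF c'])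
    also have "\<dots> \<le> card (B a c)"
    proof (rule card_mono[OF finB])
      show "{b \<in> {4*L<..4*L+4*L}. c' dvd b} \<subseteq> B a c"
      proof safe
        fix b assume b: "b \<in> {4*L<..4*L+4*L}" "c' dvd b"
        have "gcd a c * c' dvd a * b" by (rule mult_dvd_mono[OF gcd_dvd1 b(2)])
        then show "b \<in> B a c" using b cc by (simp add: B_def)
      qed
    qed
    finally show ?thesis .
  qed
  define h where "h = (\<lambda>(a, c, b). ((b + a, a * b div c - c), (b - a, a * b div c + c :: nat)))"
  have props: "a \<le> L" "a < b" "c \<le> L" "0 < a" "c > 0" "a * b = c * (a * b div c)" "2 * L \<le> a * b div c" "a * b div c \<le> 16 * L" "4 * L < b" "b \<le> 8 * L"
    if t: "(a, c, b) \<in> T" for a b c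
  proof -
    from t have t: "a \<in> {X<..2*X}" "c \<in> {X<..2*X}" "4 * L < b" "b \<le> 8 * L" "c dvd a * b"
      by (auto simp: T_def B_def)
    then show 1: "a \<le> L" "c \<le> L" "0 < a" "c > 0" "4 * L < b" "b \<le> 8 * L" using X by auto
    then show "a < b" using L by simp
    show "a * b = c * (a * b div c)" using t by simp
    have "2 * L * c \<le> a * b"
    proof -
      have "c \<le> 2 * a" using t by auto
      then have "2 * L * c \<le> 2 * L * (2 * a)" by (rule mult_le_mono2)
      also have "\<dots> = a * (4 * L)" by simp
      also have "\<dots> \<le> a * b" using t by (intro mult_le_mono2) auto
      finally show ?thesis .
    qed
    then show "2 * L \<le> a * b div c" using 1 by (simp add: less_eq_div_iff_mult_less_eq)
    have "a * b \<le> 16 * L * c"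
    proof -
      have "a \<le> 2 * c" using t by auto
      then have "a * b \<le> (2 * c) * (8 * L)" using t by (intro mult_le_mono) auto
      then show ?thesis by (simp add: mult_ac)
    qed
    then have "a * b div c \<le> 16 * L * c div c" by (rule div_le_mono)
    then show "a * b div c \<le> 16 * L" using 1 by simp
  qed
  have inj: "inj_on h T"
  proof (rule inj_onI)
    fix t t' assume tt: "t \<in> T" "t' \<in> T" "h t = h t'"
    obtain a c b a' c' b' where e: "t = (a, c, b)" "t' = (a', c', b')" by (metis prod_cases3)
    note P = props[OF tt(1)[unfolded e]] and P' = props[OF tt(2)[unfolded e]]
    have "b + a = b' + a'" "b - a = b' - a'" "a * b div c - c = a' * b' div c' - c'" "a * b div c + c = a' * b' div c' + c'"
      using tt(3) by (auto simp: e h_def)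
    then show "t = t'" using P P' by (auto simp: e)
  qed
  show thesis
  proof (rule that[of "h ` T"])
    show "finite (h ` T)" using finT by simp
    show "h ` T \<subseteq> ({L..17*L} \<times> {L..17*L}) \<times> ({L..17*L} \<times> {L..17*L})"
    proof (rule image_subsetI)
      fix t assume "t \<in> T"
      moreover obtain a c b where e: "t = (a, c, b)" by (metis prod_cases3)
      ultimately have t: "(a, c, b) \<in> T" by simp
      show "h t \<in> ({L..17*L} \<times> {L..17*L}) \<times> ({L..17*L} \<times> {L..17*L})"
        using props[OF t] by (auto simp: h_def e)
    qed
  next
    fix n1 n2 n3 n4 assume "((n1, n2), (n3, n4)) \<in> h ` T"
    then obtain a c b where t: "(a, c, b) \<in> T" "((n1, n2), (n3, n4)) = h (a, c, b)" by auto
    define d where "d = a * b div c"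
    have n: "n1 = b + a" "n2 = d - c" "n3 = b - a" "n4 = d + c" using t(2) by (auto simp: h_def d_def)
    have "a \<le> b" "c \<le> d" "a * b = c * d" using props[OF t(1)] by (auto simp: d_def)
    then have "(int n1)\<^sup>2 + (int n2)\<^sup>2 = (int n3)\<^sup>2 + (int n4)\<^sup>2" 
    proof -
      have "int a * int b = int c * int d" using \<open>a * b = c * d\<close> by (metis of_nat_mult)
      then show ?thesis using \<open>a \<le> b\<close> \<open>c \<le> d\<close> by (simp add: n of_nat_diff power2_eq_square algebra_simps)
    qed
    then show "n1\<^sup>2 + n2\<^sup>2 = n3\<^sup>2 + n4\<^sup>2"
      by (metis of_nat_add of_nat_power of_nat_eq_iff)
  next
    have cT: "card T = (\<Sum>a\<in>{X<..2*X}. \<Sum>c\<in>{X<..2*X}. card (B a c))"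
      unfolding T_def by (subst card_SigmaI) (auto simp: finB card_SigmaI intro!: finite_SigmaI)
    have "(real L)\<^sup>2 * ln (real L) / 256 = (real L / 4)\<^sup>2 * (ln (real L) / 2) / 8"
      by (simp add: power_divide)
    also have "\<dots> \<le> (real X)\<^sup>2 * ln (real X + 1) / 8"
    proof (intro divide_right_mono mult_mono power_mono X)
      \<comment> \<open>The difference of the two sides is the square of \<open>L / 4 - 1\<close>;
        this replaces \<open>ln L\<close> by \<open>ln X\<close> at the price of a factor 2 for all
        \<open>L\<close>.\<close>
      have "real L \<le> (real L / 4 + 1)\<^sup>2" using sum_power2_ge_zero[of "real L / 4 - 1" 0]
        by (simp add: power2_eq_square algebra_simps)
      then have "ln (real L) \<le> ln ((real L / 4 + 1)\<^sup>2)" using L by (intro ln_mono) auto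
      also have "\<dots> = 2 * ln (real L / 4 + 1)" by (simp add: ln_realpow)
      also have "ln (real L / 4 + 1) \<le> ln (real X + 1)" using X by (intro ln_mono) auto
      finally show "ln (real L) / 2 \<le> ln (real X + 1)" by simp
    qed (use L in auto)
    also have "\<dots> \<le> (\<Sum>a\<in>{X<..2*X}. \<Sum>c\<in>{X<..2*X}. real (gcd a c))" by (rule sum_gcd_ge)
    also have "\<dots> \<le> (\<Sum>a\<in>{X<..2*X}. \<Sum>c\<in>{X<..2*X}. real (card (B a c)))"
      using gB by (intro sum_mono) (simp only: of_nat_le_iff)
    also have "\<dots> = real (card T)" by (simp add: cT)
    also have "card T = card (h ` T)" using inj by (simp add: card_image)
    finally show "(real L)\<^sup>2 * ln (real L) / 256 \<le> real (card (h ` T))" .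
  qed
qed

section \<open>Lower bounds\<close>

lemma sq_term_eq: "sq_term s n x = of_real (real n powr (- 2 * s)) * unit_exp (of_int (int (n\<^sup>2)) * x)"
  by (simp add: sq_term_def)

text \<open>The fourth power of the modulus is the squared modulus of the squared sum, whose
  frequencies are sums of two squares. Its integral adds the positive products of coefficients over
  equal frequencies, so all but the known solutions may be dropped. Each of the four coefficients is
  at least \<open>(17 * L) powr (-2*s)\<close>.\<close>

lemma Lp_pow_4_sum_sq_term_ge:
  assumes s: "s > 0" and L: "L \<ge> 2" and M: "17 * L < M"
  shows "ennreal ((17 * real L) powr (- 8 * s) * ((real L)\<^sup>2 * ln (real L) / 256))
      \<le> Lp_pow 4 (sq_sum s L M)"
proof -
  obtain Q where Q: "finite Q" "Q \<subseteq> ({L..17*L} \<times> {L..17*L}) \<times> ({L..17*L} \<times> {L..17*L})"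
    "\<And>n1 n2 n3 n4. ((n1, n2), (n3, n4)) \<in> Q \<Longrightarrow> n1\<^sup>2 + n2\<^sup>2 = n3\<^sup>2 + n4\<^sup>2"
    "(real L)\<^sup>2 * ln (real L) / 256 \<le> real (card Q)"
    using many_equal_sums_of_two_squares[OF L] by blast
  define I where "I = {L..<M} \<times> {L..<M}"
  define a where "a n = real n powr (- 2 * s)" for n :: nat
  define c where "c = (\<lambda>(i, j). a i * a j)"
  define k where "k = (\<lambda>(i, j). int (i\<^sup>2 + j\<^sup>2 :: nat))"
  define V where "V = (\<Sum>i\<in>I. \<Sum>j\<in>I. if k i = k j then c i * c j else 0)"
  have a0: "a n \<ge> 0" for n by (simp add: a_def)
  have c0: "c i \<ge> 0" for i by (auto simp: c_def a0 split: prod.split)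
  have sq: "(\<Sum>n\<in>{L..<M}. sq_term s n x)\<^sup>2 = (\<Sum>i\<in>I. of_real (c i) * unit_exp (of_int (k i) * x))" for x
  proof -
    have "(\<Sum>n\<in>{L..<M}. sq_term s n x)\<^sup>2 = (\<Sum>i\<in>{L..<M}. \<Sum>j\<in>{L..<M}. sq_term s i x * sq_term s j x)"
      by (simp add: power2_eq_square sum_product)
    also have "\<dots> = (\<Sum>(i, j)\<in>I. sq_term s i x * sq_term s j x)"
      unfolding I_def by (rule sum.cartesian_product)
    also have "\<dots> = (\<Sum>i\<in>I. of_real (c i) * unit_exp (of_int (k i) * x))"
      by (intro sum.cong refl) (auto simp: sq_term_def c_def k_def a_def distrib_right unit_exp_add)
    finally show ?thesis .
  qed
  have "((\<lambda>x. (cmod (\<Sum>i\<in>I. of_real (c i) * unit_exp (of_int (k i) * x)))\<^sup>2) has_integral V) {0..1}"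
    unfolding V_def by (rule has_integral_norm_sq_trig) (simp add: I_def)
  then have "((\<lambda>x. cmod (\<Sum>n\<in>{L..<M}. sq_term s n x) powr 4) has_integral V) {0..1}"
    by (simp add: sq[symmetric] norm_power)
  then have P: "Lp_pow 4 (sq_sum s L M) = ennreal V"
    unfolding Lp_pow_def by (intro nn_integral_has_integral_lebesgue') auto
  have "(17 * real L) powr (- 8 * s) * ((real L)\<^sup>2 * ln (real L) / 256) \<le> (17 * real L) powr (- 8 * s) * real (card Q)"
    by (intro mult_left_mono Q) auto
  also have "\<dots> = (\<Sum>q\<in>Q. (17 * real L) powr (- 8 * s))" by simp
  also have "\<dots> \<le> (\<Sum>(i, j)\<in>Q. c i * c j)"
  proof (rule sum_mono)
    fix q assume q: "q \<in> Q"
    obtain n1 n2 n3 n4 where n: "q = ((n1, n2), (n3, n4))" by (metis prod.collapse)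
    have al: "(17 * real L) powr (- 2 * s) \<le> a n" if "n \<in> {L..17*L}" for n
      unfolding a_def using that L s by (intro powr_mono2') auto
    have "(17 * real L) powr (- 8 * s) = ((17 * real L) powr (- 2 * s) * (17 * real L) powr (- 2 * s)) * ((17 * real L) powr (- 2 * s) * (17 * real L) powr (- 2 * s))"
      by (simp add: powr_add[symmetric])
    also have "\<dots> \<le> (a n1 * a n2) * (a n3 * a n4)"
      using q Q(2) by (intro mult_mono al mult_nonneg_nonneg a0) (auto simp: n)
    finally show "(17 * real L) powr (- 8 * s) \<le> (case q of (i, j) \<Rightarrow> c i * c j)"
      by (simp add: n c_def)
  qed
  also have "\<dots> = (\<Sum>(i, j)\<in>Q. if k i = k j then c i * c j else 0)"
    using Q(3) by (intro sum.cong refl) (auto simp: k_def simp flip: of_nat_add of_nat_power)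
  also have "\<dots> \<le> (\<Sum>(i, j)\<in>I \<times> I. if k i = k j then c i * c j else 0)"
    using Q(2) M by (intro sum_mono2) (fastforce simp: I_def c0)+
  also have "\<dots> = V" unfolding V_def by (rule sum.cartesian_product[symmetric])
  finally show ?thesis unfolding P by (rule ennreal_leI)
qed

text \<open>The \<open>n\<close>-th coefficient counts the pairs with \<open>m' = m + n\<close>
  below \<open>Q\<close>. The truncated difference \<open>Q - n\<close> on naturals is the right
  value beyond the degree as well, namely 0.\<close>

lemma has_integral_Fejer:
  fixes Q :: nat and n :: nat
  shows "((\<lambda>x. Re (unit_exp (of_int (int n) * x)) * (cmod (\<Sum>m<Q. unit_exp (of_int (int m) * x)))\<^sup>2) has_integral real (Q - n)) {0..1}"
proof -
  have eq: "of_real ((cmod (\<Sum>m<Q. unit_exp (of_int (int m) * x)))\<^sup>2) * unit_exp (of_int (int n) * x)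
      = (\<Sum>m<Q. \<Sum>m'<Q. unit_exp (of_int (int m - int m' + int n) * x))" for x
  proof -
    have "complex_of_real ((cmod (\<Sum>m<Q. unit_exp (of_int (int m) * x)))\<^sup>2)
       = (\<Sum>m<Q. unit_exp (of_int (int m) * x)) * cnj (\<Sum>m'<Q. unit_exp (of_int (int m') * x))"
      by (rule complex_norm_square)
    also have "\<dots> = (\<Sum>m<Q. \<Sum>m'<Q. unit_exp (of_int (int m) * x) * unit_exp (- (of_int (int m') * x)))"
      by (simp add: sum_product cnj_unit_exp)
    finally have A: "complex_of_real ((cmod (\<Sum>m<Q. unit_exp (of_int (int m) * x)))\<^sup>2)
       = (\<Sum>m<Q. \<Sum>m'<Q. unit_exp (of_int (int m) * x) * unit_exp (- (of_int (int m') * x)))" .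
    show ?thesis unfolding A sum_distrib_right
      by (intro sum.cong refl) (simp add: unit_exp_add[symmetric] algebra_simps)
  qed
  have "((\<lambda>x. \<Sum>m<Q. \<Sum>m'<Q. unit_exp (of_int (int m - int m' + int n) * x)) has_integral
      (\<Sum>m<Q. \<Sum>m'<Q. if int m - int m' + int n = 0 then 1 else 0)) {0..1}"
    by (intro has_integral_sum has_integral_unit_exp) auto
  then have "((\<lambda>x. of_real ((cmod (\<Sum>m<Q. unit_exp (of_int (int m) * x)))\<^sup>2) * unit_exp (of_int (int n) * x)) has_integral
      (\<Sum>m<Q. \<Sum>m'<Q. if int m - int m' + int n = 0 then 1 else 0)) {0..1}"
    unfolding eq .
  from has_integral_Re[OF this]
  have 1: "((\<lambda>x. Re (unit_exp (of_int (int n) * x)) * (cmod (\<Sum>m<Q. unit_exp (of_int (int m) * x)))\<^sup>2) has_integral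
      Re (\<Sum>m<Q. \<Sum>m'<Q. if int m - int m' + int n = 0 then 1 else 0)) {0..1}"
    by (simp add: mult.commute)
  have "(\<Sum>m<Q. \<Sum>m'<Q. if int m - int m' + int n = 0 then 1 else (0::complex)) = (\<Sum>m<Q. if m < Q - n then 1 else 0)"
  proof (rule sum.cong[OF refl])
    fix m
    have "(\<Sum>m'<Q. if int m - int m' + int n = 0 then 1 else (0::complex)) = (\<Sum>m'<Q. if m' = m + n then 1 else 0)"
      by (intro sum.cong) auto
    also have "\<dots> = (if m < Q - n then 1 else 0)" by (auto simp: sum.delta)
    finally show "(\<Sum>m'<Q. if int m - int m' + int n = 0 then 1 else (0::complex)) = (if m < Q - n then 1 else 0)" .
  qed
  also have "\<dots> = (\<Sum>m<Q - n. 1)" by (rule sum.mono_neutral_cong_right) auto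
  also have "\<dots> = of_nat (Q - n)" by simp
  finally show ?thesis using 1 by simp
qed

text \<open>Testing against the Fejer kernel of degree \<open>8 L\<^sup>2\<close>, which concentrates on \<open>\<bar>x\<bar> \<lesssim> L\<^bsup>-2\<^esup>\<close>, avoids any
  pointwise control of the infinite tail near the origin.\<close>

lemma Lp_pow_sum_sq_term_ge:
  assumes s: "s > 0" and L: "L \<ge> 1" and M: "2 * L \<le> M" and p: "p \<ge> 1"
  defines "b \<equiv> real L * (2 * real L) powr (- 2 * s) / 2"
  shows "ennreal (b powr p / (8 * (real L)\<^sup>2)) \<le> Lp_pow p (sq_sum s L M)"
proof -
  \<comment> \<open>For \<open>n < 2 * L\<close> this makes \<open>n\<^sup>2 \<le> Q / 2\<close>, so
    the first \<open>L\<close> terms keep at least half of the Fejer weight; all further terms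
    contribute nonnegatively. Thus \<open>b\<close> bounds the average of \<open>Re (S x)\<close>
    against the kernel from below.\<close>
  define Q where "Q = 8 * L\<^sup>2"
  have Q: "real Q = 8 * (real L)\<^sup>2" "Q > 0" using L by (auto simp: Q_def)
  have b: "b > 0" using L by (simp add: b_def)
  define D where "D x = (\<Sum>m<Q. unit_exp (of_int (int m) * x))" for x
  define S where "S x = (\<Sum>n\<in>{L..<M}. sq_term s n x)" for x
  define a where "a n = real n powr (- 2 * s)" for n :: nat
  have a0: "a n \<ge> 0" for n by (simp add: a_def)
  have DQ: "(cmod (D x))\<^sup>2 \<le> (real Q)\<^sup>2" for x
  proof (rule power_mono)
    have "cmod (D x) \<le> (\<Sum>m<Q. cmod (unit_exp (of_int (int m) * x)))" unfolding D_def by (rule norm_sum)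
    then show "cmod (D x) \<le> real Q" by simp
  qed simp
  have contS: "continuous_on {0..1} S" unfolding S_def by (intro continuous_on_sum continuous_on_sq_term)
  define I where "I = integral {0..1} (\<lambda>x. cmod (S x) powr p)"
  have "(\<lambda>x. cmod (S x) powr p) integrable_on {0..1}"
    using p contS by (intro integrable_continuous_real continuous_on_powr' continuous_intros) auto
  then have I: "((\<lambda>x. cmod (S x) powr p) has_integral I) {0..1}" unfolding I_def by (rule integrable_integral)
  then have P: "Lp_pow p S = ennreal I"
    unfolding Lp_pow_def by (intro nn_integral_has_integral_lebesgue') auto
  have D1: "((\<lambda>x. (cmod (D x))\<^sup>2) has_integral real Q) {0..1}"
    using has_integral_Fejer[of 0 Q] by (simp add: D_def)
  define W where "W = (\<Sum>n\<in>{L..<M}. a n * real (Q - n\<^sup>2))"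
  have "((\<lambda>x. \<Sum>n\<in>{L..<M}. a n * (Re (unit_exp (of_int (int (n\<^sup>2)) * x)) * (cmod (D x))\<^sup>2)) has_integral W) {0..1}"
    unfolding W_def D_def by (intro has_integral_sum has_integral_mult_right has_integral_Fejer) auto
  also have "(\<lambda>x. \<Sum>n\<in>{L..<M}. a n * (Re (unit_exp (of_int (int (n\<^sup>2)) * x)) * (cmod (D x))\<^sup>2)) = (\<lambda>x. Re (S x) * (cmod (D x))\<^sup>2)"
    unfolding S_def sq_term_eq a_def Re_sum sum_distrib_right by (simp add: mult_ac)
  finally have SD: "((\<lambda>x. Re (S x) * (cmod (D x))\<^sup>2) has_integral W) {0..1}" .
  have W: "b * real Q \<le> W"
  proof -
    have "b * real Q = (\<Sum>n\<in>{L..<2*L}. (2 * real L) powr (- 2 * s) * (real Q / 2))"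
      by (simp add: b_def)
    also have "\<dots> \<le> (\<Sum>n\<in>{L..<2*L}. a n * real (Q - n\<^sup>2))"
    proof (intro sum_mono mult_mono)
      fix n assume n: "n \<in> {L..<2*L}"
      show "(2 * real L) powr (- 2 * s) \<le> a n"
        unfolding a_def using n s L by (intro powr_mono2') auto
      have "n\<^sup>2 \<le> (2 * L)\<^sup>2" using n by (intro power_mono) auto
      then have "2 * n\<^sup>2 \<le> Q" by (simp add: Q_def power_mult_distrib)
      then have "real (2 * n\<^sup>2) \<le> real Q" "n\<^sup>2 \<le> Q" by (simp_all only: of_nat_le_iff)
      then show "real Q / 2 \<le> real (Q - n\<^sup>2)" by (simp add: of_nat_diff)
    qed (auto simp: a0)
    also have "\<dots> \<le> W" unfolding W_def using M by (intro sum_mono2) (auto simp: a0)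
    finally show ?thesis .
  qed
  \<comment> \<open>A minorant of \<open>cmod (S x) powr p\<close> that is linear in
    \<open>Re (S x)\<close>: the tangent at the value \<open>b\<close>, times the kernel divided by
    its maximum \<open>(real Q)\<^sup>2\<close>. Its integral follows from the Fejer coefficients
    alone.\<close>
  define h where "h x = b powr p / (real Q)\<^sup>2 * ((1 - p) * (cmod (D x))\<^sup>2 + p / b * (Re (S x) * (cmod (D x))\<^sup>2))" for x
  have hI: "(h has_integral b powr p / (real Q)\<^sup>2 * ((1 - p) * real Q + p / b * W)) {0..1}"
    unfolding h_def by (intro has_integral_mult_right has_integral_add D1 SD)
  have hle: "h x \<le> cmod (S x) powr p" for x
  proof -
    have "h x = b powr p * (1 + p * (Re (S x) / b - 1)) * ((cmod (D x))\<^sup>2 / (real Q)\<^sup>2)"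
      using b by (simp add: h_def algebra_simps add_divide_distrib diff_divide_distrib)
    also have "\<dots> \<le> cmod (S x) powr p * ((cmod (D x))\<^sup>2 / (real Q)\<^sup>2)"
    proof (intro mult_right_mono)
      have "b powr p * (1 + p * (Re (S x) / b - 1)) \<le> b powr p * (1 + p * (cmod (S x) / b - 1))"
        using b p by (intro mult_left_mono add_left_mono diff_right_mono divide_right_mono complex_Re_le_cmod) auto
      also have "\<dots> \<le> b powr p * (cmod (S x) / b) powr p"
        using b p by (intro mult_left_mono powr_ge_tangent) auto
      also have "\<dots> = cmod (S x) powr p" using b by (simp add: powr_divide)
      finally show "b powr p * (1 + p * (Re (S x) / b - 1)) \<le> cmod (S x) powr p" .
    qed auto
    also have "\<dots> \<le> cmod (S x) powr p * 1"
      using DQ[of x] Q by (intro mult_left_mono) (auto simp: divide_le_eq_1)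
    finally show ?thesis by simp
  qed
  have "b powr p / real Q = b powr p / (real Q)\<^sup>2 * ((1 - p) * real Q + p / b * (b * real Q))"
    using b Q by (simp add: field_simps power2_eq_square)
  also have "\<dots> \<le> b powr p / (real Q)\<^sup>2 * ((1 - p) * real Q + p / b * W)"
    using b p by (intro mult_left_mono add_left_mono W) auto
  also have "\<dots> \<le> I" by (rule has_integral_le[OF hI I hle])
  finally show ?thesis using P unfolding Q S_def[abs_def] by (simp add: ennreal_leI)
qed

section \<open>Norms of the limiting tail\<close>

lemma Lp_limit_lower_value:
  assumes "Lp_limit p S g" "\<And>M. S M \<in> borel_measurable borel" "p \<ge> 1" "v \<ge> 0"
    and "\<forall>\<^sub>F M in sequentially. ennreal v \<le> Lp_pow p (S M)"
    and "Lp_pow p g < \<infinity>"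
  shows "v \<le> enn2real (Lp_pow p g)"
proof -
  have "(v powr (1/p)) powr p \<le> enn2real (Lp_pow p g)"
    using assms by (intro Lp_limit_lower[of p S g]) (auto simp: powr_powr)
  then show ?thesis using assms by (simp add: powr_powr)
qed

lemma enn2real_Lp_pow_le: "Lp_bound p g a \<Longrightarrow> enn2real (Lp_pow p g) \<le> a powr p"
  by (auto simp: Lp_bound_def intro!: enn2real_leI)

lemma Lp_bound_finite: "Lp_bound p g a \<Longrightarrow> Lp_pow p g < \<infinity>"
  by (auto simp: Lp_bound_def intro: le_less_trans)

lemma L2_tail_lower:
  assumes s: "s > 0" and L: "L \<ge> 1" and M: "2 * L \<le> M"
  shows "ennreal (2 powr (- 4 * s) * (real L powr (1/2 - 2 * s)) powr 2) \<le> Lp_pow 2 (sq_sum s L M)"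
proof -
  have "Lp_pow 2 (sq_sum s L M) = ennreal (\<Sum>n\<in>{L..<M}. (real n powr (- 2 * s))\<^sup>2)"
    unfolding sq_term_eq by (rule Lp_pow_2_trig) (auto simp: inj_on_def simp del: of_nat_power)
  moreover have "2 powr (- 4 * s) * (real L powr (1/2 - 2 * s)) powr 2 \<le> (\<Sum>n\<in>{L..<M}. (real n powr (- 2 * s))\<^sup>2)"
  proof -
    have "2 powr (- 4 * s) * (real L powr (1/2 - 2 * s)) powr 2 = real L * (2 * real L) powr (- 4 * s)"
    proof -
      have "(real L powr (1/2 - 2 * s)) powr 2 = real L powr (1 + (- 4 * s))" unfolding powr_powr by (simp add: algebra_simps)
      also have "\<dots> = real L * real L powr (- 4 * s)" using L unfolding powr_add by simp
      finally show ?thesis unfolding powr_mult by simp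
    qed
    also have "\<dots> = (\<Sum>n\<in>{L..<2*L}. (2 * real L) powr (- 4 * s))" by simp
    also have "\<dots> \<le> (\<Sum>n\<in>{L..<2*L}. (real n powr (- 2 * s))\<^sup>2)"
    proof (rule sum_mono)
      fix n assume n: "n \<in> {L..<2*L}"
      have "(2 * real L) powr (- 4 * s) \<le> real n powr (- 4 * s)"
        using n s L by (intro powr_mono2') auto
      also have "\<dots> = (real n powr (- 2 * s))\<^sup>2" using n L by (simp add: power2_eq_square powr_add[symmetric])
      finally show "(2 * real L) powr (- 4 * s) \<le> (real n powr (- 2 * s))\<^sup>2" .
    qed
    also have "\<dots> \<le> (\<Sum>n\<in>{L..<M}. (real n powr (- 2 * s))\<^sup>2)" using M by (intro sum_mono2) auto
    finally show ?thesis .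
  qed
  ultimately show ?thesis by (simp add: ennreal_leI)
qed

text \<open>Separates the factor coming from the 2-norm, which cancels in the flatness, from the
  growth factor that survives.\<close>

lemma tail_rate_powr:
  assumes "L \<ge> 1" "p > 0"
  shows "tail_rate p s L powr p = (L powr (1/2 - 2 * s)) powr p * growth p L"
proof -
  have "tail_rate p s L = L powr (- 2 * s) * L powr (1/2) * growth p L powr (1/p)"
    using assms by (simp add: tail_rate_def gauss_rate_def powr_half_sqrt)
  also have "L powr (- 2 * s) * L powr (1/2) = L powr (1/2 - 2 * s)"
    unfolding powr_add[symmetric] by simp
  finally have "tail_rate p s L powr p = (L powr (1/2 - 2 * s)) powr p * (growth p L powr (1/p)) powr p"
    by (simp only: powr_mult)
  also have "(growth p L powr (1/p)) powr p = growth p L" using assms growth_pos[of L p] by (simp add: powr_powr)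
  finally show ?thesis .
qed

section \<open>Flatness\<close>

lemma L2_tail_bounds:
  assumes s: "s > 1/4"
  obtains c C where "c > 0" "C > 0"
    "\<And>L g. L \<ge> 1 \<Longrightarrow> Lp_limit 2 (sq_sum s L) g \<Longrightarrow>
       c * (real L powr (1/2 - 2 * s)) powr 2 \<le> enn2real (Lp_pow 2 g) \<and>
       enn2real (Lp_pow 2 g) \<le> C * (real L powr (1/2 - 2 * s)) powr 2"
proof -
  have "s > s_star 2" using s by (simp add: s_star_def)
  then obtain C where C: "C > 0"
    "\<And>L M. L \<ge> 1 \<Longrightarrow> Lp_bound 2 (sq_sum s L M) (C * tail_rate 2 s (real L))"
    using Lp_bound_tail[of 2 s] by auto
  show thesis
  proof (rule that[of "2 powr (- 4 * s)" "C powr 2"])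
    fix L g assume L: "L \<ge> 1" and g: "Lp_limit 2 (sq_sum s L) g"
    have b: "Lp_bound 2 g (C * tail_rate 2 s (real L))"
      by (rule Lp_limit_upper[OF g C(2)[OF L]]) simp
    have "enn2real (Lp_pow 2 g) \<le> (C * tail_rate 2 s (real L)) powr 2"
      by (rule enn2real_Lp_pow_le[OF b])
    also have "\<dots> = C powr 2 * (real L powr (1/2 - 2 * s)) powr 2"
      using L tail_rate_powr[of "real L" 2 s] by (simp only: powr_mult) (simp add: growth_def)
    finally have 1: "enn2real (Lp_pow 2 g) \<le> C powr 2 * (real L powr (1/2 - 2 * s)) powr 2" .
    have 2: "2 powr (- 4 * s) * (real L powr (1/2 - 2 * s)) powr 2 \<le> enn2real (Lp_pow 2 g)"
    proof (rule Lp_limit_lower_value[OF g])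
      show "\<forall>\<^sub>F M in sequentially. ennreal (2 powr (- 4 * s) * (real L powr (1/2 - 2 * s)) powr 2)
          \<le> Lp_pow 2 (sq_sum s L M)"
        using eventually_ge_at_top[of "2 * L"] by eventually_elim (use s L in \<open>intro L2_tail_lower, auto\<close>)
    qed (use Lp_bound_finite[OF b] in \<open>auto simp del: powr_numeral\<close>)
    show "2 powr (- 4 * s) * (real L powr (1/2 - 2 * s)) powr 2 \<le> enn2real (Lp_pow 2 g) \<and>
       enn2real (Lp_pow 2 g) \<le> C powr 2 * (real L powr (1/2 - 2 * s)) powr 2"
      using 1 2 by blast
  qed (use C in auto)
qed

text \<open>Counting solutions yields the bare \<open>ln K\<close> at \<open>p = 4\<close>, without
  the summand 2 of \<open>growth\<close>; for large \<open>K\<close> the two are comparable.\<close>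

definition growth_low :: "real \<Rightarrow> real \<Rightarrow> real" where
  "growth_low p K = (if p < 4 then 1 else if p = 4 then ln K else K powr (p/2 - 2))"

lemma L2_le_Lp:
  assumes "Lp_bound p g a" "p \<ge> 2"
  shows "enn2real (Lp_pow 2 g) powr (p/2) \<le> enn2real (Lp_pow p g)"
proof -
  define b where "b = enn2real (Lp_pow p g) powr (1 / p)"
  have bp: "b powr p = enn2real (Lp_pow p g)" using assms by (simp add: b_def powr_powr)
  have gb: "Lp_bound p g b"
    unfolding Lp_bound_def bp using assms Lp_bound_finite[OF assms(1)] by (auto simp: Lp_bound_def b_def)
  have b0: "b \<ge> 0" by (simp add: b_def)
  \<comment> \<open>The comparison of exponents needs a positive bound, whereas the norm
    \<open>b\<close> may be 0.\<close>
  have "sqrt (enn2real (Lp_pow 2 g)) \<le> b + \<epsilon>" if "\<epsilon> > 0" for \<epsilon>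
  proof -
    have "Lp_bound p g (b + \<epsilon>)" by (rule Lp_bound_mono[OF gb]) (use that assms in auto)
    then have "Lp_bound 2 g (b + \<epsilon>)" using that assms b0 by (intro Lp_bound_lower_exponent) auto
    then have "enn2real (Lp_pow 2 g) \<le> (b + \<epsilon>) powr 2" by (rule enn2real_Lp_pow_le)
    then show ?thesis using that b0 by (intro real_le_lsqrt) auto
  qed
  then have "sqrt (enn2real (Lp_pow 2 g)) \<le> b" by (rule field_le_epsilon)
  then have "sqrt (enn2real (Lp_pow 2 g)) powr p \<le> b powr p" using assms by (intro powr_mono2) auto
  then show ?thesis by (simp add: bp powr_half_sqrt[symmetric] powr_powr)
qed

lemma Lp_tail_lower:
  assumes p: "p \<ge> 4" and s: "s > s_star p"
  obtains c where "c > 0"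
    "\<And>L g. L \<ge> 2 \<Longrightarrow> Lp_limit p (sq_sum s L) g \<Longrightarrow> Lp_pow p g < \<infinity> \<Longrightarrow>
       c * (real L powr (1/2 - 2 * s)) powr p * growth_low p (real L) \<le> enn2real (Lp_pow p g)"
proof (cases "p = 4")
  case True
  have s0: "s > 0" using s s_star_ge[of p] p by simp
  show thesis
  proof (rule that[of "17 powr (- 8 * s) / 256"])
    fix L g assume L: "L \<ge> 2" and g: "Lp_limit p (sq_sum s L) g" and fin: "Lp_pow p g < \<infinity>"
    have e: "17 powr (- 8 * s) / 256 * (real L powr (1/2 - 2 * s)) powr p * growth_low p (real L)
        = (17 * real L) powr (- 8 * s) * ((real L)\<^sup>2 * ln (real L) / 256)"
    proof -
      have "(real L powr (1/2 - 2 * s)) powr p = real L powr (2 + (- 8 * s))"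
        unfolding powr_powr True by (simp add: algebra_simps)
      also have "\<dots> = (real L)\<^sup>2 * real L powr (- 8 * s)" using L unfolding powr_add by simp
      finally show ?thesis unfolding powr_mult by (simp add: True growth_low_def)
    qed
    show "17 powr (- 8 * s) / 256 * (real L powr (1/2 - 2 * s)) powr p * growth_low p (real L) \<le> enn2real (Lp_pow p g)"
      unfolding e
    proof (rule Lp_limit_lower_value[OF g _ _ _ _ fin])
      show "\<forall>\<^sub>F M in sequentially. ennreal ((17 * real L) powr (- 8 * s) * ((real L)\<^sup>2 * ln (real L) / 256))
          \<le> Lp_pow p (sq_sum s L M)"
        using eventually_gt_at_top[of "17 * L"] unfolding True
        by eventually_elim (use s0 L in \<open>intro Lp_pow_4_sum_sq_term_ge, auto\<close>)
    qed (use p L in auto)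
  qed simp
next
  case False
  then have p4: "p > 4" using p by simp
  have s0: "s > 0" using s s_star_ge[of p] p by simp
  show thesis
  proof (rule that[of "2 powr (- (1 + 2 * s) * p) / 8"])
    fix L g assume L: "L \<ge> 2" and g: "Lp_limit p (sq_sum s L) g" and fin: "Lp_pow p g < \<infinity>"
    have e: "2 powr (- (1 + 2 * s) * p) / 8 * (real L powr (1/2 - 2 * s)) powr p * growth_low p (real L)
        = (real L * (2 * real L) powr (- 2 * s) / 2) powr p / (8 * (real L)\<^sup>2)"
    proof -
      have "(2::real) powr (- (1 + 2 * s)) = 2 powr (- 1 + (- 2 * s))" by simp
      also have "\<dots> = 2 powr (- 1) * 2 powr (- 2 * s)" by (rule powr_add)
      finally have t: "(2::real) powr (- (1 + 2 * s)) = 2 powr (- 2 * s) / 2" by (simp add: powr_minus)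
      have "real L powr (1 - 2 * s) = real L powr (1 + (- 2 * s))" by simp
      also have "\<dots> = real L * real L powr (- 2 * s)" using L unfolding powr_add by simp
      finally have l: "real L powr (1 - 2 * s) = real L * real L powr (- 2 * s)" .
      have "real L * (2 * real L) powr (- 2 * s) / 2 = 2 powr (- (1 + 2 * s)) * real L powr (1 - 2 * s)"
        unfolding t l powr_mult by simp
      then have "(real L * (2 * real L) powr (- 2 * s) / 2) powr p = 2 powr (- (1 + 2 * s) * p) * real L powr ((1 - 2 * s) * p)"
        unfolding powr_powr[symmetric] powr_mult[symmetric] by simp
      moreover have "real L powr ((1 - 2 * s) * p) = (real L powr (1/2 - 2 * s)) powr p * real L powr (p/2 - 2) * (real L)\<^sup>2"
      proof -
        have "(real L)\<^sup>2 = real L powr 2" using L by simp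
        then have "(real L powr (1/2 - 2 * s)) powr p * real L powr (p/2 - 2) * (real L)\<^sup>2
            = real L powr ((1/2 - 2 * s) * p + (p/2 - 2) + 2)"
          by (simp only: powr_powr powr_add)
        also have "(1/2 - 2 * s) * p + (p/2 - 2) + 2 = (1 - 2 * s) * p" by (simp add: algebra_simps)
        finally show ?thesis ..
      qed
      ultimately show ?thesis using p4 L by (simp add: growth_low_def)
    qed
    show "2 powr (- (1 + 2 * s) * p) / 8 * (real L powr (1/2 - 2 * s)) powr p * growth_low p (real L) \<le> enn2real (Lp_pow p g)"
      unfolding e
    proof (rule Lp_limit_lower_value[OF g _ _ _ _ fin])
      show "\<forall>\<^sub>F M in sequentially. ennreal ((real L * (2 * real L) powr (- 2 * s) / 2) powr p / (8 * (real L)\<^sup>2))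
          \<le> Lp_pow p (sq_sum s L M)"
        using eventually_ge_at_top[of "2 * L"]
        by eventually_elim (use s0 L p in \<open>intro Lp_pow_sum_sq_term_ge, auto\<close>)
    qed (use p in auto)
  qed simp
qed

text \<open>With \<open>W = L powr (1/2 - 2*s)\<close>, the denominator lies between constant
  multiples of \<open>W powr p\<close>, and the numerator carries the same factor in the upper bound
  and, for \<open>p \<ge> 4\<close>, in the lower one.\<close>

lemma flatness_tail:
  assumes p: "p \<ge> 2" and s: "s > s_star p"
  obtains c C where "c > 0" "C > 0"
    "\<And>L g. L \<ge> 2 \<Longrightarrow> Lp_limit p (sq_sum s L) g \<Longrightarrow>
       c * growth_low p (real L) \<le> flatness p g \<and> flatness p g \<le> C * growth p (real L)"
proof -
  have s4: "s > 1/4" using s s_star_ge[OF p] by simp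
  obtain C where C: "C > 0"
    "\<And>L M. L \<ge> 1 \<Longrightarrow> Lp_bound p (sq_sum s L M) (C * tail_rate p s (real L))"
    using Lp_bound_tail[OF p s] by blast
  obtain c2 C2 where c2: "c2 > 0" "C2 > 0"
    "\<And>L g. L \<ge> 1 \<Longrightarrow> Lp_limit 2 (sq_sum s L) g \<Longrightarrow>
       c2 * (real L powr (1/2 - 2 * s)) powr 2 \<le> enn2real (Lp_pow 2 g) \<and>
       enn2real (Lp_pow 2 g) \<le> C2 * (real L powr (1/2 - 2 * s)) powr 2"
    using L2_tail_bounds[OF s4] by metis
  \<comment> \<open>The premise \<open>p \<ge> 4\<close> sits inside the statement so that one
    constant is available in all cases; below 4 the claim is vacuous and any positive value
    serves.\<close>
  obtain cl where cl: "cl > 0"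
    "\<And>L g. p \<ge> 4 \<Longrightarrow> L \<ge> 2 \<Longrightarrow> Lp_limit p (sq_sum s L) g \<Longrightarrow> Lp_pow p g < \<infinity> \<Longrightarrow>
       cl * (real L powr (1/2 - 2 * s)) powr p * growth_low p (real L) \<le> enn2real (Lp_pow p g)"
  proof (cases "p \<ge> 4")
    case True
    from Lp_tail_lower[OF True s] show thesis using that by metis
  next
    case False
    then show thesis using that[of 1] by simp
  qed
  define A where "A = C2 powr (p/2)"
  define B where "B = c2 powr (p/2)"
  have AB: "A > 0" "B > 0" using c2 by (auto simp: A_def B_def)
  \<comment> \<open>The value 1 is the constant of the comparison of exponents for
    \<open>p < 4\<close>, and \<open>cl / A\<close> that of the lower bounds for
    \<open>p \<ge> 4\<close>.\<close>
  show thesis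
  proof (rule that[of "min 1 (cl / A)" "C powr p / B"])
    show "min 1 (cl / A) > 0" "C powr p / B > 0" using AB cl C by auto
    fix L g assume L: "L \<ge> 2" and g: "Lp_limit p (sq_sum s L) g"
    have L1: "L \<ge> 1" using L by simp
    define W where "W = real L powr (1/2 - 2 * s)"
    define E2 where "E2 = enn2real (Lp_pow 2 g)"
    define Ep where "Ep = enn2real (Lp_pow p g)"
    have W: "W > 0" using L by (simp add: W_def)
    have g2: "Lp_limit 2 (sq_sum s L) g"
      by (rule Lp_limit_imp_L2_limit[OF g p]) simp
    have E2: "c2 * W powr 2 \<le> E2" "E2 \<le> C2 * W powr 2"
      using c2(3)[OF L1 g2] by (auto simp: W_def E2_def simp del: powr_numeral)
    have WW: "(k * W powr 2) powr (p/2) = k powr (p/2) * W powr p" for k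
      unfolding powr_mult powr_powr by simp
    have "(c2 * W powr 2) powr (p/2) \<le> E2 powr (p/2)"
      using p c2 by (intro powr_mono2 E2) auto
    then have lo: "B * W powr p \<le> E2 powr (p/2)" unfolding WW B_def .
    have "E2 powr (p/2) \<le> (C2 * W powr 2) powr (p/2)"
      using p c2 by (intro powr_mono2 E2) (auto simp: E2_def)
    then have hi: "E2 powr (p/2) \<le> A * W powr p" unfolding WW A_def .
    \<comment> \<open>Division by 0 has the value 0, so a positive denominator is essential for the
      lower bound on the flatness.\<close>
    have Epos: "E2 powr (p/2) > 0" using lo AB W by (smt (verit) mult_pos_pos powr_gt_zero)
    have b: "Lp_bound p g (C * tail_rate p s (real L))"
      by (rule Lp_limit_upper[OF g C(2)[OF L1]]) (use p in auto)
    have "Ep \<le> (C * tail_rate p s (real L)) powr p"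
      unfolding Ep_def by (rule enn2real_Lp_pow_le[OF b])
    also have "\<dots> = C powr p * (W powr p * growth p (real L))"
      using L p tail_rate_powr[of "real L" p s] by (simp only: powr_mult) (simp add: W_def)
    finally have Ep: "Ep \<le> C powr p * (W powr p * growth p (real L))" .
    have lam0: "growth p (real L) > 0" using L by (intro growth_pos) auto
    have "Ep / E2 powr (p/2) \<le> C powr p * (W powr p * growth p (real L)) / (B * W powr p)"
      using Ep lo AB W lam0 by (intro frac_le) (auto simp: Ep_def)
    also have "\<dots> = C powr p / B * growth p (real L)" using W by simp
    finally have up: "flatness p g \<le> C powr p / B * growth p (real L)"
      by (simp add: flatness_def Ep_def E2_def)
    have low0: "growth_low p (real L) \<ge> 0" using L by (simp add: growth_low_def)
    have "min 1 (cl / A) * growth_low p (real L) \<le> Ep / E2 powr (p/2)"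
    proof (cases "p < 4")
      case True
      have "E2 powr (p/2) \<le> Ep" unfolding E2_def Ep_def by (rule L2_le_Lp[OF b p])
      then have "1 \<le> Ep / E2 powr (p/2)" using Epos by simp
      moreover have "growth_low p (real L) = 1" using True by (simp add: growth_low_def)
      ultimately show ?thesis by simp
    next
      case False
      have "min 1 (cl / A) * growth_low p (real L) \<le> cl / A * growth_low p (real L)"
        using low0 by (intro mult_right_mono) auto
      also have "\<dots> = cl * W powr p * growth_low p (real L) / (A * W powr p)" using W by simp
      also have "\<dots> \<le> Ep / E2 powr (p/2)"
      proof (rule frac_le)
        show "cl * W powr p * growth_low p (real L) \<le> Ep"
          unfolding W_def Ep_def using False by (intro cl(2)[OF _ L g Lp_bound_finite[OF b]]) auto
      qed (use hi Epos in \<open>auto simp: Ep_def\<close>)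
      finally show ?thesis .
    qed
    then show "min 1 (cl / A) * growth_low p (real L) \<le> flatness p g \<and> flatness p g \<le> C powr p / B * growth p (real L)"
      using up by (simp add: flatness_def Ep_def E2_def)
  qed
qed

section \<open>From the frequency cutoff to the first index\<close>

text \<open>The ceiling of \<open>sqrt N\<close>, with value 1 at \<open>N = 0\<close>, in keeping
  with a series that starts at \<open>n = 1\<close>.\<close>

definition sqrt_ceil :: "nat \<Rightarrow> nat" where
  "sqrt_ceil N = (LEAST n. 1 \<le> n \<and> N \<le> n\<^sup>2)"

lemma sqrt_ceil:
  shows sqrt_ceil_ge_1: "1 \<le> sqrt_ceil N" and le_sqrt_ceil: "N \<le> (sqrt_ceil N)\<^sup>2"
    and sqrt_ceil_le: "1 \<le> n \<Longrightarrow> N \<le> n\<^sup>2 \<Longrightarrow> sqrt_ceil N \<le> n"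
proof -
  have "1 \<le> N + 1 \<and> N \<le> (N + 1)\<^sup>2" by (simp add: power2_eq_square)
  then have "1 \<le> sqrt_ceil N \<and> N \<le> (sqrt_ceil N)\<^sup>2"
    unfolding sqrt_ceil_def by (rule LeastI)
  then show "1 \<le> sqrt_ceil N" "N \<le> (sqrt_ceil N)\<^sup>2" by auto
  show "sqrt_ceil N \<le> n" if "1 \<le> n" "N \<le> n\<^sup>2"
    unfolding sqrt_ceil_def using that by (intro Least_le) simp
qed

lemma sqrt_ceil_bounds:
  assumes "N \<ge> 1"
  shows "sqrt (real N) \<le> real (sqrt_ceil N)" "real (sqrt_ceil N) \<le> 2 * sqrt (real N)"
proof -
  have "real N \<le> real ((sqrt_ceil N)\<^sup>2)" using le_sqrt_ceil by (simp only: of_nat_le_iff)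
  then show "sqrt (real N) \<le> real (sqrt_ceil N)" by (simp add: real_le_lsqrt)
  have s1: "sqrt (real N) \<ge> 1" using assms by simp
  show "real (sqrt_ceil N) \<le> 2 * sqrt (real N)"
  proof (cases "sqrt_ceil N = 1")
    case False
    then have L: "sqrt_ceil N \<ge> 2" using sqrt_ceil_ge_1[of N] by simp
    then have "1 \<le> sqrt_ceil N - 1" by simp
    then have "\<not> N \<le> (sqrt_ceil N - 1)\<^sup>2"
      using sqrt_ceil_le[of "sqrt_ceil N - 1" N] L by linarith
    then have "real ((sqrt_ceil N - 1)\<^sup>2) < real N" by (simp only: of_nat_less_iff not_le)
    then have "real (sqrt_ceil N - 1) < sqrt (real N)" by (simp add: real_less_rsqrt)
    then show ?thesis using s1 L by (simp add: of_nat_diff)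
  next
    case True
    then have "real (sqrt_ceil N) = 1" by simp
    then show ?thesis using s1 by linarith
  qed
qed

lemma Rs_high_partial_eq:
  "Rs_high_partial s N M x = (\<Sum>n\<in>{sqrt_ceil N..<Suc M}. sq_term s n x)"
proof -
  have "{n. 1 \<le> n \<and> N \<le> n ^ 2 \<and> n \<le> M} = {sqrt_ceil N..<Suc M}"
  proof (intro set_eqI iffI)
    fix n assume "n \<in> {sqrt_ceil N..<Suc M}"
    then have n: "sqrt_ceil N \<le> n" "n \<le> M" by auto
    then have "(sqrt_ceil N)\<^sup>2 \<le> n\<^sup>2" by (intro power_mono) auto
    then have "N \<le> n\<^sup>2" using le_sqrt_ceil[of N] by linarith
    then show "n \<in> {n. 1 \<le> n \<and> N \<le> n ^ 2 \<and> n \<le> M}"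
      using n le_sqrt_ceil[of N] sqrt_ceil_ge_1[of N] by auto
  qed (auto intro: sqrt_ceil_le)
  then show ?thesis unfolding Rs_high_partial_def sq_term_def unit_exp_def by (simp add: mult.assoc)
qed

lemma Lp_limit_Rs_high_partial:
  "Lp_limit p (Rs_high_partial s N) g \<longleftrightarrow> Lp_limit p (sq_sum s (sqrt_ceil N)) g"
  unfolding Lp_limit_def Rs_high_partial_eq
  \<comment> \<open>The partial sums include the index \<open>M\<close>, the half-open sums do not;
    a shift of the sequence by one leaves its limit unchanged.\<close>
  using filterlim_sequentially_Suc[of "\<lambda>M. Lp_pow p (\<lambda>x. (\<Sum>n\<in>{sqrt_ceil N..<M}. sq_term s n x) - g x)" "nhds 0"]
  by simp

text \<open>The index cutoff is at most \<open>2 * sqrt N\<close>, which turns the exponent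
  \<open>p/2 - 2\<close> into \<open>p/4 - 1\<close>. From \<open>N = 3\<close> on
  \<open>ln N \<ge> 1\<close>, so the additive constants at \<open>p = 4\<close> are
  absorbed.\<close>

lemma growth_le_flat_rate:
  assumes p: "p \<ge> 2" and N: "N \<ge> 3"
  shows "growth p (real (sqrt_ceil N)) \<le> max 4 (2 powr (p/2 - 2)) * flat_rate p N"
proof -
  have N1: "N \<ge> 1" using N by simp
  note L = sqrt_ceil_bounds[OF N1]
  have L1: "real (sqrt_ceil N) \<ge> 1" using sqrt_ceil_ge_1[of N] by simp
  have lnN: "ln (real N) \<ge> 1"
  proof -
    have "exp 1 \<le> real N" using exp_le N by linarith
    then have "ln (exp 1) \<le> ln (real N)" by (intro ln_mono) auto
    then show ?thesis by simp
  qed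
  consider "p < 4" | "p = 4" | "p > 4" by linarith
  then show ?thesis
  proof cases
    case 1
    then show ?thesis by (simp add: growth_def flat_rate_def)
  next
    case 2
    have "ln (real (sqrt_ceil N)) \<le> ln (2 * sqrt (real N))" using L L1 by (intro ln_mono) auto
    also have "\<dots> = ln 2 + ln (real N) / 2" using N by (simp add: ln_mult ln_sqrt)
    finally have "2 + ln (real (sqrt_ceil N)) \<le> 3 + ln (real N) / 2" using ln_2_less_1 by simp
    also have "\<dots> \<le> 4 * ln (real N)" using lnN by simp
    also have "\<dots> \<le> max 4 (2 powr (p/2 - 2)) * ln (real N)" using lnN by (intro mult_right_mono) auto
    finally show ?thesis using 2 by (simp add: growth_def flat_rate_def)
  next
    case 3
    have "real (sqrt_ceil N) powr (p/2 - 2) \<le> (2 * sqrt (real N)) powr (p/2 - 2)"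
      using L 3 by (intro powr_mono2) auto
    also have "\<dots> = 2 powr (p/2 - 2) * real N powr (p/4 - 1)"
      unfolding powr_mult by (simp add: powr_half_sqrt[symmetric] powr_powr algebra_simps)
    also have "\<dots> \<le> max 4 (2 powr (p/2 - 2)) * real N powr (p/4 - 1)" by (intro mult_right_mono) auto
    finally show ?thesis using 3 by (simp add: growth_def flat_rate_def)
  qed
qed

lemma flat_rate_le_growth_low:
  assumes p: "p \<ge> 2" and N: "N \<ge> 3"
  shows "flat_rate p N / 2 \<le> growth_low p (real (sqrt_ceil N))"
proof -
  have N1: "N \<ge> 1" using N by simp
  note L = sqrt_ceil_bounds[OF N1]
  consider "p < 4" | "p = 4" | "p > 4" by linarith
  then show ?thesis
  proof cases
    case 1
    then show ?thesis by (simp add: growth_low_def flat_rate_def)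
  next
    case 2
    have "ln (sqrt (real N)) \<le> ln (real (sqrt_ceil N))" using L N by (intro ln_mono) auto
    then show ?thesis using 2 N by (simp add: growth_low_def flat_rate_def ln_sqrt)
  next
    case 3
    have "real N powr (p/4 - 1) / 2 \<le> real N powr (p/4 - 1)" by simp
    also have "\<dots> = sqrt (real N) powr (p/2 - 2)"
      by (simp add: powr_half_sqrt[symmetric] powr_powr algebra_simps)
    also have "\<dots> \<le> real (sqrt_ceil N) powr (p/2 - 2)" using L 3 by (intro powr_mono2) auto
    finally show ?thesis using 3 by (simp add: growth_low_def flat_rate_def)
  qed
qed

theorem theoremA:
  fixes p s :: real
  assumes "p \<ge> 2" and "s > s_star p"
  shows "(\<forall>N. \<exists>g. Lp_limit p (Rs_high_partial s N) g) \<and>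
    (\<exists>c C. c > 0 \<and> C > 0 \<and>
      (\<forall>\<^sub>F N in sequentially. \<forall>g. Lp_limit p (Rs_high_partial s N) g \<longrightarrow>
          c * flat_rate p N \<le> flatness p g \<and> flatness p g \<le> C * flat_rate p N))"
proof
  show "\<forall>N. \<exists>g. Lp_limit p (Rs_high_partial s N) g"
    unfolding Lp_limit_Rs_high_partial using ex_Lp_limit_tail[OF assms] sqrt_ceil_ge_1 by blast
  obtain c C where c: "c > 0" "C > 0"
    "\<And>L g. L \<ge> 2 \<Longrightarrow> Lp_limit p (sq_sum s L) g \<Longrightarrow>
       c * growth_low p (real L) \<le> flatness p g \<and> flatness p g \<le> C * growth p (real L)"
    using flatness_tail[OF assms] by metis
  define K where "K = max 4 (2 powr (p/2 - 2))"
  have K: "K > 0" by (simp add: K_def)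
  show "\<exists>c C. c > 0 \<and> C > 0 \<and>
      (\<forall>\<^sub>F N in sequentially. \<forall>g. Lp_limit p (Rs_high_partial s N) g \<longrightarrow>
          c * flat_rate p N \<le> flatness p g \<and> flatness p g \<le> C * flat_rate p N)"
  proof (rule exI[of _ "c / 2"], rule exI[of _ "C * K"], intro conjI)
    show "\<forall>\<^sub>F N in sequentially. \<forall>g. Lp_limit p (Rs_high_partial s N) g \<longrightarrow>
          c / 2 * flat_rate p N \<le> flatness p g \<and> flatness p g \<le> C * K * flat_rate p N"
      \<comment> \<open>The bound 3 does two things: it exceeds \<open>exp 1\<close>, so that
        \<open>ln N \<ge> 1\<close>, and it forces the first index to be at least 2, as the tail
        estimates require.\<close>
      using eventually_ge_at_top[of 3]
    proof eventually_elim
      case (elim N)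
      have L: "sqrt_ceil N \<ge> 2"
      proof (rule ccontr)
        assume "\<not> sqrt_ceil N \<ge> 2"
        then have "sqrt_ceil N = 1" using sqrt_ceil_ge_1[of N] by simp
        then show False using le_sqrt_ceil[of N] elim by simp
      qed
      show ?case
      proof (intro allI impI)
        fix g assume "Lp_limit p (Rs_high_partial s N) g"
        then have g: "Lp_limit p (sq_sum s (sqrt_ceil N)) g"
          by (simp add: Lp_limit_Rs_high_partial)
        have "c / 2 * flat_rate p N = c * (flat_rate p N / 2)" by simp
        also have "\<dots> \<le> c * growth_low p (real (sqrt_ceil N))"
          using c by (intro mult_left_mono flat_rate_le_growth_low assms elim) auto
        also have "\<dots> \<le> flatness p g" using c(3)[OF L g] by simp
        finally have 1: "c / 2 * flat_rate p N \<le> flatness p g" .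
        have "flatness p g \<le> C * growth p (real (sqrt_ceil N))" using c(3)[OF L g] by simp
        also have "\<dots> \<le> C * (K * flat_rate p N)"
          unfolding K_def using c by (intro mult_left_mono growth_le_flat_rate assms elim) auto
        finally show "c / 2 * flat_rate p N \<le> flatness p g \<and> flatness p g \<le> C * K * flat_rate p N"
          using 1 by (simp add: mult.assoc)
      qed
    qed
  qed (use c K in auto)
qed

end
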